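(* Let $0<m\le n$ with $(m,n)\ne(1,1),(1,2)$, and let $\mathcal{E}$ be a Monge equation $$y^{(m)}=F\bigl(x,y,y',\dots,y^{(m-1)},z,z',\dots,z^{(n)}\bigr)$$ with $F_{z^{(n)}z^{(n)}}\ne0$. Then the algebra of internal symmetries of $\mathcal{E}$ coincides with the algebra of external symmetries of $\mathcal{E}$, i.e. those induced on $\mathcal{E}$ by (infinitesimal) Lie transformations of the ambient mixed jet space $J^{m,n}(\mathbb{R},\mathbb{R}^2)$.
   Context: Here $y=y(x)$, $z=z(x)$ and all considerations are local. The mixed jet space $J^{m,n}(\mathbb{R},\mathbb{R}^2)\simeq\mathbb{R}^{m+n+3}$ has coordinates $(x,y=y_0,y_1,\dots,y_m,z=z_0,z_1,\dots,z_n)$ and carries the canonical rank 3 (Cartan) distribution $$\mathcal{C}=\operatorname{Ann}\{dy_i-y_{i+1}\,dx,\ dz_j-z_{j+1}\,dx \mid 0\le i<m,\ 0\le j<n\}.$$ The equation $\mathcal{E}$ is the hypersurface $\{y_m=F(x,y,\dots,y_{m-1},z,\dots,z_n)\}\subset J^{m,n}(\mathbb{R},\mathbb{R}^2)$, and $\Delta=\mathcal{C}\cap T\mathcal{E}$ is the induced rank 2 distribution on $\mathcal{E}$. An internal symmetry of $\mathcal{E}$ is an (infinitesimal) symmetry of the pair $(\mathcal{E},\Delta)$, i.e. a vector field on $\mathcal{E}$ whose flow preserves $\Delta$. A Lie transformation of $J^{m,n}(\mathbb{R},\mathbb{R}^2)$ is a (local) diffeomorphism preserving $\mathcal{C}$;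 an infinitesimal Lie transformation is a vector field whose flow consists of Lie transformations. An external symmetry of $\mathcal{E}$ is an infinitesimal Lie transformation tangent to $\mathcal{E}$, and it induces an internal symmetry by restriction to $\mathcal{E}$. The condition $F_{z^{(n)}z^{(n)}}\neq0$ is required at every point. *)

theory Defs
  imports "HOL-Analysis.Analysis"
begin

section \<open>Smooth maps\<close>

primrec Ck_on :: "nat \<Rightarrow> 'a::euclidean_space set \<Rightarrow> ('a \<Rightarrow> 'b::euclidean_space) \<Rightarrow> bool" where
  "Ck_on 0 S f \<longleftrightarrow> continuous_on S f"
| "Ck_on (Suc k) S f \<longleftrightarrow>
     (\<exists>f'. (\<forall>x\<in>S. (f has_derivative f' x) (at x)) \<and> (\<forall>v. Ck_on k S (\<lambda>x. f' x v)))"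

text \<open>Smoothness on an arbitrary subset (in particular on a submanifold) means existence of local
  smooth extensions; on an open set it is the same as being \<open>Ck_on k\<close> for all \<open>k\<close>.\<close>

definition smooth_on :: "'a::euclidean_space set \<Rightarrow> ('a \<Rightarrow> 'b::euclidean_space) \<Rightarrow> bool" where
  "smooth_on S f \<longleftrightarrow>
     (\<forall>p\<in>S. \<exists>W g. open W \<and> p \<in> W \<and> (\<forall>k. Ck_on k W g) \<and> (\<forall>w\<in>W \<inter> S. g w = f w))"


section \<open>Infinitesimal symmetries of a distribution\<close>

text \<open>A local flow of \<open>V\<close> on \<open>M\<close>: integral curves inside \<open>M\<close>, defined for \<open>\<bar>t\<bar> < \<epsilon>\<close> and for all
  initial points in \<open>N\<close>, a relatively open subset of \<open>M\<close>. For a smooth field \<open>V\<close> integral curves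
  are unique, and the maps \<open>\<phi> t\<close> are automatically local diffeomorphisms of \<open>M\<close>.\<close>

definition local_flow ::
  "'a::euclidean_space set \<Rightarrow> ('a \<Rightarrow> 'a) \<Rightarrow> real \<Rightarrow> 'a set \<Rightarrow> (real \<Rightarrow> 'a \<Rightarrow> 'a) \<Rightarrow> bool" where
  "local_flow M V \<epsilon> N \<phi> \<longleftrightarrow>
     0 < \<epsilon> \<and> openin (top_of_set M) N \<and>
     (\<forall>w\<in>N. \<phi> 0 w = w \<and>
       (\<forall>t. \<bar>t\<bar> < \<epsilon> \<longrightarrow>
          \<phi> t w \<in> M \<and> ((\<lambda>s. \<phi> s w) has_vector_derivative V (\<phi> t w)) (at t)))"

text \<open>\<open>D w\<close> is a subspace of the tangent space of \<open>M\<close> at \<open>w\<close>. If \<open>M\<close> is a submanifold, a derivative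
  \<open>A\<close> of \<open>f\<close> within \<open>M\<close> is determined only on that tangent space, and there it is the
  differential of \<open>f\<close>.\<close>

definition preserves_at ::
  "'a::euclidean_space set \<Rightarrow> ('a \<Rightarrow> 'a set) \<Rightarrow> ('a \<Rightarrow> 'a) \<Rightarrow> 'a \<Rightarrow> bool" where
  "preserves_at M D f w \<longleftrightarrow> (\<exists>A. (f has_derivative A) (at w within M) \<and> A ` D w = D (f w))"

definition flow_preserves ::
  "'a::euclidean_space set \<Rightarrow> ('a \<Rightarrow> 'a set) \<Rightarrow> ('a \<Rightarrow> 'a) \<Rightarrow> bool" where
  "flow_preserves M D V \<longleftrightarrow>
     (\<forall>q\<in>M. \<exists>\<epsilon> N \<phi>. q \<in> N \<and> local_flow M V \<epsilon> N \<phi> \<and>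
        (\<forall>t w. \<bar>t\<bar> < \<epsilon> \<longrightarrow> w \<in> N \<longrightarrow> preserves_at M D (\<phi> t) w))"


section \<open>Mixed jet spaces\<close>

text \<open>The space of \<open>(m,n)\<close>-jets is the type \<open>('p,'q) jet\<close> with \<open>CARD('p) = m + 1\<close> and
  \<open>CARD('q) = n + 1\<close>. The index types are enumerated by the fixed bijections \<open>from_nat_into UNIV\<close>
  from \<open>{..<CARD('p)}\<close> and \<open>{..<CARD('q)}\<close>. Being a vector space, the same type also serves as the
  tangent space at each point; then \<open>jx\<close>, \<open>jy i\<close> and \<open>jz j\<close> are the coordinate differentials.\<close>

type_synonym ('p, 'q) jet = "real \<times> (real ^ 'p) \<times> (real ^ 'q)"

definition jx :: "('p::finite, 'q::finite) jet \<Rightarrow> real" where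
  "jx w = fst w"

definition jy :: "nat \<Rightarrow> ('p::finite, 'q::finite) jet \<Rightarrow> real" where
  "jy i w = fst (snd w) $ from_nat_into UNIV i"

definition jz :: "nat \<Rightarrow> ('p::finite, 'q::finite) jet \<Rightarrow> real" where
  "jz j w = snd (snd w) $ from_nat_into UNIV j"

definition cartan :: "nat \<Rightarrow> nat \<Rightarrow> ('p::finite, 'q::finite) jet \<Rightarrow> ('p, 'q) jet set" where
  "cartan m n w =
     {v. (\<forall>i<m. jy i v - jy (Suc i) w * jx v = 0) \<and> (\<forall>j<n. jz j v - jz (Suc j) w * jx v = 0)}"

text \<open>The linear projection \<open>(x, y\<^sub>0, \<dots>, y\<^sub>m, z\<^sub>0, \<dots>, z\<^sub>n) \<mapsto> (x, y\<^sub>0, \<dots>, y\<^sub>m\<^sub>-\<^sub>1, z\<^sub>0, \<dots>, z\<^sub>n)\<close>, where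
  \<open>CARD('r) = m\<close> and \<open>CARD('p) = m + 1\<close>.\<close>

definition drop_y :: "('p::finite, 'q::finite) jet \<Rightarrow> ('r::finite, 'q) jet" where
  "drop_y w = (fst w, (\<chi> a. jy (to_nat_on UNIV a) w), snd (snd w))"


section \<open>Monge equations\<close>

definition monge ::
  "nat \<Rightarrow> ('r::finite, 'q::finite) jet set \<Rightarrow> (('r, 'q) jet \<Rightarrow> real) \<Rightarrow> ('p::finite, 'q) jet set" where
  "monge m U F = {w. drop_y w \<in> U \<and> jy m w = F (drop_y w)}"

definition monge_tangent ::
  "nat \<Rightarrow> (('r::finite, 'q::finite) jet \<Rightarrow> real) \<Rightarrow> ('p::finite, 'q) jet \<Rightarrow> ('p, 'q) jet set" where
  "monge_tangent m F w = {v. jy m v = frechet_derivative F (at (drop_y w)) (drop_y v)}"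

definition monge_distribution ::
  "nat \<Rightarrow> nat \<Rightarrow> (('r::finite, 'q::finite) jet \<Rightarrow> real) \<Rightarrow> ('p::finite, 'q) jet \<Rightarrow> ('p, 'q) jet set" where
  "monge_distribution m n F w = cartan m n w \<inter> monge_tangent m F w"

definition F_zz :: "nat \<Rightarrow> (('r::finite, 'q::finite) jet \<Rightarrow> real) \<Rightarrow> ('r, 'q) jet \<Rightarrow> real" where
  "F_zz n F u = (deriv ^^ 2) (\<lambda>s. F (u + s *\<^sub>R (0, 0, axis (from_nat_into UNIV n) 1))) 0"


section \<open>Internal and external symmetries\<close>

definition internal_symmetry_on ::
  "nat \<Rightarrow> nat \<Rightarrow> ('r::finite, 'q::finite) jet set \<Rightarrow> (('r, 'q) jet \<Rightarrow> real) \<Rightarrow>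
   ('p::finite, 'q) jet set \<Rightarrow> (('p, 'q) jet \<Rightarrow> ('p, 'q) jet) \<Rightarrow> bool" where
  "internal_symmetry_on m n U F W V \<longleftrightarrow>
     smooth_on (monge m U F \<inter> W) V \<and>
     (\<forall>q\<in>monge m U F \<inter> W. V q \<in> monge_tangent m F q) \<and>
     flow_preserves (monge m U F \<inter> W) (monge_distribution m n F) V"

definition infinitesimal_lie_on ::
  "nat \<Rightarrow> nat \<Rightarrow> ('p::finite, 'q::finite) jet set \<Rightarrow> (('p, 'q) jet \<Rightarrow> ('p, 'q) jet) \<Rightarrow> bool" where
  "infinitesimal_lie_on m n W X \<longleftrightarrow> smooth_on W X \<and> flow_preserves W (cartan m n) X"

definition external_symmetry_on ::
  "nat \<Rightarrow> nat \<Rightarrow> ('r::finite, 'q::finite) jet set \<Rightarrow> (('r, 'q) jet \<Rightarrow> real) \<Rightarrow>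
   ('p::finite, 'q) jet set \<Rightarrow> (('p, 'q) jet \<Rightarrow> ('p, 'q) jet) \<Rightarrow> bool" where
  "external_symmetry_on m n U F W X \<longleftrightarrow>
     infinitesimal_lie_on m n W X \<and> (\<forall>q\<in>monge m U F \<inter> W. X q \<in> monge_tangent m F q)"

text \<open>The germ at \<open>p\<close> of the restriction to \<open>E\<close>: only values at points of \<open>E\<close> near \<open>p\<close> matter.
  Thus the germ along the equation of an external symmetry is the germ of the vector field
  it induces on the equation.\<close>

definition germ_along :: "'a::topological_space set \<Rightarrow> 'a \<Rightarrow> ('a \<Rightarrow> 'b) \<Rightarrow> ('a \<Rightarrow> 'b) set" where
  "germ_along E p V = {V'. \<forall>\<^sub>F q in nhds p. q \<in> E \<longrightarrow> V' q = V q}"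

definition internal_symmetry_germs ::
  "nat \<Rightarrow> nat \<Rightarrow> ('r::finite, 'q::finite) jet set \<Rightarrow> (('r, 'q) jet \<Rightarrow> real) \<Rightarrow> ('p::finite, 'q) jet \<Rightarrow>
   (('p, 'q) jet \<Rightarrow> ('p, 'q) jet) set set" where
  "internal_symmetry_germs m n U F p =
     {germ_along (monge m U F) p V | W V. open W \<and> p \<in> W \<and> internal_symmetry_on m n U F W V}"

definition external_symmetry_germs ::
  "nat \<Rightarrow> nat \<Rightarrow> ('r::finite, 'q::finite) jet set \<Rightarrow> (('r, 'q) jet \<Rightarrow> real) \<Rightarrow> ('p::finite, 'q) jet \<Rightarrow>
   (('p, 'q) jet \<Rightarrow> ('p, 'q) jet) set set" where
  "external_symmetry_germs m n U F p =
     {germ_along (monge m U F) p X | W X. open W \<and> p \<in> W \<and> external_symmetry_on m n U F W X}"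

end

theory Submission
  imports Defs
begin

text \<open>
  On the equation let \<open>D\<close> be the restricted total derivative and write \<open>\<partial>\<^sub>n\<close>, \<open>\<partial>'\<close> for the
  derivatives in \<open>z\<^sub>n\<close> and \<open>y\<^sub>m\<^sub>-\<^sub>1\<close>, so that \<open>\<Delta> = span {D, \<partial>\<^sub>n}\<close>,
  \<open>Z = [\<partial>\<^sub>n, D] = F\<^sub>n \<partial>' + \<partial>\<^sub>n\<^sub>-\<^sub>1\<close> and \<open>[\<partial>\<^sub>n, Z] = F\<^sub>n\<^sub>n \<partial>'\<close>.
  A field \<open>V\<close> with \<open>[V, \<Delta>] \<subseteq> \<Delta>\<close> also preserves the weak derived flag of \<open>\<Delta>\<close>. Since
  \<open>F\<^sub>n\<^sub>n \<noteq> 0\<close>, the brackets of order four force the \<open>x\<close>-component \<open>\<xi>\<close> of \<open>V\<close> to satisfy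
  \<open>\<partial>\<^sub>n \<xi> = 0\<close>. Then \<open>V\<close> preserves \<open>span {D, \<partial>\<^sub>n, Z, \<partial>'}\<close>, and this is exactly what is
  needed for the following extension of \<open>V\<close> to preserve the Cartan distribution: keep all components
  except those of \<open>y\<^sub>m\<close> and \<open>z\<^sub>n\<close>, make them independent of \<open>y\<^sub>m\<close>, and define the last two by the
  prolongation formula with the total derivative of the ambient jet space.

  Conversely, an external symmetry annihilates \<open>y\<^sub>m - F\<close> along the equation, so its flow
  preserves the equation and with it the intersection of the two distributions.
\<close>

section \<open>Calculus of smooth maps\<close>

text \<open>Symmetries are defined through flows, whereas the argument runs on first-order
  identities, so both translations must be proved. From flows to identities: the differentials of an
  internal flow are known only within the equation, and their behaviour in time has to be recovered.
  From identities to flows: existence, differentiability in the initial point and preservation of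
  the distribution rest on a contraction and on Gronwall estimates over short times. The equation is
  a graph over the open set \<open>U\<close>. Fields on it become maps on \<open>U\<close>, where
  partial derivatives make sense, and brackets with the constant field \<open>en\<close> become
  derivatives \<open>dd en\<close>. The direction \<open>\<partial>'\<close> matters because off the
  equation the ambient total derivative projects to \<open>D + (y_m - F) \<partial>'\<close>. The
  contact conditions there contain a \<open>\<partial>'\<close> part that the hypothesis on
  \<open>V\<close> does not supply directly; it becomes available once
  \<open>\<partial>_n \<xi> = 0\<close>. For \<open>m = 1\<close> that vanishing is drawn from the
  component along \<open>z_(n-3)\<close>, which is where \<open>n = 1\<close> and
  \<open>n = 2\<close> drop out.\<close>

abbreviation Cinf_on :: "'a::euclidean_space set \<Rightarrow> ('a \<Rightarrow> 'b::euclidean_space) \<Rightarrow> bool" where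
  "Cinf_on S f \<equiv> (\<forall>k. Ck_on k S f)"

text \<open>The direction comes first, so that \<open>dd v f\<close> is again a map of the point and
  mixed derivatives can be written \<open>dd a (dd b f)\<close>.\<close>

definition dd :: "'a::euclidean_space \<Rightarrow> ('a \<Rightarrow> 'b::euclidean_space) \<Rightarrow> 'a \<Rightarrow> 'b" where
  "dd v f x = frechet_derivative f (at x) v"

lemma has_derivative_ddI: "f differentiable at x \<Longrightarrow> (f has_derivative (\<lambda>v. dd v f x)) (at x)"
  by (simp add: dd_def frechet_derivative_works)

lemma has_derivative_dd: "(f has_derivative f') (at x) \<Longrightarrow> dd v f x = f' v"
  by (metis dd_def frechet_derivative_at)

lemma dd_cong_open:
  assumes "open S" "x \<in> S" "\<And>y. y \<in> S \<Longrightarrow> f y = g y"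
  shows "dd v f x = dd v g x"
proof -
  have "(f has_derivative D) (at x) \<longleftrightarrow> (g has_derivative D) (at x)" for D
    using has_derivative_transform_within_open[OF _ assms(1,2)] assms(3) by metis
  then show ?thesis by (simp add: dd_def frechet_derivative_def)
qed

section \<open>Closure properties of smooth maps\<close>

lemma Ck_on_SucI:
  assumes "\<And>x. x \<in> S \<Longrightarrow> (f has_derivative f' x) (at x)" and "\<And>v. Ck_on k S (\<lambda>x. f' x v)"
  shows "Ck_on (Suc k) S f"
  using assms by auto

lemma Ck_on_SucE:
  assumes "Ck_on (Suc k) S f"
  obtains f' where "\<And>x. x \<in> S \<Longrightarrow> (f has_derivative f' x) (at x)" "\<And>v. Ck_on k S (\<lambda>x. f' x v)"
  using assms by auto

lemma Ck_on_subset: "Ck_on k S f \<Longrightarrow> T \<subseteq> S \<Longrightarrow> Ck_on k T f"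
proof (induction k arbitrary: f)
  case 0 then show ?case by (auto intro: continuous_on_subset)
next
  case (Suc k) then show ?case by simp (meson subsetD)
qed

lemma Ck_on_cong:
  assumes "open S" "\<And>x. x \<in> S \<Longrightarrow> f x = g x" "Ck_on k S f"
  shows "Ck_on k S g"
proof (cases k)
  case 0 then show ?thesis using assms by (auto cong: continuous_on_cong)
next
  case (Suc l)
  with assms(3) obtain f' where f': "\<And>x. x \<in> S \<Longrightarrow> (f has_derivative f' x) (at x)"
      "\<And>v. Ck_on l S (\<lambda>x. f' x v)" by (auto elim: Ck_on_SucE)
  have "(g has_derivative f' x) (at x)" if "x \<in> S" for x
    using has_derivative_transform_within_open[OF f'(1) assms(1)] that assms(2) by blast
  with f'(2) Suc show ?thesis by (auto intro: Ck_on_SucI simp del: Ck_on.simps)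
qed

text \<open>Derivatives at a point are unique, so the existentially quantified family in
  \<open>Ck_on\<close> may be taken to be \<open>dd\<close>.\<close>

lemma Ck_on_Suc_iff:
  assumes "open S"
  shows "Ck_on (Suc k) S f \<longleftrightarrow>
    (\<forall>x\<in>S. f differentiable at x) \<and> (\<forall>v. Ck_on k S (\<lambda>x. dd v f x))"
proof
  assume "Ck_on (Suc k) S f"
  then obtain f' where f': "\<And>x. x \<in> S \<Longrightarrow> (f has_derivative f' x) (at x)"
    and k: "\<And>v. Ck_on k S (\<lambda>x. f' x v)" by auto
  have "Ck_on k S (\<lambda>x. dd v f x)" for v
    by (rule Ck_on_cong[OF assms _ k[of v]]) (simp add: has_derivative_dd[OF f'])
  then show "(\<forall>x\<in>S. f differentiable at x) \<and> (\<forall>v. Ck_on k S (\<lambda>x. dd v f x))"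
    using f' unfolding differentiable_def by blast
next
  assume "(\<forall>x\<in>S. f differentiable at x) \<and> (\<forall>v. Ck_on k S (\<lambda>x. dd v f x))"
  then show "Ck_on (Suc k) S f"
    by (intro Ck_on_SucI[where f'="\<lambda>x v. dd v f x"]) (auto simp: dd_def frechet_derivative_works)
qed

lemma Ck_on_Suc_D: "Ck_on (Suc k) S f \<Longrightarrow> Ck_on k S f"
proof (induction k arbitrary: f)
  case 0
  then show ?case
    by (auto intro!: continuous_at_imp_continuous_on intro: has_derivative_continuous)
next
  case (Suc k)
  then obtain f' where "\<And>x. x \<in> S \<Longrightarrow> (f has_derivative f' x) (at x)"
     "\<And>v. Ck_on (Suc k) S (\<lambda>x. f' x v)" by (subst (asm) (2) Ck_on.simps) blast
  then show ?case using Suc.IH by (metis Ck_on_SucI)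
qed

lemma Ck_on_const: "Ck_on k S (\<lambda>x. c)"
proof (induction k arbitrary: c)
  case (Suc k)
  then show ?case by (intro Ck_on_SucI[where f'="\<lambda>x v. 0"]) auto
qed auto

lemma Ck_on_linear: "bounded_linear f \<Longrightarrow> Ck_on k S f"
proof (induction k)
  case 0 then show ?case by (auto intro: linear_continuous_on)
next
  case (Suc k)
  then show ?case
    by (intro Ck_on_SucI[where f'="\<lambda>x. f"]) (auto intro: Ck_on_const bounded_linear_imp_has_derivative)
qed

lemma Ck_on_add: "Ck_on k S f \<Longrightarrow> Ck_on k S g \<Longrightarrow> Ck_on k S (\<lambda>x. f x + g x)"
proof (induction k arbitrary: f g)
  case 0 then show ?case by (auto intro: continuous_intros)
next
  case (Suc k)
  then obtain f' g' where "\<And>x. x \<in> S \<Longrightarrow> (f has_derivative f' x) (at x)" "\<And>v. Ck_on k S (\<lambda>x. f' x v)"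
     "\<And>x. x \<in> S \<Longrightarrow> (g has_derivative g' x) (at x)" "\<And>v. Ck_on k S (\<lambda>x. g' x v)"
    by (elim Ck_on_SucE) metis
  then show ?case
    by (intro Ck_on_SucI[where f'="\<lambda>x v. f' x v + g' x v"]) (auto intro!: Suc.IH derivative_intros)
qed

lemma Ck_on_sum: "(\<And>i. i \<in> I \<Longrightarrow> Ck_on k S (f i)) \<Longrightarrow> Ck_on k S (\<lambda>x. \<Sum>i\<in>I. f i x)"
  by (induction I rule: infinite_finite_induct) (auto intro: Ck_on_const Ck_on_add)

lemma Ck_on_bilinear:
  assumes "bounded_bilinear pr"
  shows "Ck_on k S f \<Longrightarrow> Ck_on k S g \<Longrightarrow> Ck_on k S (\<lambda>x. pr (f x) (g x))"
proof (induction k arbitrary: f g)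
  case 0 then show ?case by (auto intro: bounded_bilinear.continuous_on[OF assms])
next
  case (Suc k)
  then obtain f' g' where *: "\<And>x. x \<in> S \<Longrightarrow> (f has_derivative f' x) (at x)" "\<And>v. Ck_on k S (\<lambda>x. f' x v)"
     "\<And>x. x \<in> S \<Longrightarrow> (g has_derivative g' x) (at x)" "\<And>v. Ck_on k S (\<lambda>x. g' x v)"
    by (elim Ck_on_SucE) metis
  show ?case
  proof (intro Ck_on_SucI[where f'="\<lambda>x v. pr (f x) (g' x v) + pr (f' x v) (g x)"])
    show "((\<lambda>x. pr (f x) (g x)) has_derivative (\<lambda>v. pr (f x) (g' x v) + pr (f' x v) (g x))) (at x)"
      if "x \<in> S" for x
      by (rule bounded_bilinear.FDERIV[OF assms]) (use * that in auto)
    show "Ck_on k S (\<lambda>x. pr (f x) (g' x v) + pr (f' x v) (g x))" for v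
      using * Suc.prems by (intro Ck_on_add Suc.IH) (auto intro: Ck_on_Suc_D simp del: Ck_on.simps)
  qed
qed

lemmas Ck_on_scaleR = Ck_on_bilinear[OF bounded_bilinear_scaleR]
lemmas Ck_on_mult = Ck_on_bilinear[OF bounded_bilinear_mult]

lemma Ck_on_linear_comp: 
  assumes "bounded_linear l" shows "Ck_on k S f \<Longrightarrow> Ck_on k S (\<lambda>x. l (f x))"
proof (induction k arbitrary: f)
  case 0 then show ?case by (auto intro: linear_continuous_on_compose linear_continuous_on assms
      bounded_linear.continuous_on)
next
  case (Suc k)
  then obtain f' where "\<And>x. x \<in> S \<Longrightarrow> (f has_derivative f' x) (at x)" "\<And>v. Ck_on k S (\<lambda>x. f' x v)"
    by auto
  then show ?case
    by (intro Ck_on_SucI[where f'="\<lambda>x v. l (f' x v)"]) (auto intro!: Suc.IH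
        bounded_linear.has_derivative[OF assms])
qed

lemma Ck_on_diff: "Ck_on k S f \<Longrightarrow> Ck_on k S g \<Longrightarrow> Ck_on k S (\<lambda>x. f x - g x)"
  using Ck_on_add[of k S f "\<lambda>x. - g x"] Ck_on_linear_comp[OF
      bounded_linear_minus[OF bounded_linear_ident], of k S g]
  by simp

lemma linear_sum_Basis: "linear f \<Longrightarrow> f v = (\<Sum>b\<in>Basis. (v \<bullet> b) *\<^sub>R f b)" for v :: "'a::euclidean_space"
  by (metis (no_types, lifting) euclidean_representation linear_sum linear_scale sum.cong)

text \<open>The derivative \<open>g' (f x) (f' x v)\<close> depends on \<open>x\<close> through its
  direction too, whereas the induction hypothesis covers fixed directions only. Expanding the
  direction in \<open>Basis\<close> leaves the terms \<open>g' (f x) b\<close>, to which it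
  applies.\<close>

lemma Ck_on_compose:
  assumes "f ` S \<subseteq> T"
  shows "Ck_on k S f \<Longrightarrow> Ck_on k T g \<Longrightarrow> Ck_on k S (\<lambda>x. g (f x))"
proof (induction k arbitrary: g)
  case 0 then show ?case using assms by (auto intro: continuous_on_compose2)
next
  case (Suc k)
  then obtain f' g' where *: "\<And>x. x \<in> S \<Longrightarrow> (f has_derivative f' x) (at x)" "\<And>v. Ck_on k S (\<lambda>x. f' x v)"
     "\<And>x. x \<in> T \<Longrightarrow> (g has_derivative g' x) (at x)" "\<And>v. Ck_on k T (\<lambda>x. g' x v)"
    by (elim Ck_on_SucE) metis
  show ?case
  proof (intro Ck_on_SucI[where f'="\<lambda>x v. \<Sum>b\<in>Basis. (f' x v \<bullet> b) *\<^sub>R g' (f x) b"])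
    fix x assume x: "x \<in> S"
    have "((\<lambda>x. g (f x)) has_derivative (\<lambda>v. g' (f x) (f' x v))) (at x)"
      using diff_chain_at[OF *(1)[OF x] *(3)] assms x by (auto simp: o_def)
    moreover have "g' (f x) v = (\<Sum>b\<in>Basis. (v \<bullet> b) *\<^sub>R g' (f x) b)" for v
      by (rule linear_sum_Basis, rule has_derivative_linear[OF *(3)]) (use assms x in auto)
    ultimately show "((\<lambda>x. g (f x)) has_derivative (\<lambda>v. \<Sum>b\<in>Basis. (f' x v \<bullet> b) *\<^sub>R g' (f x) b)) (at x)"
      by (rule back_subst[where P="\<lambda>D. ((\<lambda>x. g (f x)) has_derivative D) (at x)", OF _ ext])
  next
    show "Ck_on k S (\<lambda>x. \<Sum>b\<in>Basis. (f' x v \<bullet> b) *\<^sub>R g' (f x) b)" for v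
      by (rule Ck_on_sum, rule Ck_on_scaleR, rule Ck_on_linear_comp[OF bounded_linear_inner_left],
          rule *(2), rule Suc.IH[OF Ck_on_Suc_D[OF Suc.prems(1)] *(4)])
  qed
qed

text \<open>Different neighbourhoods may come with different derivative families; passing to
  \<open>dd\<close>, which depends on \<open>f\<close> alone, makes them fit together.\<close>

lemma Ck_on_local:
  assumes "open S" "\<And>p. p \<in> S \<Longrightarrow> \<exists>W. open W \<and> p \<in> W \<and> Ck_on k (W \<inter> S) f"
  shows "Ck_on k S f"
  using assms(2)
proof (induction k arbitrary: f)
  case 0
  then show ?case
    by (auto intro!: continuous_at_imp_continuous_on simp: continuous_on_eq_continuous_at assms(1)
        open_Int) 
      (metis IntI assms(1) continuous_on_eq_continuous_at open_Int)
next
  case (Suc k)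
  have *: "\<exists>W. open W \<and> p \<in> W \<and> (\<forall>x\<in>W \<inter> S. f differentiable at x)
      \<and> (\<forall>v. Ck_on k (W \<inter> S) (\<lambda>x. dd v f x))"
    if "p \<in> S" for p
    using Suc.prems[OF that] assms(1) by (metis Ck_on_Suc_iff open_Int)
  have "Ck_on k S (\<lambda>x. dd v f x)" for v
    by (rule Suc.IH) (use * in blast)
  with * show ?case
    unfolding Ck_on_Suc_iff[OF assms(1)] by (meson IntI)
qed

lemma smooth_on_open_imp_Cinf_on:
  assumes "open S" "smooth_on S f" shows "Cinf_on S f"
proof (rule allI, rule Ck_on_local[OF assms(1)])
  fix k p assume "p \<in> S"
  then obtain W g where W: "open W" "p \<in> W" "\<forall>k. Ck_on k W g" "\<forall>w\<in>W \<inter> S. g w = f w"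
    using assms unfolding smooth_on_def by metis
  have "Ck_on k (W \<inter> S) g" using W(3) by (auto intro: Ck_on_subset)
  then have "Ck_on k (W \<inter> S) f"
    by (rule Ck_on_cong[where f=g, rotated 2]) (use W assms(1) in auto)
  with W show "\<exists>W. open W \<and> p \<in> W \<and> Ck_on k (W \<inter> S) f" by blast
qed

lemma smooth_on_subset:
  assumes "smooth_on S f" "T \<subseteq> S" shows "smooth_on T f"
  unfolding smooth_on_def
proof
  fix p assume "p \<in> T"
  then obtain W g where "open W" "p \<in> W" "\<forall>k. Ck_on k W g" "\<forall>w\<in>W \<inter> S. g w = f w"
    using assms unfolding smooth_on_def by (metis subsetD)
  with assms(2) show "\<exists>W g. open W \<and> p \<in> W \<and> (\<forall>k. Ck_on k W g) \<and> (\<forall>w\<in>W \<inter> T. g w = f w)"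
    by (intro exI[of _ W] exI[of _ g]) auto
qed

lemma Cinf_on_imp_smooth_on: "open S \<Longrightarrow> Cinf_on S f \<Longrightarrow> smooth_on S f"
  unfolding smooth_on_def by blast

lemma Cinf_on_differentiable: "Cinf_on S f \<Longrightarrow> x \<in> S \<Longrightarrow> f differentiable at x"
  by (metis Ck_on.simps(2) differentiable_def)

lemma Cinf_on_dd: "open S \<Longrightarrow> Cinf_on S f \<Longrightarrow> Cinf_on S (dd v f)"
  by (metis Ck_on_Suc_iff)

lemma linear_dd: "f differentiable at x \<Longrightarrow> linear (\<lambda>v. dd v f x)"
  using linear_frechet_derivative[of f "at x"] by (simp add: dd_def[abs_def])

text \<open>A point-dependent direction is expanded in \<open>Basis\<close>: its coefficients are
  smooth, and only derivatives in fixed directions remain.\<close>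

lemma Cinf_on_dd_field:
  assumes "open S" "Cinf_on S f" "Cinf_on S e"
  shows "Cinf_on S (\<lambda>x. dd (e x) f x)"
proof
  fix k
  show "Ck_on k S (\<lambda>x. dd (e x) f x)"
  proof (rule Ck_on_cong[OF assms(1)])
    show "Ck_on k S (\<lambda>x. \<Sum>b\<in>Basis. (e x \<bullet> b) *\<^sub>R dd b f x)"
      using assms(3) Cinf_on_dd[OF assms(1,2)] 
      by (intro Ck_on_sum Ck_on_scaleR Ck_on_linear_comp[OF bounded_linear_inner_left]) auto
    show "x \<in> S \<Longrightarrow> (\<Sum>b\<in>Basis. (e x \<bullet> b) *\<^sub>R dd b f x) = dd (e x) f x" for x
      using linear_sum_Basis[OF linear_dd[OF Cinf_on_differentiable[OF assms(2)]], of x "e x"] by simp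
  qed
qed

section \<open>Rules for directional derivatives\<close>

lemma dd_add_dir: "f differentiable at x \<Longrightarrow> dd (a + b) f x = dd a f x + dd b f x"
  by (rule linear_add[OF linear_dd])
lemma dd_diff_dir: "f differentiable at x \<Longrightarrow> dd (a - b) f x = dd a f x - dd b f x"
  by (rule linear_diff[OF linear_dd])
lemma dd_scaleR_dir: "f differentiable at x \<Longrightarrow> dd (r *\<^sub>R a) f x = r *\<^sub>R dd a f x"
  by (rule linear_scale[OF linear_dd])
lemma dd_zero_dir: "f differentiable at x \<Longrightarrow> dd 0 f x = 0"
  by (rule linear_0[OF linear_dd])

lemma dd_sum_Basis: "f differentiable at x \<Longrightarrow> dd v f x = (\<Sum>b\<in>Basis. (v \<bullet> b) *\<^sub>R dd b f x)"
  by (rule linear_sum_Basis[OF linear_dd])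

lemma dd_add: "f differentiable at x \<Longrightarrow> g differentiable at x \<Longrightarrow> dd a (\<lambda>u. f u + g u) x
    = dd a f x + dd a g x"
  by (rule has_derivative_dd[where f'="\<lambda>a. dd a f x + dd a g x"]) (intro derivative_intros
      has_derivative_ddI)

lemma dd_diff: "f differentiable at x \<Longrightarrow> g differentiable at x \<Longrightarrow> dd a (\<lambda>u. f u - g u) x
    = dd a f x - dd a g x"
  by (rule has_derivative_dd[where f'="\<lambda>a. dd a f x - dd a g x"]) (intro derivative_intros
      has_derivative_ddI)

lemma dd_mult:
  fixes f g :: "'a::euclidean_space \<Rightarrow> real"
  shows "f differentiable at x \<Longrightarrow> g differentiable at x \<Longrightarrow> dd a (\<lambda>u. f u * g u) x
      = dd a f x * g x + f x * dd a g x"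
  by (rule has_derivative_dd[where f'="\<lambda>a. dd a f x * g x + f x * dd a g x"])
    (auto intro!: derivative_eq_intros has_derivative_ddI)

lemma dd_scaleR:
  fixes f :: "'a::euclidean_space \<Rightarrow> real"
  shows "f differentiable at x \<Longrightarrow> g differentiable at x \<Longrightarrow> dd a (\<lambda>u. f u *\<^sub>R g u) x
      = dd a f x *\<^sub>R g x + f x *\<^sub>R dd a g x"
  by (rule has_derivative_dd[where f'="\<lambda>a. dd a f x *\<^sub>R g x + f x *\<^sub>R dd a g x"])
    (auto intro!: derivative_eq_intros has_derivative_ddI)

lemma dd_linear: "bounded_linear l \<Longrightarrow> dd a l x = l a"
  by (rule has_derivative_dd) (rule bounded_linear_imp_has_derivative)

lemma dd_const: "dd a (\<lambda>u. c) x = 0"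
  by (rule has_derivative_dd[where f'="\<lambda>a. 0"]) auto

lemma dd_linear_comp: "bounded_linear l \<Longrightarrow> f differentiable at x \<Longrightarrow> dd a (\<lambda>u. l (f u)) x = l (dd a f x)"
  by (rule has_derivative_dd[where f'="\<lambda>a. l (dd a f x)"])
    (rule bounded_linear.has_derivative[OF _ has_derivative_ddI])

lemma dd_sum: "finite I \<Longrightarrow> (\<And>i. i \<in> I \<Longrightarrow> f i differentiable at x) \<Longrightarrow> dd a (\<lambda>u. \<Sum>i\<in>I. f i u) x
    = (\<Sum>i\<in>I. dd a (f i) x)"
  by (rule has_derivative_dd[where f'="\<lambda>a. \<Sum>i\<in>I. dd a (f i) x"])
    (intro derivative_intros has_derivative_ddI)

lemma dd_chain: "f differentiable at x \<Longrightarrow> g differentiable at (f x) \<Longrightarrow> dd a (\<lambda>u. g (f u)) x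
    = dd (dd a f x) g (f x)"
  by (rule has_derivative_dd[where f'="\<lambda>a. dd (dd a f x) g (f x)"])
    (rule has_derivative_compose[OF has_derivative_ddI has_derivative_ddI])

lemma Ck_on_differentiable: "Ck_on (Suc k) S f \<Longrightarrow> x \<in> S \<Longrightarrow> f differentiable at x"
  by (metis Ck_on.simps(2) differentiable_def)

lemma Cinf_on_continuous: "Cinf_on S f \<Longrightarrow> continuous_on S f"
  by (metis Ck_on.simps(1))

section \<open>Symmetry of second derivatives\<close>

lemma DERIV_along:
  fixes g :: "'a::euclidean_space \<Rightarrow> real"
  assumes "g differentiable at (x + s *\<^sub>R a)"
  shows "((\<lambda>s. g (x + s *\<^sub>R a)) has_real_derivative dd a g (x + s *\<^sub>R a)) (at s)"
proof -
  have "((\<lambda>s. g (x + s *\<^sub>R a)) has_derivative (\<lambda>h. dd (h *\<^sub>R a) g (x + s *\<^sub>R a))) (at s)"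
    by (rule has_derivative_compose[where f="\<lambda>s. x + s *\<^sub>R a", OF _ has_derivative_ddI[OF assms]])
      (auto intro!: derivative_eq_intros)
  then show ?thesis
    unfolding has_field_derivative_def by (rule has_derivative_eq_rhs) (auto simp:
        dd_scaleR_dir[OF assms])
qed

text \<open>The mean value theorem is used twice: along \<open>a\<close> for the increment of
  \<open>g\<close> in direction \<open>b\<close>, then along \<open>b\<close> for
  \<open>dd a g\<close>.\<close>

lemma second_difference:
  fixes g :: "'a::euclidean_space \<Rightarrow> real"
  assumes "open S" "Cinf_on S g" "0 < s"
    and S: "\<And>\<sigma> \<tau>. 0 \<le> \<sigma> \<Longrightarrow> \<sigma> \<le> s \<Longrightarrow> 0 \<le> \<tau> \<Longrightarrow> \<tau> \<le> s \<Longrightarrow> x + \<sigma> *\<^sub>R a + \<tau> *\<^sub>R b \<in> S"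
  obtains \<sigma> \<tau> where "0 < \<sigma>" "\<sigma> < s" "0 < \<tau>" "\<tau> < s"
    "g (x + s *\<^sub>R a + s *\<^sub>R b) - g (x + s *\<^sub>R a) - g (x + s *\<^sub>R b) + g x =
      s * (s * dd b (dd a g) (x + \<sigma> *\<^sub>R a + \<tau> *\<^sub>R b))"
proof -
  have d: "g differentiable at (x + \<sigma> *\<^sub>R a + \<tau> *\<^sub>R b)" "dd a g differentiable at (x + \<sigma> *\<^sub>R a + \<tau> *\<^sub>R
      b)"
    if "0 \<le> \<sigma>" "\<sigma> \<le> s" "0 \<le> \<tau>" "\<tau> \<le> s" for \<sigma> \<tau>
    using Cinf_on_differentiable[OF _ S[OF that]] Cinf_on_dd[OF assms(1,2)] assms(2) by blast+
  define \<phi> where "\<phi> \<sigma> = g (x + s *\<^sub>R b + \<sigma> *\<^sub>R a) - g (x + \<sigma> *\<^sub>R a)" for \<sigma>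
  have "(\<phi> has_real_derivative dd a g (x + s *\<^sub>R b + \<sigma> *\<^sub>R a) - dd a g (x + \<sigma> *\<^sub>R a)) (at \<sigma>)"
    if "0 \<le> \<sigma>" "\<sigma> \<le> s" for \<sigma>
    unfolding \<phi>_def using d(1)[OF that, of s] d(1)[OF that, of 0] assms(3)
    by (intro derivative_intros DERIV_along) (auto simp: algebra_simps)
  from MVT2[OF assms(3) this] obtain \<sigma> where \<sigma>: "0 < \<sigma>" "\<sigma> < s"
    and 1: "\<phi> s - \<phi> 0 = s * (dd a g (x + s *\<^sub>R b + \<sigma> *\<^sub>R a) - dd a g (x + \<sigma> *\<^sub>R a))" by auto
  have "((\<lambda>\<tau>. dd a g (x + \<sigma> *\<^sub>R a + \<tau> *\<^sub>R b)) has_real_derivative dd b (dd a g) (x + \<sigma> *\<^sub>R a + \<tau> *\<^sub>R b))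
      (at \<tau>)"
    if "0 \<le> \<tau>" "\<tau> \<le> s" for \<tau>
    by (rule DERIV_along) (use \<sigma> that d in auto)
  from MVT2[OF assms(3) this] obtain \<tau> where \<tau>: "0 < \<tau>" "\<tau> < s"
    and 2: "dd a g (x + \<sigma> *\<^sub>R a + s *\<^sub>R b) - dd a g (x + \<sigma> *\<^sub>R a)
        = s * dd b (dd a g) (x + \<sigma> *\<^sub>R a + \<tau> *\<^sub>R b)"
    by auto
  show ?thesis
    using that[OF \<sigma> \<tau>] 1 2 unfolding \<phi>_def by (simp add: algebra_simps)
qed

text \<open>The second difference is symmetric in \<open>a\<close> and \<open>b\<close>, so the two
  mixed derivatives agree at suitable pairs of points arbitrarily close to \<open>x\<close>;
  continuity does the rest.\<close>

lemma dd_commute: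
  fixes g :: "'a::euclidean_space \<Rightarrow> real"
  assumes "open S" "Cinf_on S g" "x \<in> S"
  shows "dd a (dd b g) x = dd b (dd a g) x"
proof (rule ccontr)
  assume ne: "dd a (dd b g) x \<noteq> dd b (dd a g) x"
  \<comment> \<open>Half the gap: two errors below \<open>e\<close> cannot bridge it.\<close>
  define e where "e = \<bar>dd a (dd b g) x - dd b (dd a g) x\<bar> / 2"
  have e: "0 < e" using ne by (simp add: e_def)
  have c: "isCont (dd a (dd b g)) x" "isCont (dd b (dd a g)) x"
    using assms by (metis Cinf_on_dd Cinf_on_continuous continuous_on_eq_continuous_at)+
  obtain d0 where d0: "0 < d0" "ball x d0 \<subseteq> S" using assms by (meson open_contains_ball)
  obtain d1 where d1: "0 < d1" "\<And>y. dist y x < d1 \<Longrightarrow> dist (dd a (dd b g) y) (dd a (dd b g) x) < e"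
    using c(1) e unfolding continuous_at_eps_delta by metis
  obtain d2 where d2: "0 < d2" "\<And>y. dist y x < d2 \<Longrightarrow> dist (dd b (dd a g) y) (dd b (dd a g) x) < e"
    using c(2) e unfolding continuous_at_eps_delta by metis
  define d where "d = min d0 (min d1 d2)"
  \<comment> \<open>Small enough for the parallelogram with sides \<open>s a\<close> and
    \<open>s b\<close> at \<open>x\<close> to lie within distance \<open>d\<close> of
    \<open>x\<close>.\<close>
  define s where "s = d / (2 * (1 + norm a + norm b))"
  have d: "0 < d" using d0 d1 d2 by (simp add: d_def)
  have pos: "0 < 1 + norm a + norm b" by (smt (verit) norm_ge_zero)
  have s: "0 < s" using d pos by (simp add: s_def)
  have near: "dist (x + \<sigma> *\<^sub>R a + \<tau> *\<^sub>R b) x < d" if "0 \<le> \<sigma>" "\<sigma> \<le> s" "0 \<le> \<tau>" "\<tau> \<le> s" for \<sigma> \<tau>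
  proof -
    have "dist (x + \<sigma> *\<^sub>R a + \<tau> *\<^sub>R b) x \<le> norm (\<sigma> *\<^sub>R a) + norm (\<tau> *\<^sub>R b)"
      by (simp add: dist_norm add.assoc) (metis norm_scaleR norm_triangle_ineq)
    also have "\<dots> \<le> s * norm a + s * norm b"
      using that by (auto intro!: add_mono mult_right_mono)
    also have "\<dots> < 2 * s * (1 + norm a + norm b)"
      using s by (simp add: algebra_simps) (smt (verit) norm_ge_zero mult_nonneg_nonneg)
    also have "\<dots> = d" using pos by (simp add: s_def field_simps)
    finally show ?thesis .
  qed
  have nearS: "x + \<sigma> *\<^sub>R a + \<tau> *\<^sub>R b \<in> S" if "0 \<le> \<sigma>" "\<sigma> \<le> s" "0 \<le> \<tau>" "\<tau> \<le> s" for \<sigma> \<tau>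
    using near[OF that] d0(2) by (auto simp: d_def dist_commute subset_iff)
  obtain \<sigma> \<tau> where 1: "0 < \<sigma>" "\<sigma> < s" "0 < \<tau>" "\<tau> < s"
    "g (x + s *\<^sub>R a + s *\<^sub>R b) - g (x + s *\<^sub>R a) - g (x + s *\<^sub>R b) + g x =
      s * (s * dd b (dd a g) (x + \<sigma> *\<^sub>R a + \<tau> *\<^sub>R b))"
    using second_difference[OF assms(1,2) s, of x a b] nearS by metis
  have nearS': "x + \<sigma> *\<^sub>R b + \<tau> *\<^sub>R a \<in> S" if "0 \<le> \<sigma>" "\<sigma> \<le> s" "0 \<le> \<tau>" "\<tau> \<le> s" for \<sigma> \<tau>
    using nearS[OF that(3,4,1,2)] by (simp add: algebra_simps)
  obtain \<sigma>' \<tau>' where 2: "0 < \<sigma>'" "\<sigma>' < s" "0 < \<tau>'" "\<tau>' < s"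
    "g (x + s *\<^sub>R b + s *\<^sub>R a) - g (x + s *\<^sub>R b) - g (x + s *\<^sub>R a) + g x =
      s * (s * dd a (dd b g) (x + \<sigma>' *\<^sub>R b + \<tau>' *\<^sub>R a))"
    using second_difference[OF assms(1,2) s, of x b a] nearS' by metis
  have "g (x + s *\<^sub>R b + s *\<^sub>R a) = g (x + s *\<^sub>R a + s *\<^sub>R b)"
      by (simp add: add.commute add.left_commute)
  with 1(5) 2(5) have "s * (s * dd b (dd a g) (x + \<sigma> *\<^sub>R a + \<tau> *\<^sub>R b)) =
     s * (s * dd a (dd b g) (x + \<sigma>' *\<^sub>R b + \<tau>' *\<^sub>R a))" by linarith
  then have eq: "dd b (dd a g) (x + \<sigma> *\<^sub>R a + \<tau> *\<^sub>R b) = dd a (dd b g) (x + \<sigma>' *\<^sub>R b + \<tau>' *\<^sub>R a)"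
    using s by simp
  have "dist (dd b (dd a g) (x + \<sigma> *\<^sub>R a + \<tau> *\<^sub>R b)) (dd b (dd a g) x) < e"
    using near[of \<sigma> \<tau>] 1 by (intro d2) (simp add: d_def)
  moreover have "dist (dd a (dd b g) (x + \<sigma>' *\<^sub>R b + \<tau>' *\<^sub>R a)) (dd a (dd b g) x) < e"
    using near[of \<tau>' \<sigma>'] 2 by (intro d1) (simp add: d_def algebra_simps)
  moreover have "dist (dd a (dd b g) x) (dd b (dd a g) x) = 2 * e" by (simp add: e_def dist_real_def)
  ultimately show False
    using dist_triangle3[of "dd a (dd b g) x" "dd b (dd a g) x" "dd a (dd b g) (x + \<sigma>' *\<^sub>R b + \<tau>' *\<^sub>R
        a)"]
    unfolding eq by linarith
qed

text \<open>For the constant field \<open>c\<close> and the field \<open>e\<close> this says that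
  their commutator is differentiation along \<open>dd c e\<close>. Brackets with \<open>en\<close>
  and \<open>e'\<close> are computed in this way.\<close>

lemma dd_commute_field:
  fixes g :: "'a::euclidean_space \<Rightarrow> real"
  assumes "open S" "Cinf_on S g" "Cinf_on S e" "x \<in> S"
  shows "dd c (\<lambda>u. dd (e u) g u) x = dd (e x) (dd c g) x + dd (dd c e x) g x"
proof -
  note D = Cinf_on_differentiable[OF _ assms(4)]
  have "dd c (\<lambda>u. dd (e u) g u) x = dd c (\<lambda>u. \<Sum>b\<in>Basis. (e u \<bullet> b) *\<^sub>R dd b g u) x"
    using Cinf_on_differentiable[OF assms(2)] by (intro dd_cong_open[OF assms(1,4)] dd_sum_Basis)
  also have "\<dots> = (\<Sum>b\<in>Basis. dd c (\<lambda>u. (e u \<bullet> b) *\<^sub>R dd b g u) x)"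
    by (intro dd_sum D finite_Basis allI Ck_on_scaleR Ck_on_linear_comp[OF bounded_linear_inner_left]
        spec[OF Cinf_on_dd[OF assms(1,2)]] spec[OF assms(3)])
  also have "\<dots> = (\<Sum>b\<in>Basis. (dd c e x \<bullet> b) *\<^sub>R dd b g x + (e x \<bullet> b) *\<^sub>R dd b (dd c g) x)"
  proof (rule sum.cong[OF refl])
    fix b :: 'a
    have "dd c (\<lambda>u. (e u \<bullet> b) *\<^sub>R dd b g u) x = dd c (\<lambda>u. e u \<bullet> b) x *\<^sub>R dd b g x + (e x \<bullet> b) *\<^sub>R dd c
        (dd b g) x"
      using assms Ck_on_linear_comp[OF bounded_linear_inner_left, of _ S e b]
      by (intro dd_scaleR D Cinf_on_dd) auto
    also have "dd c (\<lambda>u. e u \<bullet> b) x = dd c e x \<bullet> b"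
      using assms by (intro dd_linear_comp bounded_linear_inner_left D)
    also have "dd c (dd b g) x = dd b (dd c g) x" using assms by (intro dd_commute)
    finally show "dd c (\<lambda>u. (e u \<bullet> b) *\<^sub>R dd b g u) x =
        (dd c e x \<bullet> b) *\<^sub>R dd b g x + (e x \<bullet> b) *\<^sub>R dd b (dd c g) x" .
  qed
  also have "\<dots> = dd (e x) (dd c g) x + dd (dd c e x) g x"
    using dd_sum_Basis[OF D[OF assms(2)], of "dd c e x"] dd_sum_Basis[OF
        D[OF Cinf_on_dd[OF assms(1,2)]], of "e x" c]
    by (simp add: sum.distrib)
  finally show ?thesis .
qed

section \<open>Uniform estimates on compact sets\<close>

lemma linear_family_bound:
  fixes \<Lambda> :: "'a::topological_space \<Rightarrow> 'b::euclidean_space \<Rightarrow> 'c::euclidean_space"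
  assumes "compact K" "\<And>w. w \<in> K \<Longrightarrow> linear (\<Lambda> w)" "\<And>u. continuous_on K (\<lambda>w. \<Lambda> w u)"
  obtains C where "0 \<le> C" "\<And>w u. w \<in> K \<Longrightarrow> norm (\<Lambda> w u) \<le> C * norm u"
proof -
  have "\<exists>B. \<forall>w\<in>K. norm (\<Lambda> w b) \<le> B" for b
    using compact_imp_bounded[OF compact_continuous_image[OF assms(3,1)], of b]
        by (auto simp: bounded_iff)
  then obtain B where B: "\<And>b w. w \<in> K \<Longrightarrow> norm (\<Lambda> w b) \<le> B b" by metis
  show ?thesis
  proof
    show "0 \<le> (\<Sum>b\<in>(Basis::'b set). \<bar>B b\<bar>)" by (intro sum_nonneg) auto
    fix w u assume w: "w \<in> K"
    have "norm (\<Lambda> w u) \<le> (\<Sum>b\<in>Basis. norm ((u \<bullet> b) *\<^sub>R \<Lambda> w b))"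
      unfolding linear_sum_Basis[OF assms(2)[OF w], of u] by (rule norm_sum)
    also have "\<dots> \<le> (\<Sum>b\<in>Basis. norm u * \<bar>B b\<bar>)"
      using B[OF w] by (intro sum_mono) (auto intro!: mult_mono Basis_le_norm intro:
          order_trans[OF _ abs_ge_self])
    finally show "norm (\<Lambda> w u) \<le> (\<Sum>b\<in>Basis. \<bar>B b\<bar>) * norm u"
      by (simp add: sum_distrib_left mult.commute)
  qed
qed

lemma dd_bound:
  assumes "open S" "Ck_on 1 S f" "compact K" "K \<subseteq> S"
  obtains B where "0 \<le> B" "\<And>x v. x \<in> K \<Longrightarrow> norm (dd v f x) \<le> B * norm v"
proof (rule linear_family_bound[OF assms(3), of "\<lambda>x v. dd v f x"])
  show "linear (\<lambda>v. dd v f x)" if "x \<in> K" for x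
    using assms(2,4) that Ck_on_differentiable[of 0 S f] by (intro linear_dd) auto
  show "continuous_on K (\<lambda>x. dd v f x)" for v
    using assms(2,4) Ck_on_Suc_iff[OF assms(1), of 0 f] by (auto intro: continuous_on_subset)
qed (rule that)

lemma C1_lipschitz:
  assumes "open S" "Ck_on 1 S f" "compact K" "convex K" "K \<subseteq> S"
  obtains L where "0 \<le> L" "\<And>x y. x \<in> K \<Longrightarrow> y \<in> K \<Longrightarrow> norm (f x - f y) \<le> L * norm (x - y)"
     "\<And>x v. x \<in> K \<Longrightarrow> norm (dd v f x) \<le> L * norm v"
proof -
  obtain L where L: "0 \<le> L" "\<And>x v. x \<in> K \<Longrightarrow> norm (dd v f x) \<le> L * norm v"
    using dd_bound[OF assms(1,2,3,5)] by metis
  have df: "f differentiable at x" if "x \<in> K" for x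
    using assms that Ck_on_differentiable[of 0 S f] by auto
  show ?thesis
  proof (rule that[OF L(1) _ L(2)])
    show "norm (f x - f y) \<le> L * norm (x - y)" if "x \<in> K" "y \<in> K" for x y
      using that L by (intro differentiable_bound[OF assms(4), where f'="\<lambda>x v. dd v f x"])
        (auto intro!: onorm_le has_derivative_at_withinI[OF has_derivative_ddI] df)
  qed
qed

text \<open>This is the mean value inequality for \<open>f\<close> minus its linear part at
  \<open>x\<close>.\<close>

lemma linearization_bound:
  assumes "convex K" "\<And>y. y \<in> K \<Longrightarrow> f differentiable at y" "f differentiable at x"
    and "\<And>y v. y \<in> K \<Longrightarrow> norm (dd v f y - dd v f x) \<le> \<kappa> * norm v" "a \<in> K" "b \<in> K"
  shows "norm (f a - f b - dd (a - b) f x) \<le> \<kappa> * norm (a - b)"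
proof -
  have "norm ((f a - dd a f x) - (f b - dd b f x)) \<le> \<kappa> * norm (a - b)"
  proof (rule differentiable_bound[OF assms(1), where f'="\<lambda>y v. dd v f y - dd v f x"])
    fix y assume y: "y \<in> K"
    have "bounded_linear (\<lambda>v. dd v f x)" using linear_dd[OF assms(3)]
        by (simp add: linear_conv_bounded_linear)
    then show "((\<lambda>y. f y - dd y f x) has_derivative (\<lambda>v. dd v f y - dd v f x)) (at y within K)"
      by (intro has_derivative_diff has_derivative_at_withinI[OF has_derivative_ddI]
          bounded_linear_imp_has_derivative assms(2) y)
    show "onorm (\<lambda>v. dd v f y - dd v f x) \<le> \<kappa>" using assms(4)[OF y] by (rule onorm_le)
  qed fact+
  then show ?thesis by (simp add: dd_diff_dir[OF assms(3)] algebra_simps)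
qed

text \<open>Both points are free, in contrast to differentiability at \<open>x\<close>; two moving
  trajectories can thus be compared. The reason is continuity of the derivative: each of the
  \<open>n\<close> basis directions is allowed an error of \<open>\<kappa> / n\<close>.\<close>

lemma C1_strict_derivative:
  assumes "open S" "Ck_on 1 S f" "x \<in> S" "0 < \<kappa>"
  obtains \<delta> where "0 < \<delta>" "ball x \<delta> \<subseteq> S"
    "\<And>a b. a \<in> ball x \<delta> \<Longrightarrow> b \<in> ball x \<delta> \<Longrightarrow> norm (f a - f b - dd (a - b) f x) \<le> \<kappa> * norm (a - b)"
proof -
  have df: "f differentiable at x" if "x \<in> S" for x
    using assms that Ck_on_differentiable[of 0 S f] by auto
  define n where "n = real (DIM('a))"
  have n: "0 < n" by (simp add: n_def)
  have "eventually (\<lambda>y. norm (dd b f y - dd b f x) \<le> \<kappa> / n) (at x)" for b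
  proof -
    have "continuous_on S (dd b f)" using assms(2) Ck_on_Suc_iff[OF assms(1), of 0 f] by simp
    then have "(dd b f \<longlongrightarrow> dd b f x) (at x)"
      using assms by (simp add: continuous_on_eq_continuous_at isCont_def)
    then have "eventually (\<lambda>y. dist (dd b f y) (dd b f x) < \<kappa> / n) (at x)"
      by (rule tendstoD) (use assms n in auto)
    then show ?thesis by eventually_elim (simp add: dist_norm)
  qed
  then have "eventually (\<lambda>y. \<forall>b\<in>Basis. norm (dd b f y - dd b f x) \<le> \<kappa> / n) (at x)"
    by (intro eventually_ball_finite) auto
  then obtain d where d: "0 < d"
    "\<And>y b. y \<noteq> x \<Longrightarrow> dist y x < d \<Longrightarrow> b \<in> Basis \<Longrightarrow> norm (dd b f y - dd b f x) \<le> \<kappa> / n"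
    unfolding eventually_at by blast
  obtain d0 where d0: "0 < d0" "ball x d0 \<subseteq> S" using assms by (meson open_contains_ball)
  have bd: "norm (dd v f y - dd v f x) \<le> \<kappa> * norm v" if "y \<in> ball x (min d d0)" for y v
  proof -
    have y: "y \<in> S" using that d0 by auto
    have "dd v f y - dd v f x = (\<Sum>b\<in>Basis. (v \<bullet> b) *\<^sub>R (dd b f y - dd b f x))"
      using dd_sum_Basis[OF df[OF y], of v] dd_sum_Basis[OF df[OF assms(3)], of v]
      by (simp add: sum_subtractf scaleR_diff_right)
    also have "norm \<dots> \<le> (\<Sum>b\<in>(Basis::'a set). norm v * (\<kappa> / n))"
    proof (rule sum_norm_le)
      fix b :: 'a assume b: "b \<in> Basis"
      have "norm (dd b f y - dd b f x) \<le> \<kappa> / n"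
        using d(2)[of y b] b that n assms(4) by (cases "y = x") (auto simp: dist_commute)
      then show "norm ((v \<bullet> b) *\<^sub>R (dd b f y - dd b f x)) \<le> norm v * (\<kappa> / n)"
        unfolding norm_scaleR using Basis_le_norm[OF b, of v] by (intro mult_mono) auto
    qed
    also have "\<dots> = \<kappa> * norm v" using n by (simp add: n_def)
    finally show ?thesis .
  qed
  show ?thesis
  proof
    show "0 < min d d0" "ball x (min d d0) \<subseteq> S" using d d0 by auto
    fix a b assume ab: "a \<in> ball x (min d d0)" "b \<in> ball x (min d d0)"
    show "norm (f a - f b - dd (a - b) f x) \<le> \<kappa> * norm (a - b)"
      by (rule linearization_bound[OF convex_ball _ df[OF assms(3)] bd ab]) (use d0 df in auto)
  qed
qed

text \<open>The derivative is Lipschitz on \<open>K\<close>, so on the segment from \<open>b\<close>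
  to \<open>a\<close> it deviates from its value at \<open>b\<close> by at most a multiple of
  \<open>norm (a - b)\<close>, and this multiple serves as the constant in
  \<open>linearization_bound\<close>.\<close>

lemma C2_quadratic_bound:
  assumes "open S" "Ck_on 2 S f" "compact K" "convex K" "K \<subseteq> S"
  obtains C where "0 \<le> C"
    "\<And>a b. a \<in> K \<Longrightarrow> b \<in> K \<Longrightarrow> norm (f a - f b - dd (a - b) f b) \<le> C * norm (a - b) * norm (a - b)"
proof -
  have two: "Ck_on (Suc 1) S f" using assms(2) by (simp add: numeral_2_eq_2)
  then have df: "f differentiable at x" if "x \<in> K" for x
    using assms that Ck_on_differentiable[of 1 S f] by auto
  have "\<exists>L\<ge>0. \<forall>x\<in>K. \<forall>y\<in>K. norm (dd b f x - dd b f y) \<le> L * norm (x - y)" for b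
  proof -
    have "Ck_on 1 S (dd b f)" using two Ck_on_Suc_iff[OF assms(1), of 1 f] by auto
    then show ?thesis using C1_lipschitz[OF assms(1) _ assms(3,4,5)] by metis
  qed
  then obtain L where L: "\<And>b. 0 \<le> L b"
      "\<And>b x y. x \<in> K \<Longrightarrow> y \<in> K \<Longrightarrow> norm (dd b f x - dd b f y) \<le> L b * norm (x - y)"
    by metis
  define C where "C = (\<Sum>b\<in>(Basis::'a set). L b)"
  show ?thesis
  proof
    show C: "0 \<le> C" unfolding C_def by (intro sum_nonneg L)
    fix a b assume ab: "a \<in> K" "b \<in> K"
    have seg: "closed_segment b a \<subseteq> K" using ab assms(4) by (simp add: closed_segment_subset)
    have bd: "norm (dd v f y - dd v f b) \<le> (C * norm (a - b)) * norm v" if "y \<in> closed_segment b a"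
        for y v
    proof -
      have y: "y \<in> K" using that seg by auto
      have "dd v f y - dd v f b = (\<Sum>i\<in>Basis. (v \<bullet> i) *\<^sub>R (dd i f y - dd i f b))"
        using dd_sum_Basis[OF df[OF y], of v] dd_sum_Basis[OF df[OF ab(2)], of v]
        by (simp add: sum_subtractf scaleR_diff_right)
      also have "norm \<dots> \<le> (\<Sum>i\<in>(Basis::'a set). norm v * (L i * norm (a - b)))"
      proof (rule sum_norm_le)
        fix i :: 'a assume i: "i \<in> Basis"
        have "norm (dd i f y - dd i f b) \<le> L i * norm (a - b)"
          using L(2)[OF y ab(2), of i] mult_left_mono[OF segment_bound(1)[OF that] L(1)]
              by (rule order_trans)
        then show "norm ((v \<bullet> i) *\<^sub>R (dd i f y - dd i f b)) \<le> norm v * (L i * norm (a - b))"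
          unfolding norm_scaleR using Basis_le_norm[OF i, of v] by (intro mult_mono) auto
      qed
      also have "\<dots> = (C * norm (a - b)) * norm v"
        by (simp add: C_def sum_distrib_left sum_distrib_right mult_ac)
      finally show ?thesis .
    qed
    show "norm (f a - f b - dd (a - b) f b) \<le> C * norm (a - b) * norm (a - b)"
      by (rule linearization_bound[OF convex_closed_segment _ df[OF ab(2)] bd]) (use seg df in auto)
  qed
qed

section \<open>Local flows\<close>

lemma increment_bound:
  fixes u :: "real \<Rightarrow> 'a::euclidean_space"
  assumes "\<And>s. \<bar>s\<bar> \<le> \<bar>t\<bar> \<Longrightarrow> (u has_vector_derivative u' s) (at s within {-\<bar>t\<bar>..\<bar>t\<bar>})"
    and "\<And>s. \<bar>s\<bar> \<le> \<bar>t\<bar> \<Longrightarrow> norm (u' s) \<le> B"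
  shows "norm (u t - u 0) \<le> B * \<bar>t\<bar>"
proof -
  have "norm (u t - u 0) \<le> B * norm (t - 0)"
  proof (rule differentiable_bound[where S="{-\<bar>t\<bar>..\<bar>t\<bar>}" and f'="\<lambda>s h. h *\<^sub>R u' s"])
    fix s assume "s \<in> {-\<bar>t\<bar>..\<bar>t\<bar>}"
    then have s: "\<bar>s\<bar> \<le> \<bar>t\<bar>" by auto
    show "(u has_derivative (\<lambda>h. h *\<^sub>R u' s)) (at s within {-\<bar>t\<bar>..\<bar>t\<bar>})"
      using assms(1)[OF s] by (simp add: has_vector_derivative_def)
    show "onorm (\<lambda>h. h *\<^sub>R u' s) \<le> B"
      using assms(2)[OF s] by (intro onorm_le) (auto simp: mult.commute[of B] intro: mult_left_mono)
  qed auto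
  then show ?thesis by simp
qed

text \<open>On intervals with \<open>L \<epsilon> \<le> 1/2\<close> the maximum of \<open>norm u\<close> can be absorbed, so no exponential is needed.\<close>

lemma gronwall_small:
  fixes u :: "real \<Rightarrow> 'a::euclidean_space"
  assumes der: "\<And>t. \<bar>t\<bar> < \<epsilon> \<Longrightarrow> (u has_vector_derivative u' t) (at t)"
    and bd: "\<And>t. \<bar>t\<bar> < \<epsilon> \<Longrightarrow> norm (u' t) \<le> L * norm (u t) + R"
    and "0 \<le> L" "0 \<le> R" "L * \<epsilon> \<le> 1 / 2" "\<bar>t\<bar> < \<epsilon>"
  shows "norm (u t) \<le> 2 * (norm (u 0) + R * \<epsilon>)"
proof -
  have "continuous_on {-\<bar>t\<bar>..\<bar>t\<bar>} (\<lambda>s. norm (u s))"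
    using assms(6) by (intro continuous_on_norm continuous_at_imp_continuous_on ballI
        has_vector_derivative_continuous[OF der]) auto
  then obtain s where s: "\<bar>s\<bar> \<le> \<bar>t\<bar>" "\<And>\<tau>. \<bar>\<tau>\<bar> \<le> \<bar>t\<bar> \<Longrightarrow> norm (u \<tau>) \<le> norm (u s)"
  proof -
    have "compact {-\<bar>t\<bar>..\<bar>t\<bar>}" "{-\<bar>t\<bar>..\<bar>t\<bar>} \<noteq> {}" by auto
    from continuous_attains_sup[OF this \<open>continuous_on {-\<bar>t\<bar>..\<bar>t\<bar>} (\<lambda>s. norm (u s))\<close>]
    obtain s where "s \<in> {-\<bar>t\<bar>..\<bar>t\<bar>}" "\<forall>\<tau>\<in>{-\<bar>t\<bar>..\<bar>t\<bar>}. norm (u \<tau>) \<le> norm (u s)" by blast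
    then show thesis by (intro that[of s]) (auto simp: abs_le_iff)
  qed
  have "norm (u s - u 0) \<le> (L * norm (u s) + R) * \<bar>s\<bar>"
  proof (rule increment_bound)
    fix \<tau> assume \<tau>: "\<bar>\<tau>\<bar> \<le> \<bar>s\<bar>"
    show "(u has_vector_derivative u' \<tau>) (at \<tau> within {-\<bar>s\<bar>..\<bar>s\<bar>})"
      using \<tau> s assms(6) by (intro has_vector_derivative_at_within[OF der]) auto
    have "norm (u' \<tau>) \<le> L * norm (u \<tau>) + R" using bd[of \<tau>] \<tau> s assms(6) by auto
    also have "\<dots> \<le> L * norm (u s) + R" using s \<tau> assms(3) by (auto intro!: mult_left_mono)
    finally show "norm (u' \<tau>) \<le> L * norm (u s) + R" .
  qed
  also have "\<dots> \<le> (L * norm (u s) + R) * \<epsilon>"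
    using s(1) assms(3,4,6) by (intro mult_left_mono) auto
  also have "\<dots> \<le> norm (u s) / 2 + R * \<epsilon>"
    using mult_right_mono[OF assms(5), of "norm (u s)"] by (simp add: algebra_simps)
  finally have "norm (u s) - norm (u 0) \<le> norm (u s) / 2 + R * \<epsilon>"
    using norm_triangle_ineq2[of "u s" "u 0"] by linarith
  then have "norm (u s) \<le> 2 * (norm (u 0) + R * \<epsilon>)" by (simp add: algebra_simps)
  then show ?thesis using s(2)[of t] by simp
qed

lemma gronwall_zero:
  fixes u :: "real \<Rightarrow> 'a::euclidean_space"
  assumes "\<And>t. \<bar>t\<bar> < \<epsilon> \<Longrightarrow> (u has_vector_derivative u' t) (at t)"
    and "\<And>t. \<bar>t\<bar> < \<epsilon> \<Longrightarrow> norm (u' t) \<le> L * norm (u t)"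
    and "0 \<le> L" "L * \<epsilon> \<le> 1 / 2" "\<bar>t\<bar> < \<epsilon>" "u 0 = 0"
  shows "u t = 0"
  using gronwall_small[of \<epsilon> u u' L 0 t] assms by simp

text \<open>Consider the first time at which the curve is outside. Until then its speed is at most
  \<open>B\<close>, so from a start at distance less than \<open>r / 2\<close> it has covered at
  most \<open>r / 2\<close>, too little to get out.\<close>

lemma stays_in_ball_pos:
  fixes u :: "real \<Rightarrow> 'a::euclidean_space"
  assumes der: "\<And>t. \<bar>t\<bar> < \<epsilon> \<Longrightarrow> (u has_vector_derivative u' t) (at t)"
    and bd: "\<And>t. \<bar>t\<bar> < \<epsilon> \<Longrightarrow> u t \<in> ball w r \<Longrightarrow> norm (u' t) \<le> B"
    and "u 0 \<in> ball w (r / 2)" "0 \<le> t" "t < \<epsilon>" "B * t \<le> r / 2"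
  shows "u t \<in> ball w r"
proof (rule ccontr)
  assume out: "u t \<notin> ball w r"
  have cont: "continuous_on {0..t} u"
    using assms(5) by (intro continuous_at_imp_continuous_on ballI
        has_vector_derivative_continuous[OF der]) auto
  define K where "K = {s\<in>{0..t}. r \<le> dist w (u s)}"
  have "closed K" unfolding K_def
    by (intro continuous_on_closed_Collect_le cont continuous_intros closed_atLeastAtMost)
  then have K: "compact K" "t \<in> K" unfolding K_def using out assms(4)
    by (auto simp: compact_eq_bounded_closed intro: bounded_subset[of "{0..t}"])
  obtain s where s: "s \<in> K" "\<And>\<tau>. \<tau> \<in> K \<Longrightarrow> s \<le> \<tau>"
    using compact_attains_inf[of K] K by blast
  have r: "0 < r" using assms(3) by (smt (verit) mem_ball zero_le_dist field_sum_of_halves)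
  have s0: "0 \<le> s" "s \<le> t" "r \<le> dist w (u s)" using s(1) by (auto simp: K_def)
  have inb: "u \<tau> \<in> ball w r" if "0 \<le> \<tau>" "\<tau> < s" for \<tau>
    using s(2)[of \<tau>] that s0 unfolding K_def by fastforce
  have "0 < s"
    using assms(3) r s0 by (cases "s = 0") (auto simp: dist_commute)
  then obtain x where x: "0 < x" "x < s" "norm (u s - u 0) \<le> norm ((s - 0) *\<^sub>R u' x)"
    using mvt_general[of 0 s u "\<lambda>\<tau> h. h *\<^sub>R u' \<tau>"] der s0 assms(5) continuous_on_subset[OF cont]
    by (force simp: has_vector_derivative_def)
  have "norm (u' x) \<le> B" using bd[of x] inb[of x] x s0 assms(5) by auto
  then have "norm (u s - u 0) \<le> B * t"
    using x s0 mult_mono[of s t "norm (u' x)" B] by (simp add: mult.commute)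
  then have "dist w (u s) < r"
    using assms(3,6) dist_triangle[of w "u s" "u 0"] by (auto simp: dist_norm norm_minus_commute)
  with s0 show False by simp
qed

lemma stays_in_ball:
  fixes u :: "real \<Rightarrow> 'a::euclidean_space"
  assumes der: "\<And>t. \<bar>t\<bar> < \<epsilon> \<Longrightarrow> (u has_vector_derivative u' t) (at t)"
    and bd: "\<And>t. \<bar>t\<bar> < \<epsilon> \<Longrightarrow> u t \<in> ball w r \<Longrightarrow> norm (u' t) \<le> B"
    and "u 0 \<in> ball w (r / 2)" "\<bar>t\<bar> < \<epsilon>" "B * \<bar>t\<bar> \<le> r / 2"
  shows "u t \<in> ball w r"
proof (cases "0 \<le> t")
  case True
  then show ?thesis using stays_in_ball_pos[of \<epsilon> u u', OF der bd assms(3) True] assms(4,5) by auto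
next
  case False
  \<comment> \<open>Negative times are positive times of the reversed curve.\<close>
  have "((\<lambda>t. u (- t)) has_vector_derivative - u' (- t)) (at t)" if "\<bar>t\<bar> < \<epsilon>" for t
  proof -
    have "(uminus has_vector_derivative (- 1 :: real)) (at t)"
      by (auto intro!: derivative_eq_intros simp: has_vector_derivative_def)
    then show ?thesis
      using vector_diff_chain_at[of uminus "- 1" t u "u' (- t)"] der[of "- t"] that by (simp add: o_def)
  qed
  then show ?thesis
    using stays_in_ball_pos[of \<epsilon> "\<lambda>t. u (- t)" "\<lambda>t. - u' (- t)" w r B "- t"] bd assms(3-5) False by auto
qed

section \<open>Existence of integral curves and differentiability of the flow\<close>

lemma picard:
  fixes f :: "real \<Rightarrow> 'a::euclidean_space \<Rightarrow> 'a"
  assumes cont: "continuous_on UNIV (\<lambda>p. f (fst p) (snd p))"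
    and lip: "\<And>t x y. norm (f t x - f t y) \<le> L * norm (x - y)"
    and "0 < \<epsilon>" "0 \<le> L" "L * \<epsilon> \<le> 1 / 2"
  obtains u where "u 0 = w" "\<And>t. \<bar>t\<bar> < \<epsilon> \<Longrightarrow> (u has_vector_derivative f t (u t)) (at t)"
proof -
  define I where "I = {-\<epsilon>..\<epsilon>}"
  \<comment> \<open>Clamping time to the interval makes the iterates bounded continuous functions on
    the whole line, so that the Banach fixed point theorem applies to bounded continuous
    functions.\<close>
  define c where "c t = max (-\<epsilon>) (min \<epsilon> t)" for t
  have c: "c t \<in> I" "\<bar>t\<bar> \<le> \<epsilon> \<Longrightarrow> c t = t" for t using assms(3) by (auto simp: c_def I_def)
  have cc: "continuous_on S c" for S unfolding c_def by (intro continuous_intros)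
  \<comment> \<open>Subtracting two integrals with the same left end handles both signs of
    \<open>t\<close> at once.\<close>
  define J where "J v t = integral {-\<epsilon>..t} (\<lambda>s. f s (v s)) - integral {-\<epsilon>..0} (\<lambda>s. f s (v s))" for v t
  have contf: "continuous_on S (\<lambda>s. f s (apply_bcontfun v s))" for v S
    by (rule continuous_on_compose2[OF cont, of S "\<lambda>s. (s, apply_bcontfun v s)", simplified])
      (intro continuous_intros continuous_on_apply_bcontfun)
  have J: "(J (apply_bcontfun v) has_vector_derivative f t (apply_bcontfun v t)) (at t within I)"
      if "t \<in> I" for v t
    unfolding J_def I_def
    using integral_has_vector_derivative[OF contf, of t "-\<epsilon>" \<epsilon> v] that
    by (auto intro!: derivative_eq_intros simp: I_def)
  have Jc: "continuous_on I (J (apply_bcontfun v))" for v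
    by (rule continuous_on_vector_derivative) (rule J)
  have JJ: "continuous_on UNIV (\<lambda>t. w + J (apply_bcontfun v) (c t))" for v
    by (intro continuous_intros continuous_on_compose2[OF Jc cc]) (use c in auto)
  have Jb: "(\<lambda>t. w + J (apply_bcontfun v) (c t)) \<in> bcontfun" for v
  proof -
    have "bounded ((\<lambda>t. w + J (apply_bcontfun v) t) ` I)"
      by (intro compact_imp_bounded compact_continuous_image continuous_intros Jc) (simp add: I_def)
    then have "bounded (range (\<lambda>t. w + J (apply_bcontfun v) (c t)))"
      by (rule bounded_subset) (use c in auto)
    with JJ show ?thesis by (simp add: bcontfun_def)
  qed
  define T where "T v = Bcontfun (\<lambda>t. w + J (apply_bcontfun v) (c t))" for v
  have T: "apply_bcontfun (T v) t = w + J (apply_bcontfun v) (c t)" for v t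
    unfolding T_def using Bcontfun_inverse[OF Jb] by simp
  have J0: "J v 0 = 0" for v by (simp add: J_def)
  have contr: "dist (T v1) (T v2) \<le> (1/2) * dist v1 v2" for v1 v2
  proof (rule dist_bound)
    fix t
    define \<tau> where "\<tau> = c t"
    have \<tau>: "\<bar>\<tau>\<bar> \<le> \<epsilon>" using c(1)[of t] by (auto simp: \<tau>_def I_def)
    define h where "h = (\<lambda>s. J (apply_bcontfun v1) s - J (apply_bcontfun v2) s)"
    have "norm (h \<tau> - h 0) \<le> (L * dist v1 v2) * \<bar>\<tau>\<bar>"
    proof (rule increment_bound)
      fix s assume s: "\<bar>s\<bar> \<le> \<bar>\<tau>\<bar>"
      have "(h has_vector_derivative f s (apply_bcontfun v1 s) - f s (apply_bcontfun v2 s)) (at s within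
          I)"
        unfolding h_def using s \<tau> by (intro has_vector_derivative_diff J) (auto simp: I_def)
      then show "(h has_vector_derivative f s (apply_bcontfun v1 s) - f s (apply_bcontfun v2 s))
          (at s within {-\<bar>\<tau>\<bar>..\<bar>\<tau>\<bar>})"
        by (rule has_vector_derivative_within_subset) (use \<tau> in \<open>auto simp: I_def\<close>)
      show "norm (f s (apply_bcontfun v1 s) - f s (apply_bcontfun v2 s)) \<le> L * dist v1 v2"
        using lip[of s] mult_left_mono[OF dist_bounded[of v1 s v2] assms(4)]
        by (auto simp: dist_norm intro: order_trans)
    qed
    also have "\<dots> \<le> (L * \<epsilon>) * dist v1 v2"
      using mult_left_mono[OF \<tau>, of "L * dist v1 v2"] assms(4) by (simp add: mult_ac)
    also have "\<dots> \<le> (1/2) * dist v1 v2" by (intro mult_right_mono assms) simp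
    finally show "dist (apply_bcontfun (T v1) t) (apply_bcontfun (T v2) t) \<le> (1/2) * dist v1 v2"
      unfolding T \<tau>_def[symmetric] by (simp add: h_def J0 dist_norm)
  qed
  obtain v where v: "T v = v" using banach_fix_type[of "1/2" T] contr by auto
  define u where "u t = w + J (apply_bcontfun v) t" for t
  have uv: "apply_bcontfun v t = u t" if "\<bar>t\<bar> \<le> \<epsilon>" for t
    using T[of v t] c(2)[OF that] by (simp add: v u_def)
  show ?thesis
  proof
    show "u 0 = w" by (simp add: u_def J0)
    fix t assume t: "\<bar>t\<bar> < \<epsilon>"
    have "(u has_vector_derivative f t (u t)) (at t within I)"
      unfolding u_def[abs_def] uv[OF less_imp_le[OF t], symmetric, unfolded u_def]
      using has_vector_derivative_add[OF has_vector_derivative_const[of w] J[of t v]] t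
      by (simp add: I_def abs_le_iff less_imp_le)
    moreover have "at t within I = at t" using t by (intro at_within_interior) (auto simp: I_def)
    ultimately show "(u has_vector_derivative f t (u t)) (at t)" by simp
  qed
qed

lemma closest_point_cball:
  fixes q :: "'a::euclidean_space"
  assumes "0 < r"
  shows "closest_point (cball q r) x \<in> cball q r"
    and "x \<in> cball q r \<Longrightarrow> closest_point (cball q r) x = x"
    and "norm (closest_point (cball q r) x - closest_point (cball q r) y) \<le> norm (x - y)"
    and "continuous_on T (closest_point (cball q r))"
proof -
  have ne: "cball q r \<noteq> {}" using assms by auto
  show "closest_point (cball q r) x \<in> cball q r" by (rule closest_point_in_set[OF closed_cball ne])
  show "x \<in> cball q r \<Longrightarrow> closest_point (cball q r) x = x" by (rule closest_point_self)
  show "norm (closest_point (cball q r) x - closest_point (cball q r) y) \<le> norm (x - y)"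
    using closest_point_lipschitz[OF convex_cball closed_cball ne] by (simp add: dist_norm)
  show "continuous_on T (closest_point (cball q r))"
    by (rule continuous_on_closest_point[OF convex_cball closed_cball ne])
qed

text \<open>The condition \<open>B * \<epsilon> \<le> r / 2\<close> confines curves that start in
  the half ball to the full ball, where the truncated field agrees with \<open>X\<close>.\<close>

lemma local_flow_exists:
  fixes X :: "'a::euclidean_space \<Rightarrow> 'a"
  assumes "0 < r" "0 \<le> L" "0 < \<epsilon>" "L * \<epsilon> \<le> 1 / 2" "B * \<epsilon> \<le> r / 2"
    and lip: "\<And>x y. x \<in> cball q r \<Longrightarrow> y \<in> cball q r \<Longrightarrow> norm (X x - X y) \<le> L * norm (x - y)"
    and bd: "\<And>x. x \<in> cball q r \<Longrightarrow> norm (X x) \<le> B"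
  obtains \<phi> where "\<And>w. \<phi> 0 w = w"
    "\<And>t w. w \<in> ball q (r / 2) \<Longrightarrow> \<bar>t\<bar> < \<epsilon> \<Longrightarrow> \<phi> t w \<in> ball q r"
    "\<And>t w. w \<in> ball q (r / 2) \<Longrightarrow> \<bar>t\<bar> < \<epsilon> \<Longrightarrow> ((\<lambda>s. \<phi> s w) has_vector_derivative X (\<phi> t w)) (at t)"
proof -
  note cp = closest_point_cball[OF assms(1), where q=q]
  \<comment> \<open>composing with the projection onto the ball makes the field globally Lipschitz\<close>
  define Y where "Y x = X (closest_point (cball q r) x)" for x
  have Ylip: "norm (Y x - Y y) \<le> L * norm (x - y)" for x y
    unfolding Y_def using lip[OF cp(1) cp(1), of x y] mult_left_mono[OF cp(3) assms(2), of x y]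
        by linarith
  have Yc: "continuous_on UNIV (\<lambda>p. Y (snd p))"
  proof -
    have "L-lipschitz_on UNIV Y" using Ylip assms(2) by (auto simp: lipschitz_on_def dist_norm)
    then have "continuous_on UNIV Y" by (rule lipschitz_on_continuous_on)
    then show ?thesis by (rule continuous_on_compose2) (auto intro: continuous_intros)
  qed
  have "\<exists>u. u 0 = w \<and> (\<forall>t. \<bar>t\<bar> < \<epsilon> \<longrightarrow> (u has_vector_derivative Y (u t)) (at t))" for w
    by (rule picard[of "\<lambda>_. Y" L \<epsilon> w, OF Yc Ylip assms(3,2,4)]) blast
  then obtain u where u: "\<And>w. u w 0 = w" "\<And>w t. \<bar>t\<bar> < \<epsilon> \<Longrightarrow> (u w has_vector_derivative Y (u w t)) (at t)"
    by metis
  have B: "0 \<le> B" using bd[of q] assms(1) by (auto intro: order_trans[OF norm_ge_zero])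
  have inb: "u w t \<in> ball q r" if "w \<in> ball q (r / 2)" "\<bar>t\<bar> < \<epsilon>" for w t
  proof (rule stays_in_ball[OF u(2)])
    show "norm (Y (u w t)) \<le> B" for t unfolding Y_def by (rule bd[OF cp(1)])
    show "B * \<bar>t\<bar> \<le> r / 2"
      using mult_left_mono[OF less_imp_le[OF that(2)] B] assms(5) by linarith
  qed (use that u in auto)
  show ?thesis
  proof (rule that[of "\<lambda>t w. u w t"])
    show "u w t \<in> ball q r" if "w \<in> ball q (r / 2)" "\<bar>t\<bar> < \<epsilon>" for w t using inb that .
    show "(u w has_vector_derivative X (u w t)) (at t)" if "w \<in> ball q (r / 2)" "\<bar>t\<bar> < \<epsilon>" for w t
      using u(2)[OF that(2), of w] inb[OF that] cp(2)[of "u w t"] by (simp add: Y_def)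
  qed (rule u)
qed

text \<open>\<open>\<Psi>\<close> solves the variational equation. The deviation of
  \<open>\<phi> t y - \<phi> t w\<close> from \<open>\<Psi> t w (y - w)\<close> satisfies a linear
  equation up to an error quadratic in \<open>norm (y - w)\<close>, hence is itself quadratic by
  \<open>gronwall_small\<close>; this gives the derivative.\<close>

lemma local_flow_exists_C1:
  fixes X :: "'a::euclidean_space \<Rightarrow> 'a"
  assumes "open W" "Cinf_on W X" "q \<in> W"
  obtains r L \<phi> \<Psi> \<epsilon>0 where "0 < r" "cball q r \<subseteq> W" "0 \<le> L" "0 < \<epsilon>0"
    "\<And>x v. x \<in> cball q r \<Longrightarrow> norm (dd v X x) \<le> L * norm v" "L * \<epsilon>0 \<le> 1 / 4"
    "\<And>w. \<phi> 0 w = w"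
    "\<And>t w. w \<in> ball q (r / 2) \<Longrightarrow> \<bar>t\<bar> < \<epsilon>0 \<Longrightarrow> \<phi> t w \<in> ball q r"
    "\<And>t w. w \<in> ball q (r / 2) \<Longrightarrow> \<bar>t\<bar> < \<epsilon>0 \<Longrightarrow> ((\<lambda>s. \<phi> s w) has_vector_derivative X (\<phi> t w)) (at t)"
    "\<And>v w. \<Psi> 0 w v = v"
    "\<And>t w v. w \<in> ball q (r / 2) \<Longrightarrow> \<bar>t\<bar> < \<epsilon>0 \<Longrightarrow> ((\<lambda>s. \<Psi> s w v)
        has_vector_derivative dd (\<Psi> t w v) X (\<phi> t w)) (at t)"
    "\<And>t w. w \<in> ball q (r / 2) \<Longrightarrow> \<bar>t\<bar> < \<epsilon>0 \<Longrightarrow> (\<phi> t has_derivative \<Psi> t w) (at w)"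
proof -
  obtain r where r: "0 < r" "cball q r \<subseteq> W" using assms by (meson open_contains_cball)
  note K = compact_cball[of q r] convex_cball[of q r] r(2)
  have "Ck_on 1 W X" "Ck_on 2 W X" using assms(2) by blast+
  then obtain L C where L: "0 \<le> L" "\<And>x y. x \<in> cball q r \<Longrightarrow> y \<in> cball q r \<Longrightarrow> norm (X x - X y)
      \<le> L * norm (x - y)"
     "\<And>x v. x \<in> cball q r \<Longrightarrow> norm (dd v X x) \<le> L * norm v"
     and C: "0 \<le> C" "\<And>a b. a \<in> cball q r \<Longrightarrow> b \<in> cball q r \<Longrightarrow> norm (X a - X b - dd (a - b) X b)
         \<le> C * norm (a - b) * norm (a - b)"
    using C1_lipschitz[OF assms(1) _ K] C2_quadratic_bound[OF assms(1) _ K] by metis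
  have "compact (X ` cball q r)"
    by (intro compact_continuous_image continuous_on_subset[OF Cinf_on_continuous[OF assms(2)]] K)
  then obtain B where B: "0 < B" "\<And>x. x \<in> cball q r \<Longrightarrow> norm (X x) \<le> B"
    by (force dest!: compact_imp_bounded simp: bounded_pos)
  \<comment> \<open>The first bound leaves room for the Gronwall condition and for the later proof
    that the differentials are injective; the second confines the curves to the ball.
    \<open>L + 1\<close> avoids a division by zero.\<close>
  define \<epsilon> where "\<epsilon> = min (1 / (4 * (L + 1))) (r / (2 * B))"
  have "0 < L + 1" using L by simp
  then have \<epsilon>: "0 < \<epsilon>" "(L + 1) * \<epsilon> \<le> 1 / 4" "B * \<epsilon> \<le> r / 2"
    using r B(1) mult_left_mono[of \<epsilon> "1 / (4 * (L + 1))" "L + 1"] mult_left_mono[of \<epsilon> "r / (2 * B)" B]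
    by (simp_all add: \<epsilon>_def del: distrib_left_numeral)
  then have L\<epsilon>: "L * \<epsilon> \<le> 1 / 4" by (simp add: algebra_simps)
  obtain \<phi> where \<phi>: "\<And>w. \<phi> 0 w = w"
    "\<And>t w. w \<in> ball q (r / 2) \<Longrightarrow> \<bar>t\<bar> < \<epsilon> \<Longrightarrow> \<phi> t w \<in> ball q r"
    "\<And>t w. w \<in> ball q (r / 2) \<Longrightarrow> \<bar>t\<bar> < \<epsilon> \<Longrightarrow> ((\<lambda>s. \<phi> s w) has_vector_derivative X (\<phi> t w)) (at t)"
  proof -
    have half: "L * \<epsilon> \<le> 1 / 2" using L\<epsilon> by linarith
    show thesis
      by (rule local_flow_exists[of r L \<epsilon> B q X, OF r(1) L(1) \<epsilon>(1) half \<epsilon>(3) L(2) B(2) that])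
  qed
  \<comment> \<open>Strictly smaller than \<open>\<epsilon>\<close>, so that times clamped to the
    closed interval of radius \<open>\<epsilon>0\<close> stay where \<open>\<phi>\<close> is known
    to be an integral curve.\<close>
  define \<epsilon>0 where "\<epsilon>0 = \<epsilon> / 2"
  have \<epsilon>0: "0 < \<epsilon>0" "\<epsilon>0 < \<epsilon>" using \<epsilon> by (auto simp: \<epsilon>0_def)
  then have L\<epsilon>0: "L * \<epsilon>0 \<le> 1 / 4" using mult_left_mono[of \<epsilon>0 \<epsilon> L] L L\<epsilon> by linarith
  note cp = closest_point_cball[OF r(1), where q=q]
  define c where "c t = max (-\<epsilon>0) (min \<epsilon>0 t)" for t
  have c: "\<bar>c t\<bar> < \<epsilon>" "\<bar>t\<bar> \<le> \<epsilon>0 \<Longrightarrow> c t = t" for t using \<epsilon>0 by (auto simp: c_def)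
  have cc: "continuous_on S c" for S unfolding c_def by (intro continuous_intros)
  have dX: "X differentiable at x" if "x \<in> cball q r" for x
    using Cinf_on_differentiable[OF assms(2)] that r by blast
  have "\<exists>u. u 0 = v \<and> (\<forall>t. \<bar>t\<bar> < \<epsilon>0 \<longrightarrow> (u has_vector_derivative dd (u t) X (\<phi> t w)) (at t))"
    if w: "w \<in> ball q (r / 2)" for w v
  proof -
    define A where "A t v = (\<Sum>b\<in>Basis. (v \<bullet> b) *\<^sub>R dd b X (\<phi> (c t) w))" for t v
    have in': "\<phi> (c t) w \<in> cball q r" for t using \<phi>(2)[OF w c(1)] by (metis ball_subset_cball subsetD)
    have A: "A t v = dd v X (\<phi> (c t) w)" for t v
      unfolding A_def by (rule dd_sum_Basis[OF dX[OF in'], symmetric])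
    have ct: "continuous_on {-\<epsilon><..<\<epsilon>} (\<lambda>s. \<phi> s w)"
      by (intro continuous_at_imp_continuous_on ballI has_vector_derivative_continuous[OF \<phi>(3)] w) auto
    have "continuous_on UNIV (\<lambda>t. \<phi> (c t) w)"
      by (rule continuous_on_compose2[OF ct cc]) (use c(1) in \<open>auto simp: abs_less_iff minus_less_iff\<close>)
    then have "continuous_on UNIV (\<lambda>p. \<phi> (c (fst p)) w)"
      by (rule continuous_on_compose2) (auto intro: continuous_intros)
    then have "continuous_on UNIV (\<lambda>p. dd b X (\<phi> (c (fst p)) w))" for b
      by (rule continuous_on_compose2[OF Cinf_on_continuous[OF Cinf_on_dd[OF assms(1,2)]]]) (use in' r
          in auto)
    then have cont: "continuous_on UNIV (\<lambda>p. A (fst p) (snd p))"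
      unfolding A_def by (intro continuous_intros)
    have lip: "norm (A t x - A t y) \<le> L * norm (x - y)" for t x y
      unfolding A using L(3)[OF in', of "x - y" t] by (simp add: dd_diff_dir[OF dX[OF in']])
    have half: "L * \<epsilon>0 \<le> 1 / 2" using L\<epsilon>0 by linarith
    show ?thesis
      by (rule picard[of A L \<epsilon>0 v, OF cont lip \<epsilon>0(1) L(1) half]) (use c(2) A in auto)
  qed
  then obtain z where z: "\<And>w v. w \<in> ball q (r / 2) \<Longrightarrow> z w v 0 = v"
      "\<And>w v t. w \<in> ball q (r / 2) \<Longrightarrow> \<bar>t\<bar> < \<epsilon>0 \<Longrightarrow> (z w v has_vector_derivative dd (z w v t) X (\<phi> t w))
          (at t)"
    by metis
  \<comment> \<open>Solutions for different initial vectors were chosen separately; superposing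
    those of the basis vectors makes linearity in \<open>v\<close> evident. Outside the half ball
    the identity is a default value.\<close>
  define \<Psi> where "\<Psi> t w v = (if w \<in> ball q (r / 2) then \<Sum>b\<in>Basis. (v \<bullet> b) *\<^sub>R z w b t else v)" for t w v
  have \<Psi>0: "\<Psi> 0 w v = v" for w v
    using z(1) by (simp add: \<Psi>_def euclidean_representation)
  have \<Psi>: "((\<lambda>s. \<Psi> s w v) has_vector_derivative dd (\<Psi> t w v) X (\<phi> t w)) (at t)"
    if "w \<in> ball q (r / 2)" "\<bar>t\<bar> < \<epsilon>0" for w v t
  proof -
    have "\<phi> t w \<in> cball q r" using \<phi>(2)[OF that(1), of t] that \<epsilon>0 by auto
    note D = linear_dd[OF dX[OF this]]
    have "((\<lambda>s. \<Sum>b\<in>Basis. (v \<bullet> b) *\<^sub>R z w b s) has_vector_derivative (\<Sum>b\<in>Basis. (v \<bullet> b) *\<^sub>R dd (z w b t)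
        X (\<phi> t w))) (at t)"
      by (intro has_vector_derivative_sum) (auto intro!: derivative_eq_intros z(2) that)
    also have "(\<Sum>b\<in>Basis. (v \<bullet> b) *\<^sub>R dd (z w b t) X (\<phi> t w)) = dd (\<Psi> t w v) X (\<phi> t w)"
      using that by (simp add: \<Psi>_def linear_sum[OF D] linear_scale[OF D])
    finally show ?thesis using that by (simp add: \<Psi>_def)
  qed
  have lin: "linear (\<Psi> t w)" for t w
    by (auto simp: \<Psi>_def[abs_def] inner_add_left scaleR_add_left sum.distrib scaleR_sum_right intro!:
        linearI)
  have der: "(\<phi> t has_derivative \<Psi> t w) (at w)" if w: "w \<in> ball q (r / 2)" and t: "\<bar>t\<bar> < \<epsilon>0" for t w
  proof -
    obtain d0 where d0: "0 < d0" "ball w d0 \<subseteq> ball q (r / 2)" using w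
        by (meson open_ball open_contains_ball)
    have quad: "norm (\<phi> t y - \<phi> t w - \<Psi> t w (y - w)) \<le> (8 * C * \<epsilon>0) * norm (y - w) * norm (y - w)"
      if y: "y \<in> ball q (r / 2)" for y
    proof -
      have in1: "\<phi> s x \<in> cball q r" if "x \<in> ball q (r / 2)" "\<bar>s\<bar> < \<epsilon>0" for s x
        using \<phi>(2)[OF that(1), of s] that \<epsilon>0 by auto
      have near: "norm (\<phi> s y - \<phi> s w) \<le> 2 * norm (y - w)" if "\<bar>s\<bar> < \<epsilon>0" for s
      proof -
        have "norm (\<phi> s y - \<phi> s w) \<le> 2 * (norm (\<phi> 0 y - \<phi> 0 w) + 0 * \<epsilon>0)"
        proof (rule gronwall_small[where u="\<lambda>s. \<phi> s y - \<phi> s w" and L=L])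
          show "((\<lambda>s. \<phi> s y - \<phi> s w) has_vector_derivative X (\<phi> s y) - X (\<phi> s w)) (at s)" if "\<bar>s\<bar> < \<epsilon>0"
              for s
            using that \<epsilon>0 by (intro has_vector_derivative_diff \<phi>(3) y w) auto
          show "norm (X (\<phi> s y) - X (\<phi> s w)) \<le> L * norm (\<phi> s y - \<phi> s w) + 0" if "\<bar>s\<bar> < \<epsilon>0" for s
            using L(2) in1 that y w by simp
        qed (use L L\<epsilon>0 that in auto)
        then show ?thesis by (simp add: \<phi>(1))
      qed
      \<comment> \<open>\<open>C\<close> times the square of the bound
        \<open>2 * norm (y - w)\<close> supplied by \<open>near\<close>.\<close>
      define R where "R = 4 * C * norm (y - w) * norm (y - w)"
      define e where "e s = \<phi> s y - \<phi> s w - \<Psi> s w (y - w)" for s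
      have "norm (e t) \<le> 2 * (norm (e 0) + R * \<epsilon>0)"
      proof (rule gronwall_small[where L=L])
        show "(e has_vector_derivative X (\<phi> s y) - X (\<phi> s w) - dd (\<Psi> s w (y - w)) X (\<phi> s w)) (at s)"
            if "\<bar>s\<bar> < \<epsilon>0" for s
          unfolding e_def using that \<epsilon>0 by (intro has_vector_derivative_diff \<phi>(3) y w \<Psi>) auto
        show "norm (X (\<phi> s y) - X (\<phi> s w) - dd (\<Psi> s w (y - w)) X (\<phi> s w)) \<le> L * norm (e s) + R"
            if s: "\<bar>s\<bar> < \<epsilon>0" for s
        proof -
          let ?a = "\<phi> s y" and ?b = "\<phi> s w"
          have "X ?a - X ?b - dd (\<Psi> s w (y - w)) X ?b = (X ?a - X ?b - dd (?a - ?b) X ?b) + dd (e s) X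
              ?b"
            by (simp add: e_def dd_diff_dir[OF dX[OF in1[OF w s]]])
          also have "norm \<dots> \<le> C * norm (?a - ?b) * norm (?a - ?b) + L * norm (e s)"
            by (intro norm_triangle_mono C(2) L(3) in1 y w s)
          also have "C * norm (?a - ?b) * norm (?a - ?b) \<le> C * (2 * norm (y - w)) * (2 * norm (y - w))"
            using near[OF s] C(1) by (intro mult_mono) auto
          finally show ?thesis by (simp add: R_def)
        qed
        show "0 \<le> R" using C(1) by (simp add: R_def)
      qed (use L L\<epsilon>0 t in auto)
      then show ?thesis by (simp add: e_def \<phi>(1) \<Psi>0 R_def mult_ac)
    qed
    show ?thesis
      unfolding has_derivative_at_alt
    proof (intro conjI allI impI)
      show "bounded_linear (\<Psi> t w)" using lin by (simp add: linear_conv_bounded_linear)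
      fix e :: real assume e: "0 < e"
      define M where "M = 8 * C * \<epsilon>0 + 1"
      have M: "0 < M" using C(1) \<epsilon>0 by (simp add: M_def add_nonneg_pos)
      show "\<exists>d>0. \<forall>y. norm (y - w) < d \<longrightarrow> norm (\<phi> t y - \<phi> t w - \<Psi> t w (y - w)) \<le> e * norm (y - w)"
      proof (intro exI[of _ "min d0 (e / M)"] conjI allI impI)
        fix y assume y: "norm (y - w) < min d0 (e / M)"
        have "y \<in> ball q (r / 2)" using y d0 by (auto simp: dist_norm norm_minus_commute)
        note quad[OF this]
        also have "8 * C * \<epsilon>0 * norm (y - w) * norm (y - w) \<le> e * norm (y - w)"
        proof (rule mult_right_mono)
          have "8 * C * \<epsilon>0 * norm (y - w) \<le> M * norm (y - w)" by (intro mult_right_mono) (auto simp: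
              M_def)
          also have "\<dots> \<le> M * (e / M)" using y M by (intro mult_left_mono) auto
          finally show "8 * C * \<epsilon>0 * norm (y - w) \<le> e" using M by simp
        qed simp
        finally show "norm (\<phi> t y - \<phi> t w - \<Psi> t w (y - w)) \<le> e * norm (y - w)" .
      qed (use d0 e M in auto)
    qed
  qed
  show ?thesis
    by (rule that[of r L \<epsilon>0 \<phi> \<Psi>, OF r L(1) \<epsilon>0(1) L(3) L\<epsilon>0 \<phi>(1)]) (use \<phi> \<Psi>0 \<Psi> der \<epsilon>0 in auto)
qed

section \<open>Flows preserving the kernels of a family of projections\<close>

lemma dim_image_subspace:
  fixes A :: "'a::euclidean_space \<Rightarrow> 'b::euclidean_space"
  assumes "linear A" "subspace S" "inj_on A S"
  shows "dim (A ` S) = dim S"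
  using dim_image_eq[OF assms(1), of S] assms(2,3) by (metis span_eq_iff)

text \<open>The map \<open>v - Q v\<close> sends the kernel of \<open>P\<close> into that of
  \<open>Q\<close>. It is injective there: a vector that it annihilates lies in the range of
  \<open>Q\<close>, which \<open>P\<close> fixes, so the vector vanishes if \<open>P\<close> kills
  it.\<close>

lemma dim_kernel_le:
  fixes P Q :: "'a::euclidean_space \<Rightarrow> 'a"
  assumes "linear P" "linear Q" "\<And>v. P (Q v) = Q v" "\<And>v. Q (Q v) = Q v"
  shows "dim {v. P v = 0} \<le> dim {v. Q v = 0}"
proof -
  let ?f = "\<lambda>v. v - Q v"
  have sub: "subspace {v. P v = 0}" by (rule linear_subspace_kernel[OF assms(1)])
  have lin: "linear ?f" by (intro linear_compose_sub linear_ident assms(2))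
  have "inj_on ?f {v. P v = 0}"
  proof (rule inj_onI)
    fix x y assume *: "x \<in> {v. P v = 0}" "y \<in> {v. P v = 0}" "x - Q x = y - Q y"
    then have eq: "x - y = Q (x - y)" by (simp add: linear_diff[OF assms(2)] algebra_simps)
    have "P (x - y) = 0" using * by (simp add: linear_diff[OF assms(1)])
    then have "Q (x - y) = 0" using eq assms(3) by metis
    with eq show "x = y" by simp
  qed
  then have "dim {v. P v = 0} = dim (?f ` {v. P v = 0})"
    using dim_image_subspace[OF lin sub] by simp
  also have "\<dots> \<le> dim {v. Q v = 0}"
    by (intro dim_subset) (auto simp: linear_diff[OF assms(2)] assms(4))
  finally show ?thesis .
qed

text \<open>The third condition on \<open>P\<close> says that the \<open>P w\<close> are projections with a common range. Then
  \<open>P (\<phi>\<^sub>t w) (d\<phi>\<^sub>t v)\<close> solves a homogeneous linear equation in \<open>t\<close>, because the Lie derivative of \<open>P\<close>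
  along \<open>X\<close> factors through \<open>P\<close>.\<close>

lemma flow_preserves_kernel:
  fixes P :: "'a::euclidean_space \<Rightarrow> 'a \<Rightarrow> 'a"
  assumes W: "open W" and X: "Cinf_on W X"
    and P: "\<And>w. linear (P w)" "\<And>v. Cinf_on W (\<lambda>w. P w v)" "\<And>w w' v. P w (P w' v) = P w' v"
    and inv: "\<And>w v. w \<in> W \<Longrightarrow> P w v = 0 \<Longrightarrow> dd (X w) (\<lambda>w. P w v) w + P w (dd v X w) = 0"
  shows "flow_preserves W (\<lambda>w. {v. P w v = 0}) X"
  unfolding flow_preserves_def
proof
  fix q assume q: "q \<in> W"
  obtain r L \<phi> \<Psi> \<epsilon>0 where r: "0 < r" "cball q r \<subseteq> W" and L: "0 \<le> L" and \<epsilon>0: "0 < \<epsilon>0"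
    and bd: "\<And>x v. x \<in> cball q r \<Longrightarrow> norm (dd v X x) \<le> L * norm v" and L\<epsilon>0: "L * \<epsilon>0 \<le> 1 / 4"
    and \<phi>0: "\<And>w. \<phi> 0 w = w"
    and \<phi>1: "\<And>t w. w \<in> ball q (r / 2) \<Longrightarrow> \<bar>t\<bar> < \<epsilon>0 \<Longrightarrow> \<phi> t w \<in> ball q r"
    and \<phi>2: "\<And>t w. w \<in> ball q (r / 2) \<Longrightarrow> \<bar>t\<bar> < \<epsilon>0 \<Longrightarrow> ((\<lambda>s. \<phi> s w) has_vector_derivative X (\<phi> t w)) (at t)"
    and \<Psi>0: "\<And>v w. \<Psi> 0 w v = v"
    and \<Psi>: "\<And>t w v. w \<in> ball q (r / 2) \<Longrightarrow> \<bar>t\<bar> < \<epsilon>0 \<Longrightarrow> ((\<lambda>s. \<Psi> s w v)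
        has_vector_derivative dd (\<Psi> t w v) X (\<phi> t w)) (at t)"
    and der: "\<And>t w. w \<in> ball q (r / 2) \<Longrightarrow> \<bar>t\<bar> < \<epsilon>0 \<Longrightarrow> (\<phi> t has_derivative \<Psi> t w) (at w)"
    by (rule local_flow_exists_C1[OF W X q], rule that; assumption)
  \<comment> \<open>Arranged so that \<open>\<Lambda> (\<phi> s w) (\<Psi> s w v)\<close> is the
    time derivative of \<open>P (\<phi> s w) (\<Psi> s w v)\<close>.\<close>
  define \<Lambda> where "\<Lambda> w u = dd (X w) (\<lambda>w. P w u) w + P w (dd u X w)" for w u
  have dX: "X differentiable at w" if "w \<in> W" for w using Cinf_on_differentiable[OF X that] .
  have dP: "(\<lambda>w. P w u) differentiable at w" if "w \<in> W" for w u using Cinf_on_differentiable[OF P(2)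
      that] .
  have Psum: "P w u = (\<Sum>b\<in>Basis. (u \<bullet> b) *\<^sub>R P w b)" for w u by (rule linear_sum_Basis[OF P(1)])
  have ddP: "dd a (\<lambda>w. P w u) w = (\<Sum>b\<in>Basis. (u \<bullet> b) *\<^sub>R dd a (\<lambda>w. P w b) w)" if "w \<in> W" for a u w
  proof (rule has_derivative_dd[where f'="\<lambda>a. \<Sum>b\<in>Basis. (u \<bullet> b) *\<^sub>R dd a (\<lambda>w. P w b) w"])
    show "((\<lambda>w. P w u) has_derivative (\<lambda>a. \<Sum>b\<in>Basis. (u \<bullet> b) *\<^sub>R dd a (\<lambda>w. P w b) w)) (at w)"
      unfolding Psum[of _ u] by (intro derivative_intros has_derivative_ddI dP that)
  qed
  have lin\<Lambda>: "linear (\<Lambda> w)" if "w \<in> W" for w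
    unfolding \<Lambda>_def
  proof (rule linear_compose_add)
    have "linear (\<lambda>u. \<Sum>b\<in>Basis. (u \<bullet> b) *\<^sub>R dd (X w) (\<lambda>w. P w b) w)"
      by (auto intro!: linearI simp: inner_add_left scaleR_add_left sum.distrib scaleR_sum_right)
    then show "linear (\<lambda>u. dd (X w) (\<lambda>w. P w u) w)"
      by (simp add: ddP[OF that, symmetric])
    show "linear (\<lambda>u. P w (dd u X w))"
      using linear_compose[OF linear_dd[OF dX[OF that]] P(1)] by (simp add: o_def)
  qed
  have cont\<Lambda>: "continuous_on W (\<lambda>w. \<Lambda> w u)" for u
  proof -
    have "continuous_on W (\<lambda>w. \<Sum>b\<in>Basis. (dd u X w \<bullet> b) *\<^sub>R P w b)"
      by (intro continuous_intros Cinf_on_continuous Cinf_on_dd[OF W X] P(2))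
    then have "continuous_on W (\<lambda>w. P w (dd u X w))" by (simp add: Psum[of _ "dd u X _", symmetric])
    then show ?thesis unfolding \<Lambda>_def
      by (intro continuous_intros Cinf_on_continuous[OF Cinf_on_dd_field[OF W P(2) X]])
  qed
  obtain C where C: "0 \<le> C" "\<And>w u. w \<in> cball q r \<Longrightarrow> norm (\<Lambda> w u) \<le> C * norm u"
    using linear_family_bound[of "cball q r" \<Lambda>] lin\<Lambda> continuous_on_subset[OF cont\<Lambda> r(2)] r(2)
    by (metis compact_cball subsetD)
  have \<Lambda>P: "\<Lambda> w u = \<Lambda> w (P w u)" if "w \<in> W" for w u
  proof -
    have "P w (u - P w u) = 0" by (simp add: linear_diff[OF P(1)] P(3))
    then have "\<Lambda> w (u - P w u) = 0" unfolding \<Lambda>_def by (rule inv[OF that])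
    then show ?thesis by (simp add: linear_diff[OF lin\<Lambda>[OF that]])
  qed
  define \<epsilon> where "\<epsilon> = min \<epsilon>0 (1 / (2 * (C + 1)))"
  have \<epsilon>: "0 < \<epsilon>" "\<epsilon> \<le> \<epsilon>0" using \<epsilon>0 C(1) by (auto simp: \<epsilon>_def)
  have "(C + 1) * \<epsilon> \<le> 1 / 2"
    using C(1) mult_left_mono[of \<epsilon> "1 / (2 * (C + 1))" "C + 1"]
        by (simp add: \<epsilon>_def del: distrib_left_numeral)
  with \<epsilon> have C\<epsilon>: "C * \<epsilon> \<le> 1 / 2" by (simp add: algebra_simps)
  have into: "P (\<phi> t w) (\<Psi> t w v) = 0" if w: "w \<in> ball q (r / 2)" and t: "\<bar>t\<bar> < \<epsilon>" and v: "P w v = 0"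
      for t w v
  proof (rule gronwall_zero[where u="\<lambda>s. P (\<phi> s w) (\<Psi> s w v)" and L=C and \<epsilon>=\<epsilon>])
    fix s assume s: "\<bar>s\<bar> < \<epsilon>"
    then have s0: "\<bar>s\<bar> < \<epsilon>0" using \<epsilon> by simp
    have inc: "\<phi> s w \<in> cball q r" and inW: "\<phi> s w \<in> W" using \<phi>1[OF w s0] r(2) by auto
    have Pd: "((\<lambda>s. P (\<phi> s w) b) has_vector_derivative dd (X (\<phi> s w)) (\<lambda>w. P w b) (\<phi> s w)) (at s)" for b
    proof -
      have "((\<lambda>s. P (\<phi> s w) b) has_derivative (\<lambda>h. dd (h *\<^sub>R X (\<phi> s w)) (\<lambda>w. P w b) (\<phi> s w))) (at s)"
        by (rule has_derivative_compose[where f="\<lambda>s. \<phi> s w", OF _ has_derivative_ddI[OF dP[OF inW]]])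
          (use \<phi>2[OF w s0] in \<open>simp add: has_vector_derivative_def\<close>)
      then show ?thesis unfolding has_vector_derivative_def dd_scaleR_dir[OF dP[OF inW]] .
    qed
    have "((\<lambda>s. \<Sum>b\<in>Basis. (\<Psi> s w v \<bullet> b) *\<^sub>R P (\<phi> s w) b) has_vector_derivative
      (\<Sum>b\<in>Basis. (\<Psi> s w v \<bullet> b) *\<^sub>R dd (X (\<phi> s w)) (\<lambda>w. P w b) (\<phi> s w) + (dd (\<Psi> s w v) X (\<phi> s w) \<bullet> b) *\<^sub>R
          P (\<phi> s w) b)) (at s)"
    proof (intro has_vector_derivative_sum has_vector_derivative_scaleR Pd)
      fix b :: 'a
      show "((\<lambda>s. \<Psi> s w v \<bullet> b) has_field_derivative dd (\<Psi> s w v) X (\<phi> s w) \<bullet> b) (at s)"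
        using bounded_linear.has_vector_derivative[OF bounded_linear_inner_left \<Psi>[OF w s0]]
        by (simp add: has_real_derivative_iff_has_vector_derivative)
    qed
    moreover have "(\<Sum>b\<in>Basis. (\<Psi> s w v \<bullet> b) *\<^sub>R dd (X (\<phi> s w)) (\<lambda>w. P w b) (\<phi> s w) + (dd (\<Psi> s w v) X (\<phi>
        s w) \<bullet> b) *\<^sub>R P (\<phi> s w) b)
        = \<Lambda> (\<phi> s w) (\<Psi> s w v)"
      unfolding \<Lambda>_def ddP[OF inW, of _ "\<Psi> s w v"] Psum[of _ "dd (\<Psi> s w v) X (\<phi> s w)"] sum.distrib ..
    moreover have "(\<lambda>s. P (\<phi> s w) (\<Psi> s w v)) = (\<lambda>s. \<Sum>b\<in>Basis. (\<Psi> s w v \<bullet> b) *\<^sub>R P (\<phi> s w) b)"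
      by (rule ext) (rule Psum)
    ultimately show "((\<lambda>s. P (\<phi> s w) (\<Psi> s w v)) has_vector_derivative \<Lambda> (\<phi> s w) (\<Psi> s w v)) (at s)"
      by (simp only:)
    show "norm (\<Lambda> (\<phi> s w) (\<Psi> s w v)) \<le> C * norm (P (\<phi> s w) (\<Psi> s w v))"
      unfolding \<Lambda>P[OF inW, of "\<Psi> s w v"] by (rule C(2)[OF inc])
  next
    show "P (\<phi> 0 w) (\<Psi> 0 w v) = 0" by (simp add: \<phi>0 \<Psi>0 v)
  qed (use C C\<epsilon> t in auto)
  \<comment> \<open>By \<open>two\<close> and \<open>L * \<epsilon>0 \<le> 1 / 4\<close>, the vector
    \<open>\<Psi> t w v\<close> differs from \<open>v\<close> by at most half the norm of
    \<open>v\<close>, so it vanishes only with \<open>v\<close>.\<close>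
  have inj: "v = 0" if w: "w \<in> ball q (r / 2)" and t: "\<bar>t\<bar> < \<epsilon>0" and v: "\<Psi> t w v = 0" for t w v
  proof -
    have b: "norm (dd (\<Psi> s w v) X (\<phi> s w)) \<le> L * norm (\<Psi> s w v)" if "\<bar>s\<bar> < \<epsilon>0" for s
      using \<phi>1[OF w that] by (intro bd) auto
    have two: "norm (\<Psi> s w v) \<le> 2 * (norm (\<Psi> 0 w v) + 0 * \<epsilon>0)" if "\<bar>s\<bar> < \<epsilon>0" for s
      by (rule gronwall_small[where u="\<lambda>s. \<Psi> s w v", OF \<Psi>[OF w]]) (use b L L\<epsilon>0 that in auto)
    have "norm (\<Psi> t w v - \<Psi> 0 w v) \<le> (L * (2 * norm v)) * \<bar>t\<bar>"
    proof (rule increment_bound[where u="\<lambda>s. \<Psi> s w v"])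
      fix s assume "\<bar>s\<bar> \<le> \<bar>t\<bar>"
      then have s: "\<bar>s\<bar> < \<epsilon>0" using t by simp
      show "((\<lambda>s. \<Psi> s w v) has_vector_derivative dd (\<Psi> s w v) X (\<phi> s w)) (at s within {-\<bar>t\<bar>..\<bar>t\<bar>})"
        by (rule has_vector_derivative_at_within[OF \<Psi>[OF w s]])
      show "norm (dd (\<Psi> s w v) X (\<phi> s w)) \<le> L * (2 * norm v)"
        using b[OF s] mult_left_mono[OF two[OF s] L] by (simp add: \<Psi>0)
    qed
    also have "\<dots> \<le> (L * (2 * norm v)) * \<epsilon>0" using t L by (intro mult_left_mono) auto
    also have "\<dots> \<le> norm v / 2" using mult_right_mono[OF L\<epsilon>0, of "2 * norm v"] by (simp add: mult_ac)
    finally show "v = 0" by (simp add: v \<Psi>0)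
  qed
  show "\<exists>\<epsilon> N \<phi>. q \<in> N \<and> local_flow W X \<epsilon> N \<phi> \<and>
      (\<forall>t w. \<bar>t\<bar> < \<epsilon> \<longrightarrow> w \<in> N \<longrightarrow> preserves_at W (\<lambda>w. {v. P w v = 0}) (\<phi> t) w)"
  proof (intro exI[of _ \<epsilon>] exI[of _ "ball q (r / 2)"] exI[of _ \<phi>] conjI allI impI)
    show "q \<in> ball q (r / 2)" using r by simp
    have sub: "ball q (r / 2) \<subseteq> W" using r by (intro order_trans[OF _ r(2)]) auto
    show "local_flow W X \<epsilon> (ball q (r / 2)) \<phi>"
      unfolding local_flow_def
    proof (intro conjI ballI allI impI)
      show "openin (top_of_set W) (ball q (r / 2))" using sub by (intro open_subset) auto
      fix w t assume "w \<in> ball q (r / 2)" "\<bar>t\<bar> < \<epsilon>"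
      then have *: "w \<in> ball q (r / 2)" "\<bar>t\<bar> < \<epsilon>0" using \<epsilon> by auto
      show "\<phi> t w \<in> W" using \<phi>1[OF *] r(2) by auto
      show "((\<lambda>s. \<phi> s w) has_vector_derivative X (\<phi> t w)) (at t)" by (rule \<phi>2[OF *])
    qed (use \<phi>0 \<epsilon> in auto)
    fix t w assume t: "\<bar>t\<bar> < \<epsilon>" and w: "w \<in> ball q (r / 2)"
    have D: "(\<phi> t has_derivative \<Psi> t w) (at w)" using der[OF w] t \<epsilon> by auto
    note lin = has_derivative_linear[OF D]
    \<comment> \<open>The inclusion is \<open>into\<close>; it is an equality because the
      differential is injective and all the kernels have the same dimension.\<close>
    have "\<Psi> t w ` {v. P w v = 0} = {v. P (\<phi> t w) v = 0}"
    proof (rule subspace_dim_equal)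
      show "subspace (\<Psi> t w ` {v. P w v = 0})" "subspace {v. P (\<phi> t w) v = 0}"
        by (intro linear_subspace_image[OF lin] linear_subspace_kernel[OF P(1)])+
      show "\<Psi> t w ` {v. P w v = 0} \<subseteq> {v. P (\<phi> t w) v = 0}" using into[OF w t] by auto
      have "inj (\<Psi> t w)" using inj[OF w, of t] t \<epsilon>(2) by (auto simp: linear_injective_0[OF lin])
      then have "dim (\<Psi> t w ` {v. P w v = 0}) = dim {v. P w v = 0}"
        by (intro dim_image_eq[OF lin]) (auto intro: inj_on_subset)
      moreover have "dim {v. P (\<phi> t w) v = 0} \<le> dim {v. P w v = 0}"
        by (rule dim_kernel_le[OF P(1) P(1) P(3) P(3)])
      ultimately show "dim {v. P (\<phi> t w) v = 0} \<le> dim (\<Psi> t w ` {v. P w v = 0})" by simp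
    qed
    then show "preserves_at W (\<lambda>w. {v. P w v = 0}) (\<phi> t) w"
      unfolding preserves_at_def using has_derivative_at_withinI[OF D] by blast
  qed
qed

text \<open>Difference quotients carry the estimate to the limit. In this way a bound at points of a
  submanifold, taken along a curve in it, becomes a bound for the velocity of the curve.\<close>

lemma norm_vector_derivative_le:
  fixes k :: "real \<Rightarrow> 'a::euclidean_space" and c :: "real \<Rightarrow> 'b::euclidean_space"
  assumes "(k has_vector_derivative k') (at 0)" "k 0 = 0" "(c has_vector_derivative v) (at 0)" "c 0 = w"
    and "eventually (\<lambda>s. norm (k s) \<le> M * norm (c s - w)) (at 0)"
  shows "norm k' \<le> M * norm v"
proof -
  have lim: "((\<lambda>s. (f s - f 0) /\<^sub>R s) \<longlongrightarrow> f') (at 0)" if "(f has_vector_derivative f') (at 0)"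
    for f :: "real \<Rightarrow> 'c::euclidean_space" and f'
  proof -
    have lim0: "((\<lambda>s. norm (f s - f 0 - s *\<^sub>R f') / norm s) \<longlongrightarrow> 0) (at 0)"
      using that by (simp add: has_vector_derivative_def has_derivative_at)
    have *: "norm (f s - f 0 - s *\<^sub>R f') / norm s = norm ((f s - f 0) /\<^sub>R s - f')" if "s \<noteq> 0" for s
    proof -
      have "(f s - f 0) /\<^sub>R s - f' = (f s - f 0 - s *\<^sub>R f') /\<^sub>R s" using that
          by (simp add: scaleR_diff_right)
      then show ?thesis by (simp add: divide_inverse)
    qed
    have "eventually (\<lambda>s. norm (f s - f 0 - s *\<^sub>R f') / norm s = norm ((f s - f 0) /\<^sub>R s - f')) (at 0)"
      unfolding eventually_at using * by (intro exI[of _ 1]) auto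
    with lim0 have "((\<lambda>s. norm ((f s - f 0) /\<^sub>R s - f')) \<longlongrightarrow> 0) (at 0)"
      by (rule Lim_transform_eventually)
    then show ?thesis by (simp add: tendsto_norm_zero_iff LIM_zero_iff)
  qed
  have lims: "((\<lambda>s. norm ((k s - k 0) /\<^sub>R s)) \<longlongrightarrow> norm k') (at 0)"
    "((\<lambda>s. M * norm ((c s - c 0) /\<^sub>R s)) \<longlongrightarrow> M * norm v) (at 0)"
    by (intro tendsto_intros lim assms)+
  show ?thesis
  proof (rule tendsto_le[OF trivial_limit_at lims(2,1)])
    show "eventually (\<lambda>s. norm ((k s - k 0) /\<^sub>R s) \<le> M * norm ((c s - c 0) /\<^sub>R s)) (at 0)"
      using assms(5)
    proof eventually_elim
      case (elim s)
      then show ?case using mult_left_mono[OF elim, of "\<bar>inverse s\<bar>"] by (simp add: assms mult_ac)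
    qed
  qed
qed

text \<open>The differentials \<open>A t\<close> are not assumed to depend on \<open>t\<close> in any regular way; differentiability
  at \<open>t = 0\<close> comes from the mean value inequality applied to
  \<open>\<phi>\<^sub>t x - \<phi>\<^sub>t w - t Dg(w)(x - w)\<close>.\<close>

lemma flow_first_variation:
  fixes V g :: "'a::euclidean_space \<Rightarrow> 'a"
  assumes flow: "local_flow M V \<epsilon> N \<phi>" and w: "w \<in> N"
    and W: "open W" "w \<in> W" "Cinf_on W g" "\<And>x. x \<in> M \<inter> W \<Longrightarrow> g x = V x"
    and c: "0 < \<eta>" "\<And>s. \<bar>s\<bar> < \<eta> \<Longrightarrow> c s \<in> M" "c 0 = w" "(c has_vector_derivative v) (at 0)"
    and A: "\<And>t. \<bar>t\<bar> < \<epsilon> \<Longrightarrow> (\<phi> t has_derivative A t) (at w within M)"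
  shows "((\<lambda>t. A t v) has_vector_derivative dd v g w) (at 0)" and "A 0 v = v"
proof -
  have \<epsilon>: "0 < \<epsilon>" and N: "openin (top_of_set M) N"
    and \<phi>0: "\<And>x. x \<in> N \<Longrightarrow> \<phi> 0 x = x" and \<phi>M: "\<And>t x. x \<in> N \<Longrightarrow> \<bar>t\<bar> < \<epsilon> \<Longrightarrow> \<phi> t x \<in> M"
    and \<phi>V: "\<And>t x. x \<in> N \<Longrightarrow> \<bar>t\<bar> < \<epsilon> \<Longrightarrow> ((\<lambda>s. \<phi> s x) has_vector_derivative V (\<phi> t x)) (at t)"
    using flow unfolding local_flow_def by auto
  obtain r where r: "0 < r" "cball w r \<subseteq> W" using W by (meson open_contains_cball)
  note K = compact_cball[of w r] convex_cball[of w r] r(2)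
  have "Ck_on 1 W g" using W(3) by blast
  then obtain L where L: "0 \<le> L" "\<And>x y. x \<in> cball w r \<Longrightarrow> y \<in> cball w r \<Longrightarrow> norm (g x - g y)
      \<le> L * norm (x - y)"
     "\<And>x v. x \<in> cball w r \<Longrightarrow> norm (dd v g x) \<le> L * norm v"
    using C1_lipschitz[OF W(1) _ K] by metis
  have "compact (g ` cball w r)"
    by (intro compact_continuous_image continuous_on_subset[OF Cinf_on_continuous[OF W(3)]] K)
  then obtain B where B: "0 < B" "\<And>x. x \<in> cball w r \<Longrightarrow> norm (g x) \<le> B"
    by (force dest!: compact_imp_bounded simp: bounded_pos)
  have dg: "g differentiable at w" by (rule Cinf_on_differentiable[OF W(3,2)])
  have contc: "isCont c 0" by (rule has_vector_derivative_continuous[OF c(4)])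
  obtain T where T: "open T" "N = M \<inter> T" using N by (auto simp: openin_open)
  \<comment> \<open>In other words, \<open>A t v\<close> equals \<open>v\<close> plus
    \<open>t\<close> times \<open>dd v g w\<close> up to \<open>o(t)\<close>, which contains both
    conclusions. The bound is first proved for differences of trajectories (\<open>est\<close>) and
    then passed to tangent vectors.\<close>
  have main: "\<exists>\<tau>>0. \<forall>t. \<bar>t\<bar> < \<tau> \<longrightarrow> \<bar>t\<bar> < \<epsilon> \<and> norm (A t v - v - t *\<^sub>R dd v g w) \<le> \<kappa> * \<bar>t\<bar> * norm v"
      if \<kappa>: "0 < \<kappa>" for \<kappa>
  proof -
    obtain \<delta>0 where \<delta>0: "0 < \<delta>0" 
      "\<And>a b. a \<in> ball w \<delta>0 \<Longrightarrow> b \<in> ball w \<delta>0 \<Longrightarrow> norm (g a - g b - dd (a - b) g w) \<le> (\<kappa> / 4) * norm (a - b)"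
      by (rule C1_strict_derivative[OF W(1) \<open>Ck_on 1 W g\<close> W(2), of "\<kappa> / 4"]) (use \<kappa> in auto)
    define \<delta> where "\<delta> = min \<delta>0 r"
    have \<delta>: "0 < \<delta>" using \<delta>0 r by (simp add: \<delta>_def)
    have sub: "x \<in> ball w \<delta>0" "x \<in> cball w r" "x \<in> W" if "x \<in> ball w \<delta>" for x
      using that r(2) by (auto simp: \<delta>_def)
    \<comment> \<open>The four bounds provide, in this order: existence of the flow, confinement to
      the ball of radius \<open>\<delta>\<close>, the Gronwall condition, and a second-order error
      factor \<open>2 * L * L * \<epsilon>1\<close> of at most \<open>\<kappa> / 2\<close>.\<close>
    define \<epsilon>1 where "\<epsilon>1 = Min {\<epsilon>, \<delta> / (2 * B), 1 / (2 * (L + 1)), \<kappa> / (4 * (L * L + 1))}"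
    have LL: "0 < L * L + 1" "0 < L + 1" using L(1) by (auto intro: add_nonneg_pos)
    have e1: "0 < \<epsilon>1" using \<epsilon> \<delta> B(1) LL \<kappa> by (simp add: \<epsilon>1_def)
    have e2: "\<epsilon>1 \<le> \<epsilon>" by (simp add: \<epsilon>1_def)
    have "\<epsilon>1 \<le> \<delta> / (2 * B)" "\<epsilon>1 \<le> 1 / (2 * (L + 1))" "\<epsilon>1 \<le> \<kappa> / (4 * (L * L + 1))" unfolding \<epsilon>1_def
        by (intro Min_le; simp)+
    then have "\<epsilon>1 * (2 * B) \<le> \<delta>" "\<epsilon>1 * (2 * (L + 1)) \<le> 1" "\<epsilon>1 * (4 * (L * L + 1)) \<le> \<kappa>"
      using B(1) LL by (simp_all add: pos_le_divide_eq del: distrib_left_numeral)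
    then have e3: "B * \<epsilon>1 \<le> \<delta> / 2" "L * \<epsilon>1 \<le> 1 / 2" "2 * L * L * \<epsilon>1 \<le> \<kappa> / 2"
      using e1 by (auto simp: algebra_simps)
    have inb: "\<phi> t x \<in> ball w \<delta>" if "x \<in> N" "x \<in> ball w (\<delta> / 2)" "\<bar>t\<bar> < \<epsilon>1" for t x
    proof (rule stays_in_ball[where \<epsilon>=\<epsilon>1 and u="\<lambda>t. \<phi> t x" and B=B])
      show "((\<lambda>t. \<phi> t x) has_vector_derivative V (\<phi> t x)) (at t)" if "\<bar>t\<bar> < \<epsilon>1" for t
        using \<phi>V that e2 \<open>x \<in> N\<close> by auto
      show "norm (V (\<phi> t x)) \<le> B" if "\<bar>t\<bar> < \<epsilon>1" "\<phi> t x \<in> ball w \<delta>" for t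
        using B(2) W(4) sub[OF that(2)] \<phi>M[OF \<open>x \<in> N\<close>, of t] that(1) e2 by (metis IntI less_le_trans)
      show "B * \<bar>t\<bar> \<le> \<delta> / 2" using mult_left_mono[OF less_imp_le[OF that(3)], of B] B(1) e3 by linarith
    qed (use that \<phi>0 in auto)
    have gV: "V (\<phi> t x) = g (\<phi> t x)" if "x \<in> N" "x \<in> ball w (\<delta> / 2)" "\<bar>t\<bar> < \<epsilon>1" for t x
      using inb[OF that] sub(3) \<phi>M[OF that(1)] that(3) e2 W(4) by auto
    have est: "norm (\<phi> t x - \<phi> t w - (x - w) - t *\<^sub>R dd (x - w) g w) \<le> (\<kappa> * \<bar>t\<bar>) * norm (x - w)"
      if x: "x \<in> N" "x \<in> ball w (\<delta> / 2)" and t: "\<bar>t\<bar> < \<epsilon>1" for t x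
    proof -
      have wb: "w \<in> ball w (\<delta> / 2)" using \<delta> by simp
      have der: "((\<lambda>s. \<phi> s x - \<phi> s w) has_vector_derivative g (\<phi> s x) - g (\<phi> s w)) (at s)" if "\<bar>s\<bar> < \<epsilon>1"
          for s
        using \<phi>V[OF x(1), of s] \<phi>V[OF w, of s] gV[OF x that] gV[OF w wb that] that e2
        by (intro has_vector_derivative_diff) auto
      have lip: "norm (g (\<phi> s x) - g (\<phi> s w)) \<le> L * norm (\<phi> s x - \<phi> s w)" if "\<bar>s\<bar> < \<epsilon>1" for s
        using inb[OF x that] inb[OF w wb that] by (intro L(2) sub)
      have near: "norm (\<phi> s x - \<phi> s w) \<le> 2 * (norm (\<phi> 0 x - \<phi> 0 w) + 0 * \<epsilon>1)" if "\<bar>s\<bar> < \<epsilon>1" for s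
        by (rule gronwall_small[where u="\<lambda>s. \<phi> s x - \<phi> s w", OF der]) (use lip L e3 that in auto)
      have near: "norm (\<phi> s x - \<phi> s w) \<le> 2 * norm (x - w)" if "\<bar>s\<bar> < \<epsilon>1" for s
        using near[OF that] by (simp add: \<phi>0 x w)
      have close: "norm (\<phi> s x - \<phi> s w - (x - w)) \<le> (L * (2 * norm (x - w))) * \<bar>s\<bar>" if s: "\<bar>s\<bar> < \<epsilon>1"
          for s
      proof -
        have "norm ((\<phi> s x - \<phi> s w) - (\<phi> 0 x - \<phi> 0 w)) \<le> (L * (2 * norm (x - w))) * \<bar>s\<bar>"
        proof (rule increment_bound[where u="\<lambda>s. \<phi> s x - \<phi> s w"])
          fix \<tau> assume "\<bar>\<tau>\<bar> \<le> \<bar>s\<bar>"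
          then have \<tau>: "\<bar>\<tau>\<bar> < \<epsilon>1" using s by simp
          show "((\<lambda>s. \<phi> s x - \<phi> s w) has_vector_derivative g (\<phi> \<tau> x) - g (\<phi> \<tau> w)) (at \<tau> within
              {-\<bar>s\<bar>..\<bar>s\<bar>})"
            by (rule has_vector_derivative_at_within[OF der[OF \<tau>]])
          show "norm (g (\<phi> \<tau> x) - g (\<phi> \<tau> w)) \<le> L * (2 * norm (x - w))"
            using lip[OF \<tau>] mult_left_mono[OF near[OF \<tau>] L(1)] by linarith
        qed
        then show ?thesis by (simp add: \<phi>0 x w)
      qed
      define h where "h s = \<phi> s x - \<phi> s w - s *\<^sub>R dd (x - w) g w" for s
      have "norm (h t - h 0) \<le> (\<kappa> * norm (x - w)) * \<bar>t\<bar>"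
      proof (rule increment_bound[where u=h])
        fix s assume "\<bar>s\<bar> \<le> \<bar>t\<bar>"
        then have s: "\<bar>s\<bar> < \<epsilon>1" using t by simp
        let ?a = "\<phi> s x" and ?b = "\<phi> s w"
        have "(h has_vector_derivative g ?a - g ?b - dd (x - w) g w) (at s)"
          unfolding h_def by (rule has_vector_derivative_diff[OF der[OF s]]) (auto intro!:
              derivative_eq_intros)
        then show "(h has_vector_derivative g ?a - g ?b - dd (x - w) g w) (at s within {-\<bar>t\<bar>..\<bar>t\<bar>})"
          by (rule has_vector_derivative_at_within)
        \<comment> \<open>The first part is controlled by strict differentiability at
          \<open>w\<close>, the second because the difference of the trajectories has moved little
          from \<open>x - w\<close> (\<open>close\<close>).\<close>
        have "g ?a - g ?b - dd (x - w) g w = (g ?a - g ?b - dd (?a - ?b) g w) + dd (?a - ?b - (x - w)) g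
            w"
          by (simp add: dd_diff_dir[OF dg])
        also have "norm \<dots> \<le> (\<kappa> / 4) * norm (?a - ?b) + L * norm (?a - ?b - (x - w))"
          by (intro norm_triangle_mono \<delta>0(2) L(3) sub(1)[OF inb] x w wb s) (use r in simp)
        also have "(\<kappa> / 4) * norm (?a - ?b) \<le> (\<kappa> / 2) * norm (x - w)"
          using mult_left_mono[OF near[OF s], of "\<kappa> / 4"] \<kappa> by simp
        also have "L * norm (?a - ?b - (x - w)) \<le> L * ((L * (2 * norm (x - w))) * \<epsilon>1)"
          using close[OF s] s L(1) by (intro mult_left_mono order_trans[OF close[OF s]]) auto
        also have "\<dots> = (2 * L * L * \<epsilon>1) * norm (x - w)" by simp
        also have "\<dots> \<le> (\<kappa> / 2) * norm (x - w)" by (intro mult_right_mono e3) simp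
        finally show "norm (g ?a - g ?b - dd (x - w) g w) \<le> \<kappa> * norm (x - w)" by simp
      qed
      then show ?thesis by (simp add: h_def \<phi>0 x w algebra_simps)
    qed
    \<comment> \<open>The estimate \<open>est\<close> holds only at points of \<open>N\<close>;
      applying it along \<open>c\<close> and letting the parameter tend to 0 reaches the tangent
      vector \<open>v\<close>.\<close>
    have "norm (A t v - v - t *\<^sub>R dd v g w) \<le> \<kappa> * \<bar>t\<bar> * norm v" if t: "\<bar>t\<bar> < \<epsilon>1" for t
    proof (rule norm_vector_derivative_le[where c=c and w=w and k="\<lambda>s. \<phi> t (c s) - \<phi> t w - (c s - w) - t
        *\<^sub>R dd (c s - w) g w"])
      have te: "\<bar>t\<bar> < \<epsilon>" using t e2 by simp
      have "(\<phi> t has_derivative A t) (at (c 0) within c ` {-\<eta><..<\<eta>})"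
        unfolding c(3) by (rule has_derivative_subset[OF A[OF te]]) (use c(2) in
            \<open>auto simp: abs_less_iff minus_less_iff\<close>)
      from diff_chain_within[OF has_derivative_at_withinI[OF c(4)[unfolded has_vector_derivative_def]]
          this]
      have "((\<phi> t \<circ> c) has_derivative A t \<circ> (\<lambda>h. h *\<^sub>R v)) (at 0 within {-\<eta><..<\<eta>})" .
      moreover have "at 0 within {-\<eta><..<\<eta>} = at 0" using c(1) by (intro at_within_open) auto
      moreover have "A t (h *\<^sub>R v) = h *\<^sub>R A t v" for h
        by (rule linear_scale[OF has_derivative_linear[OF A[OF te]]])
      ultimately have pc: "((\<lambda>s. \<phi> t (c s)) has_vector_derivative A t v) (at 0)"
        by (simp add: has_vector_derivative_def o_def)
      have cd: "((\<lambda>s. c s - w) has_vector_derivative v) (at 0)"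
        using has_vector_derivative_diff[OF c(4) has_vector_derivative_const[of w]] by simp
      have "bounded_linear (\<lambda>v. dd v g w)" using linear_dd[OF dg]
          by (simp add: linear_conv_bounded_linear)
      from bounded_linear.has_vector_derivative[OF this cd]
      have gd: "((\<lambda>s. dd (c s - w) g w) has_vector_derivative dd v g w) (at 0)" .
      show "((\<lambda>s. \<phi> t (c s) - \<phi> t w - (c s - w) - t *\<^sub>R dd (c s - w) g w)
          has_vector_derivative A t v - v - t *\<^sub>R dd v g w) (at 0)"
        using has_vector_derivative_diff[OF has_vector_derivative_diff[OF has_vector_derivative_diff[OF
            pc has_vector_derivative_const[of "\<phi> t w"]] cd]
           bounded_linear.has_vector_derivative[OF bounded_linear_scaleR_right gd, of t]] by simp
      show "\<phi> t (c 0) - \<phi> t w - (c 0 - w) - t *\<^sub>R dd (c 0 - w) g w = 0"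
        by (simp add: c(3) dd_zero_dir[OF dg])
      have "eventually (\<lambda>s. c s \<in> T \<inter> ball w (\<delta> / 2)) (at 0)"
        using contc w T \<delta> c(3) by (intro topological_tendstoD) (auto simp: isCont_def)
      moreover have "eventually (\<lambda>s. \<bar>s\<bar> < \<eta>) (at (0::real))"
        using c(1) by (auto simp: eventually_at dist_real_def)
      ultimately show "eventually (\<lambda>s. norm (\<phi> t (c s) - \<phi> t w - (c s - w) - t *\<^sub>R dd (c s - w) g w)
          \<le> \<kappa> * \<bar>t\<bar> * norm (c s - w)) (at 0)"
        by eventually_elim (use T c(2) in \<open>auto intro!: est t\<close>)
    qed (use c in auto)
    then show ?thesis using e1 e2 by (intro exI[of _ \<epsilon>1]) auto
  qed
  show A0: "A 0 v = v" 
  proof -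
    obtain \<tau> where "0 < \<tau>" "\<And>t. \<bar>t\<bar> < \<tau> \<Longrightarrow> norm (A t v - v - t *\<^sub>R dd v g w) \<le> 1 * \<bar>t\<bar> * norm v"
      using main[of 1] by auto
    from this(2)[of 0] this(1) show ?thesis by simp
  qed
  show "((\<lambda>t. A t v) has_vector_derivative dd v g w) (at 0)"
    unfolding has_vector_derivative_def has_derivative_at_alt
  proof (intro conjI allI impI bounded_linear_scaleR_left)
    fix e :: real assume e: "0 < e"
    have p: "0 < norm v + 1" by (simp add: add_nonneg_pos)
    then obtain \<tau> where \<tau>: "0 < \<tau>" "\<And>t. \<bar>t\<bar> < \<tau> \<Longrightarrow> norm (A t v - v - t *\<^sub>R dd v g w)
        \<le> e / (norm v + 1) * \<bar>t\<bar> * norm v"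
      using main[of "e / (norm v + 1)"] e by auto
    have "e / (norm v + 1) * norm v \<le> e"
      using p e by (simp add: divide_simps mult_left_mono)
    then have "e / (norm v + 1) * \<bar>t\<bar> * norm v \<le> e * \<bar>t\<bar>" for t :: real
      using mult_right_mono[of "e / (norm v + 1) * norm v" e "\<bar>t\<bar>"] by (simp add: mult_ac)
    then show "\<exists>d>0. \<forall>y. norm (y - 0) < d \<longrightarrow> norm (A y v - A 0 v - (y - 0) *\<^sub>R dd v g w)
        \<le> e * norm (y - 0)"
      using \<tau> by (intro exI[of _ \<tau>]) (auto simp: A0 intro: order_trans)
  qed
qed

section \<open>Jet coordinates\<close>

lemma to_nat_on_UNIV_less: "to_nat_on UNIV (a::'a::finite) < CARD('a)"
  using bij_betw_apply[OF to_nat_on_finite[of "UNIV :: 'a set"]] by auto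

lemma to_nat_on_from_nat_into_UNIV: "i < CARD('a::finite) \<Longrightarrow> to_nat_on UNIV (from_nat_into UNIV i :: 'a)
    = i"
  by (rule to_nat_on_from_nat_into) (simp add: bij_betw_imp_surj_on[OF to_nat_on_finite])

text \<open>Coordinates are functions on the natural numbers, so that the shift from
  \<open>i\<close> to \<open>i + 1\<close> needs no arithmetic on index types; only values below the
  cardinalities are read.\<close>

definition jet_of :: "real \<Rightarrow> (nat \<Rightarrow> real) \<Rightarrow> (nat \<Rightarrow> real) \<Rightarrow> ('p::finite, 'q::finite) jet" where
  "jet_of a f g = (a, (\<chi> k. f (to_nat_on UNIV k)), (\<chi> k. g (to_nat_on UNIV k)))"

definition ey :: "nat \<Rightarrow> ('p::finite, 'q::finite) jet" where
  "ey i = jet_of 0 (\<lambda>k. if k = i then 1 else 0) (\<lambda>_. 0)"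

definition ez :: "nat \<Rightarrow> ('p::finite, 'q::finite) jet" where
  "ez j = jet_of 0 (\<lambda>_. 0) (\<lambda>k. if k = j then 1 else 0)"

lemma jet_of_sel [simp]:
  "jx (jet_of a f g) = a"
  "i < CARD('p) \<Longrightarrow> jy i (jet_of a f g :: ('p::finite, 'q::finite) jet) = f i"
  "j < CARD('q) \<Longrightarrow> jz j (jet_of a f g :: ('p::finite, 'q::finite) jet) = g j"
  by (auto simp: jet_of_def jx_def jy_def jz_def to_nat_on_from_nat_into_UNIV)

lemma jet_eqI:
  fixes v w :: "('p::finite, 'q::finite) jet"
  assumes "jx v = jx w" "\<And>i. i < CARD('p) \<Longrightarrow> jy i v = jy i w" "\<And>j. j < CARD('q) \<Longrightarrow> jz j v = jz j w"
  shows "v = w"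
proof -
  have "fst (snd v) $ k = fst (snd w) $ k" for k
    using assms(2)[OF to_nat_on_UNIV_less, of k] by (simp add: jy_def)
  moreover have "snd (snd v) $ k = snd (snd w) $ k" for k
    using assms(3)[OF to_nat_on_UNIV_less, of k] by (simp add: jz_def)
  ultimately show ?thesis using assms(1) by (simp add: prod_eq_iff vec_eq_iff jx_def)
qed

lemma bounded_linear_jet_sel:
  "bounded_linear jx" "bounded_linear (jy i)" "bounded_linear (jz j)"
  by (auto intro!: linear_conv_bounded_linear[THEN iffD1] linearI simp: jx_def jy_def jz_def)

lemma jet_sel_linear [simp]:
  "jx (v + w) = jx v + jx w" "jy i (v + w) = jy i v + jy i w" "jz j (v + w) = jz j v + jz j w"
  "jx (v - w) = jx v - jx w" "jy i (v - w) = jy i v - jy i w" "jz j (v - w) = jz j v - jz j w"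
  "jx (r *\<^sub>R v) = r * jx v" "jy i (r *\<^sub>R v) = r * jy i v" "jz j (r *\<^sub>R v) = r * jz j v"
  "jx 0 = 0" "jy i 0 = 0" "jz j 0 = 0"
  by (auto simp: jx_def jy_def jz_def)

lemma jet_sel_basis [simp]:
  "jx (ey k) = 0" "jx (ez k) = 0"
  "i < CARD('p) \<Longrightarrow> jy i (ey k :: ('p::finite, 'q::finite) jet) = (if i = k then 1 else 0)"
  "i < CARD('p) \<Longrightarrow> jy i (ez k :: ('p::finite, 'q::finite) jet) = 0"
  "j < CARD('q) \<Longrightarrow> jz j (ey k :: ('p::finite, 'q::finite) jet) = 0"
  "j < CARD('q) \<Longrightarrow> jz j (ez k :: ('p::finite, 'q::finite) jet) = (if j = k then 1 else 0)"
  by (auto simp: ey_def ez_def)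

lemma jet_sel_sum:
  "jx (\<Sum>i\<in>I. v i) = (\<Sum>i\<in>I. jx (v i))" "jy k (\<Sum>i\<in>I. v i) = (\<Sum>i\<in>I. jy k (v i))"
  "jz k (\<Sum>i\<in>I. v i) = (\<Sum>i\<in>I. jz k (v i))"
  by (induction I rule: infinite_finite_induct) auto

lemma ez_eq_axis:
  assumes "n < CARD('q)"
  shows "(ez n :: ('p::finite, 'q::finite) jet) = (0, 0, axis (from_nat_into UNIV n) 1)"
proof -
  have "(to_nat_on UNIV k = n) = (k = from_nat_into UNIV n)" for k :: 'q
    using to_nat_on_from_nat_into_UNIV[OF assms] by (metis UNIV_I countable_finite finite
        from_nat_into_to_nat_on)
  then show ?thesis by (auto simp: ez_def jet_of_def vec_eq_iff axis_def)
qed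

lemma drop_y_sel [simp]:
  fixes w :: "('p::finite, 'q::finite) jet"
  shows "jx (drop_y w) = jx w" "jz j (drop_y w) = jz j w"
    "i < CARD('r) \<Longrightarrow> jy i (drop_y w :: ('r::finite, 'q) jet) = jy i w"
  by (auto simp: drop_y_def jx_def jz_def jy_def to_nat_on_from_nat_into_UNIV)

lemma bounded_linear_jet_map:
  fixes f :: "'v::euclidean_space \<Rightarrow> ('p::finite, 'q::finite) jet"
  assumes "linear (\<lambda>w. jx (f w))" "\<And>i. i < CARD('p) \<Longrightarrow> linear (\<lambda>w. jy i (f w))"
    "\<And>j. j < CARD('q) \<Longrightarrow> linear (\<lambda>w. jz j (f w))"
  shows "bounded_linear f"
  unfolding linear_conv_bounded_linear[symmetric]
  by (rule linearI; rule jet_eqI)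
    (simp_all add: linear_add[OF assms(1)] linear_add[OF assms(2)] linear_add[OF assms(3)]
      linear_scale[OF assms(1)] linear_scale[OF assms(2)] linear_scale[OF assms(3)])

lemma linear_jet_sel: "linear jx" "linear (jy i)" "linear (jz j)"
  using bounded_linear_jet_sel by (auto simp: linear_conv_bounded_linear)

lemma linear_drop_y: "bounded_linear (drop_y :: ('p::finite, 'q::finite) jet \<Rightarrow> ('r::finite, 'q) jet)"
  by (rule bounded_linear_jet_map) (auto intro: linear_jet_sel)

lemma Cinf_on_jet:
  fixes f :: "'v::euclidean_space \<Rightarrow> ('p::finite, 'q::finite) jet"
  assumes "open S" "Cinf_on S (\<lambda>w. jx (f w))" "\<And>i. i < CARD('p) \<Longrightarrow> Cinf_on S (\<lambda>w. jy i (f w))"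
    "\<And>j. j < CARD('q) \<Longrightarrow> Cinf_on S (\<lambda>w. jz j (f w))"
  shows "Cinf_on S f"
proof
  fix k
  have "Ck_on k S (\<lambda>w. jx (f w) *\<^sub>R jet_of 1 (\<lambda>_. 0) (\<lambda>_. 0) + (\<Sum>i<CARD('p). jy i (f w) *\<^sub>R ey i) +
      (\<Sum>j<CARD('q). jz j (f w) *\<^sub>R ez j) :: ('p, 'q) jet)"
    using assms by (intro Ck_on_add Ck_on_sum Ck_on_scaleR Ck_on_const) auto
  then show "Ck_on k S f"
  proof (rule Ck_on_cong[OF assms(1), rotated])
    show "jx (f w) *\<^sub>R jet_of 1 (\<lambda>_. 0) (\<lambda>_. 0) + (\<Sum>i<CARD('p). jy i (f w) *\<^sub>R ey i) + (\<Sum>j<CARD('q). jz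
        j (f w) *\<^sub>R ez j) = f w" for w
      by (rule jet_eqI) (auto simp: jet_sel_sum if_distrib[of "\<lambda>x. _ * x"] sum.delta' cong: if_cong)
  qed
qed

section \<open>Internal symmetries in coordinates\<close>

text \<open>With \<open>[en, d] = z\<close> and \<open>[en, z] = f e'\<close>, the two conclusions are obtained by applying \<open>en\<close> to
  the hypothesis \<open>k\<close> and then to the first conclusion.\<close>

lemma commutator_relations:
  fixes g k \<xi> c f :: "'a::euclidean_space \<Rightarrow> real" and d z :: "'a \<Rightarrow> 'a"
  assumes S: "open S" and smooth: "Cinf_on S g" "Cinf_on S k" "Cinf_on S \<xi>" "Cinf_on S c" "Cinf_on S d"
      "Cinf_on S z"
    and dz: "\<And>u. u \<in> S \<Longrightarrow> dd en d u = z u" and zf: "\<And>u. u \<in> S \<Longrightarrow> dd en z u = f u *\<^sub>R e'"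
    and g: "\<And>u. u \<in> S \<Longrightarrow> dd en g u = c u * dd en \<xi> u"
    and k: "\<And>u. u \<in> S \<Longrightarrow> dd (d u) g u = k u + c u * dd (d u) \<xi> u"
    and k': "\<And>u. u \<in> S \<Longrightarrow> dd en k u = dd (d u) c u * dd en \<xi> u"
    and c: "\<And>u. u \<in> S \<Longrightarrow> dd en c u = 0"
    and u: "u \<in> S"
  shows "dd (z u) g u = c u * dd (z u) \<xi> u"
    and "f u * dd e' g u = c u * (f u * dd e' \<xi> u) - dd en \<xi> u * dd (z u) c u"
proof -
  note D = Cinf_on_differentiable
  have field: "Cinf_on S (\<lambda>u. dd (d u) \<xi> u)" "Cinf_on S (\<lambda>u. dd (z u) \<xi> u)"
    by (intro Cinf_on_dd_field S smooth)+
  have one: "dd (z u) g u = c u * dd (z u) \<xi> u" if u: "u \<in> S" for u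
  proof -
    have "dd en (\<lambda>u. dd (d u) g u) u = dd en (\<lambda>u. k u + c u * dd (d u) \<xi> u) u"
      by (rule dd_cong_open[OF S u k])
    also have "\<dots> = dd en k u + (dd en c u * dd (d u) \<xi> u + c u * dd en (\<lambda>u. dd (d u) \<xi> u) u)"
      using D[OF smooth(2) u] D[OF smooth(4) u] D[OF field(1) u] by (simp add: dd_add dd_mult)
    finally have L: "dd en (\<lambda>u. dd (d u) g u) u = dd (d u) c u * dd en \<xi> u + c u * (dd (d u) (dd en \<xi>) u
        + dd (z u) \<xi> u)"
      by (simp add: k' c u dd_commute_field[OF S smooth(3,5) u] dz)
    have "dd en (\<lambda>u. dd (d u) g u) u = dd (d u) (dd en g) u + dd (z u) g u"
      by (simp add: dd_commute_field[OF S smooth(1,5) u] dz u)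
    also have "dd (d u) (dd en g) u = dd (d u) (\<lambda>u. c u * dd en \<xi> u) u"
      by (rule dd_cong_open[OF S u g])
    also have "\<dots> = dd (d u) c u * dd en \<xi> u + c u * dd (d u) (dd en \<xi>) u"
      by (rule dd_mult[OF D[OF smooth(4) u] D[OF Cinf_on_dd[OF S smooth(3)] u]])
    finally show ?thesis using L by (simp add: algebra_simps)
  qed
  show "dd (z u) g u = c u * dd (z u) \<xi> u" by (rule one[OF u])
  have "dd en (\<lambda>u. dd (z u) g u) u = dd en (\<lambda>u. c u * dd (z u) \<xi> u) u"
    by (rule dd_cong_open[OF S u one])
  also have "\<dots> = dd en c u * dd (z u) \<xi> u + c u * dd en (\<lambda>u. dd (z u) \<xi> u) u"
    by (rule dd_mult[OF D[OF smooth(4) u] D[OF field(2) u]])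
  also have "\<dots> = c u * (dd (z u) (dd en \<xi>) u + f u * dd e' \<xi> u)"
    by (simp add: c u dd_commute_field[OF S smooth(3,6) u] zf dd_scaleR_dir[OF D[OF smooth(3) u]])
  finally have L: "dd en (\<lambda>u. dd (z u) g u) u = c u * (dd (z u) (dd en \<xi>) u + f u * dd e' \<xi> u)" .
  have "dd en (\<lambda>u. dd (z u) g u) u = dd (z u) (dd en g) u + f u * dd e' g u"
    by (simp add: dd_commute_field[OF S smooth(1,6) u] zf u dd_scaleR_dir[OF D[OF smooth(1) u]])
  also have "dd (z u) (dd en g) u = dd (z u) (\<lambda>u. c u * dd en \<xi> u) u"
    by (rule dd_cong_open[OF S u g])
  also have "\<dots> = dd (z u) c u * dd en \<xi> u + c u * dd (z u) (dd en \<xi>) u"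
    by (rule dd_mult[OF D[OF smooth(4) u] D[OF Cinf_on_dd[OF S smooth(3)] u]])
  finally show "f u * dd e' g u = c u * (f u * dd e' \<xi> u) - dd en \<xi> u * dd (z u) c u"
    using L by (simp add: algebra_simps)
qed

text \<open>The type \<open>('r, 'q) jet\<close> carries the coordinates on the equation. The
  argument \<open>ptype\<close> fixes the type variable \<open>'p\<close> of the ambient jets, which
  occurs in no other parameter.\<close>

locale monge_equation =
  fixes m n :: nat
    and U :: "('r::finite, 'q::finite) jet set"
    and F :: "('r, 'q) jet \<Rightarrow> real"
    and ptype :: "('p::finite) itself"
  assumes card: "CARD('r) = m" "CARD('p) = m + 1" "CARD('q) = n + 1"
    and mn: "0 < m" "m \<le> n" "(m, n) \<noteq> (1, 1)" "(m, n) \<noteq> (1, 2)"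
    and U: "open U" and F: "Cinf_on U F"
begin

text \<open>Guarantees that the components along \<open>z_(n-2)\<close>, and along
  \<open>z_(n-3)\<close> if \<open>m = 1\<close>, exist; the vanishing of
  \<open>\<partial>_n \<xi>\<close> is extracted from them.\<close>

lemma n_ge: "2 \<le> n" "m = 1 \<Longrightarrow> 3 \<le> n"
  using mn by (cases n; auto)+

text \<open>\<open>yn i\<close> is the restriction of the coordinate \<open>y\<^sub>i\<^sub>+\<^sub>1\<close> to the equation, where \<open>y\<^sub>m = F\<close>.\<close>

definition yn :: "nat \<Rightarrow> ('r, 'q) jet \<Rightarrow> real" where
  "yn i u = (if Suc i < m then jy (Suc i) u else F u)"

text \<open>Parametrises the equation as a graph, inverse there to \<open>drop_y\<close>. Composing
  with it turns fields on the equation into maps on an open set.\<close>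

definition lift :: "('r, 'q) jet \<Rightarrow> ('p, 'q) jet" where
  "lift u = jet_of (jx u) (\<lambda>i. if i < m then jy i u else F u) (\<lambda>j. jz j u)"

text \<open>The field \<open>D\<close> in the chart \<open>U\<close>. Its \<open>z_n\<close>
  component may be normalised to 0 because \<open>\<partial>_n\<close> belongs to the distribution
  as well.\<close>

definition dvec :: "('r, 'q) jet \<Rightarrow> ('r, 'q) jet" where
  "dvec u = jet_of 1 (\<lambda>i. yn i u) (\<lambda>j. if j < n then jz (Suc j) u else 0)"

abbreviation "en \<equiv> ez n :: ('r, 'q) jet"
abbreviation "e' \<equiv> ey (m - 1) :: ('r, 'q) jet"

definition zvec :: "('r, 'q) jet \<Rightarrow> ('r, 'q) jet" where
  "zvec u = dd en F u *\<^sub>R e' + ez (n - 1)"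

lemma lift_sel [simp]:
  "jx (lift u) = jx u" "j \<le> n \<Longrightarrow> jz j (lift u) = jz j u"
  "i < m \<Longrightarrow> jy i (lift u) = jy i u" "jy m (lift u) = F u" "i < m \<Longrightarrow> jy (Suc i) (lift u) = yn i u"
  by (auto simp: lift_def yn_def card)

lemma dvec_sel [simp]:
  "jx (dvec u) = 1" "i < m \<Longrightarrow> jy i (dvec u) = yn i u" "j < n \<Longrightarrow> jz j (dvec u) = jz (Suc j) u"
  "jz n (dvec u) = 0"
  by (auto simp: dvec_def card)

lemma Cinf_on_jet_sel: "Cinf_on S jx" "Cinf_on S (jy i)" "Cinf_on S (jz j)"
  by (auto intro: Ck_on_linear bounded_linear_jet_sel)

lemma Ck_on_F: "S \<subseteq> U \<Longrightarrow> Ck_on k S F" "S \<subseteq> U \<Longrightarrow> Ck_on k S (dd a F)"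
  using F Cinf_on_dd[OF U F, of a] by (auto intro: Ck_on_subset simp: prod_eq_iff)

lemma Cinf_on_yn: "S \<subseteq> U \<Longrightarrow> Cinf_on S (yn i)"
  using Cinf_on_jet_sel(2)[of S "Suc i"] Ck_on_F(1) by (cases "Suc i < m") (auto simp: yn_def[abs_def])

lemma Cinf_on_dvec: "open S \<Longrightarrow> S \<subseteq> U \<Longrightarrow> Cinf_on S dvec"
  by (rule Cinf_on_jet) (auto simp: card less_Suc_eq intro: Ck_on_const Cinf_on_yn[rule_format]
      Cinf_on_jet_sel[rule_format] cong: if_cong)

lemma Cinf_on_lift: "open S \<Longrightarrow> S \<subseteq> U \<Longrightarrow> Cinf_on S lift"
  by (intro Cinf_on_jet) (auto simp: card less_Suc_eq intro: Cinf_on_jet_sel[rule_format] Ck_on_F)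

lemma Cinf_on_zvec: "open S \<Longrightarrow> S \<subseteq> U \<Longrightarrow> Cinf_on S zvec"
  unfolding zvec_def[abs_def] by (intro allI Ck_on_add Ck_on_scaleR Ck_on_const Ck_on_F)

lemma dd_jet_sel: "dd a jx u = jx a" "dd a (jy i) u = jy i a" "dd a (jz j) u = jz j a"
  by (intro dd_linear bounded_linear_jet_sel)+

lemma dd_yn: "dd a (yn i) u = (if Suc i < m then jy (Suc i) a else dd a F u)"
  by (simp add: yn_def[abs_def] dd_jet_sel)

lemma dd_dvec:
  assumes "u \<in> U"
  shows "dd a dvec u = jet_of 0 (\<lambda>i. dd a (yn i) u) (\<lambda>j. if j < n then jz (Suc j) a else 0)" (is "_
      = ?R")
proof (rule jet_eqI)
  have d: "dvec differentiable at u" using Cinf_on_differentiable[OF Cinf_on_dvec assms] U by simp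
  note C = dd_linear_comp[OF _ d, symmetric]
  show "jx (dd a dvec u) = jx ?R"
    by (simp add: C bounded_linear_jet_sel dd_const)
  show "jy i (dd a dvec u) = jy i ?R" if "i < CARD('r)" for i
    using that by (simp add: C bounded_linear_jet_sel card cong: if_cong)
  show "jz j (dd a dvec u) = jz j ?R" if "j < CARD('q)" for j
    using that by (cases "j = n") (simp_all add: C bounded_linear_jet_sel card dd_const dd_jet_sel)
qed

text \<open>As \<open>en\<close> is a constant field, this is the bracket of
  \<open>\<partial>_n\<close> and \<open>D\<close>. Only two entries of \<open>D\<close> depend on
  \<open>z_n\<close>: the last \<open>y\<close> entry, which is \<open>F\<close>, and the entry
  along \<open>z_(n-1)\<close>.\<close>

lemma dd_en_dvec: "u \<in> U \<Longrightarrow> dd en dvec u = zvec u"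
  using mn by (intro jet_eqI) (auto simp: dd_dvec dd_yn zvec_def card)

lemma dd_en_zvec: "u \<in> U \<Longrightarrow> dd en zvec u = dd en (dd en F) u *\<^sub>R e'"
proof -
  assume u: "u \<in> U"
  have d: "dd en F differentiable at u" using Cinf_on_differentiable[OF Cinf_on_dd[OF U F] u] .
  then have "((\<lambda>u. dd en F u *\<^sub>R e' + ez (n - 1)) has_derivative (\<lambda>a. dd a (dd en F) u *\<^sub>R e')) (at u)"
    by (auto intro!: derivative_eq_intros has_derivative_ddI)
  then show ?thesis unfolding zvec_def[abs_def] by (rule has_derivative_dd)
qed

end

text \<open>Since the Lie derivative of \<open>dy_i - y_(i+1) dx\<close> along \<open>v\<close> is
  \<open>d\<eta>_i - \<eta>_(i+1) dx - y_(i+1) d\<xi>\<close>, the assumptions \<open>vy\<close> and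
  \<open>vz\<close> say that the Lie derivatives of the contact forms vanish on \<open>D\<close> and
  \<open>\<partial>_n\<close>, the infinitesimal form of preserving the distribution.\<close>

locale internal_field = monge_equation m n U F ptype
  for m n :: nat and U :: "('r::finite, 'q::finite) jet set" and F :: "('r, 'q) jet \<Rightarrow> real"
    and ptype :: "('p::finite) itself" +
  fixes S :: "('r, 'q) jet set" and v :: "('r, 'q) jet \<Rightarrow> ('p, 'q) jet"
  assumes S: "open S" "S \<subseteq> U" and v: "Cinf_on S v"
    and F_nn: "\<And>u. u \<in> S \<Longrightarrow> dd en (dd en F) u \<noteq> 0"
    and vy: "\<And>u a i. u \<in> S \<Longrightarrow> a = dvec u \<or> a = en \<Longrightarrow> i < m \<Longrightarrow>
      jy i (dd a v u) = jy (Suc i) (v u) * jx a + yn i u * jx (dd a v u)"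
    and vz: "\<And>u a j. u \<in> S \<Longrightarrow> a = dvec u \<or> a = en \<Longrightarrow> j < n \<Longrightarrow>
      jz j (dd a v u) = jz (Suc j) (v u) * jx a + jz (Suc j) u * jx (dd a v u)"
begin

abbreviation \<xi> where "\<xi> u \<equiv> jx (v u)"
abbreviation \<eta> where "\<eta> i u \<equiv> jy i (v u)"
abbreviation \<zeta> where "\<zeta> j u \<equiv> jz j (v u)"

lemma smooth_components: "Cinf_on S \<xi>" "Cinf_on S (\<eta> i)" "Cinf_on S (\<zeta> j)"
  using v by (auto intro: Ck_on_linear_comp bounded_linear_jet_sel)

lemma dd_components:
  assumes "u \<in> S" shows "dd a \<xi> u = jx (dd a v u)" "dd a (\<eta> i) u = jy i (dd a v u)" "dd a (\<zeta> j) u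
      = jz j (dd a v u)"
  using Cinf_on_differentiable[OF v assms] by (auto intro: dd_linear_comp bounded_linear_jet_sel)

text \<open>In \<open>commutator_relations\<close> the component \<open>\<eta> i\<close> plays the
  role of \<open>g\<close>, the next component that of \<open>k\<close>, and the coordinate
  \<open>y_(i+1)\<close> that of \<open>c\<close>. The bound on \<open>i\<close> ensures that
  \<open>y_(i+1)\<close> is a free coordinate on the equation, killed by
  \<open>\<partial>_n\<close>, and that \<open>\<eta> (Suc i)\<close> has a contact condition of its
  own.\<close>

lemma relations_y:
  assumes u: "u \<in> S" and i: "Suc i < m"
  shows "dd (zvec u) (\<eta> i) u = jy (Suc i) u * dd (zvec u) \<xi> u"
    and "dd en (dd en F) u * dd e' (\<eta> i) u = jy (Suc i) u * (dd en (dd en F) u * dd e' \<xi> u) - dd en \<xi> u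
        * jy (Suc i) (zvec u)"
proof -
  have yn: "yn i u = jy (Suc i) u" for u using i by (simp add: yn_def)
  note * = commutator_relations[where g="\<eta> i" and k="\<eta> (Suc i)" and c="jy (Suc i)" and en=en and e'=e'
      and f="dd en (dd en F)" and \<xi>=\<xi>,
     OF S(1) smooth_components(2,2,1) Cinf_on_jet_sel(2) Cinf_on_dvec[OF S] Cinf_on_zvec[OF S] _ _ _ _ _
         _ u]
  have H: "dd en dvec u = zvec u" "dd en zvec u = dd en (dd en F) u *\<^sub>R e'"
    "dd en (\<eta> i) u = jy (Suc i) u * dd en \<xi> u"
    "dd (dvec u) (\<eta> i) u = \<eta> (Suc i) u + jy (Suc i) u * dd (dvec u) \<xi> u"
    "dd en (\<eta> (Suc i)) u = dd (dvec u) (jy (Suc i)) u * dd en \<xi> u"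
    "dd en (jy (Suc i)) u = 0" if "u \<in> S" for u
    using that S(2) i vy[OF that, of "dvec u" i] vy[OF that, of en i] vy[OF that, of en "Suc i"]
    by (auto simp: dd_en_dvec dd_en_zvec dd_components dd_jet_sel yn card)
  show "dd (zvec u) (\<eta> i) u = jy (Suc i) u * dd (zvec u) \<xi> u"
    by (rule *(1)) (use H in auto)
  show "dd en (dd en F) u * dd e' (\<eta> i) u = jy (Suc i) u * (dd en (dd en F) u * dd e' \<xi> u) - dd en \<xi> u *
      jy (Suc i) (zvec u)"
    using *(2) H by (simp add: dd_jet_sel)
qed

lemma relations_z:
  assumes u: "u \<in> S" and j: "Suc j < n"
  shows "dd (zvec u) (\<zeta> j) u = jz (Suc j) u * dd (zvec u) \<xi> u"
    and "dd en (dd en F) u * dd e' (\<zeta> j) u = jz (Suc j) u * (dd en (dd en F) u * dd e' \<xi> u) - dd en \<xi> u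
        * jz (Suc j) (zvec u)"
proof -
  note * = commutator_relations[where g="\<zeta> j" and k="\<zeta> (Suc j)" and c="jz (Suc j)" and en=en and e'=e'
      and f="dd en (dd en F)" and \<xi>=\<xi>,
     OF S(1) smooth_components(3,3,1) Cinf_on_jet_sel(3) Cinf_on_dvec[OF S] Cinf_on_zvec[OF S] _ _ _ _ _
         _ u]
  have H: "dd en dvec u = zvec u" "dd en zvec u = dd en (dd en F) u *\<^sub>R e'"
    "dd en (\<zeta> j) u = jz (Suc j) u * dd en \<xi> u"
    "dd (dvec u) (\<zeta> j) u = \<zeta> (Suc j) u + jz (Suc j) u * dd (dvec u) \<xi> u"
    "dd en (\<zeta> (Suc j)) u = dd (dvec u) (jz (Suc j)) u * dd en \<xi> u"
    "dd en (jz (Suc j)) u = 0" if "u \<in> S" for u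
    using that S(2) j vz[OF that, of "dvec u" j] vz[OF that, of en j] vz[OF that, of en "Suc j"]
    by (auto simp: dd_en_dvec dd_en_zvec dd_components dd_jet_sel card)
  show "dd (zvec u) (\<zeta> j) u = jz (Suc j) u * dd (zvec u) \<xi> u"
    by (rule *(1)) (use H in auto)
  show "dd en (dd en F) u * dd e' (\<zeta> j) u = jz (Suc j) u * (dd en (dd en F) u * dd e' \<xi> u) - dd en \<xi> u *
      jz (Suc j) (zvec u)"
    using *(2) H by (simp add: dd_jet_sel)
qed

text \<open>If \<open>m \<ge> 2\<close>, eliminate \<open>F\<^sub>n\<^sub>n\<close> between the relations for \<open>y\<^sub>m\<^sub>-\<^sub>2\<close> and \<open>z\<^sub>n\<^sub>-\<^sub>2\<close> and differentiate the
  result in \<open>z\<^sub>n\<close>, which gives \<open>2 \<partial>\<xi>/\<partial>z\<^sub>n = 0\<close>. If \<open>m = 1\<close>, then \<open>n \<ge> 3\<close>, and the relation for \<open>z\<^sub>n\<^sub>-\<^sub>3\<close>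
  differentiated along \<open>D\<close> contradicts the one for \<open>z\<^sub>n\<^sub>-\<^sub>2\<close> unless \<open>\<partial>\<xi>/\<partial>z\<^sub>n = 0\<close>.\<close>

lemma characteristic_preserved:
  assumes u: "u \<in> S" shows "dd en \<xi> u = 0"
proof (cases "m = 1")
  case True
  with n_ge have n: "3 \<le> n" by simp
  define j where "j = n - 3"
  have j: "Suc (Suc (Suc j)) = n" using n by (simp add: j_def)
  \<comment> \<open>The index \<open>Suc j\<close> is \<open>n - 2\<close>, where \<open>Z\<close>
    has no component, so the term with \<open>dd en \<xi>\<close> drops out.\<close>
  have e1: "dd e' (\<zeta> j) u = jz (Suc j) u * dd e' \<xi> u" if "u \<in> S" for u
  proof -
    have "Suc j \<noteq> n - 1" using j by simp
    then show ?thesis using relations_z(2)[OF that, of j] j F_nn[OF that] by (simp add: zvec_def card)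
  qed
  \<comment> \<open>With \<open>m = 1\<close> the only \<open>y\<close> coordinate is
    \<open>y_0\<close>, and it enters \<open>D\<close> through \<open>F\<close> alone.\<close>
  have e2: "dd e' dvec u = dd e' F u *\<^sub>R e'" if "u \<in> S" for u
  proof -
    have "u \<in> U" using that S by auto
    then show ?thesis unfolding dd_dvec[OF \<open>u \<in> U\<close>] dd_yn
      by (intro jet_eqI) (auto simp: card True)
  qed
  have "dd e' (\<lambda>u. dd (dvec u) (\<zeta> j) u) u = dd e' (\<lambda>u. \<zeta> (Suc j) u + jz (Suc j) u * dd (dvec u) \<xi> u) u"
    using vz[OF _ disjI1[OF refl], of _ j] j by (intro dd_cong_open[OF S(1) u]) (simp add:
        dd_components)
  also have "\<dots> = dd e' (\<zeta> (Suc j)) u + jz (Suc j) u * dd e' (\<lambda>u. dd (dvec u) \<xi> u) u"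
    using Cinf_on_differentiable[OF smooth_components(3) u] Cinf_on_differentiable[OF Cinf_on_jet_sel(3)
        u]
      Cinf_on_differentiable[OF Cinf_on_dd_field[OF S(1) smooth_components(1) Cinf_on_dvec[OF S]] u] j
    by (simp add: dd_add dd_mult dd_jet_sel card)
  finally have L: "dd (dvec u) (dd e' (\<zeta> j)) u + dd e' F u * dd e' (\<zeta> j) u
      = dd e' (\<zeta> (Suc j)) u + jz (Suc j) u * (dd (dvec u) (dd e' \<xi>) u + dd e' F u * dd e' \<xi> u)"
    using Cinf_on_differentiable[OF smooth_components(3) u] Cinf_on_differentiable[OF
        smooth_components(1) u]
    by (simp add: dd_commute_field[OF S(1) smooth_components(3) Cinf_on_dvec[OF S] u]
       dd_commute_field[OF S(1) smooth_components(1) Cinf_on_dvec[OF S] u] e2[OF u, simplified]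
           dd_scaleR_dir)
  have "dd (dvec u) (dd e' (\<zeta> j)) u = dd (dvec u) (\<lambda>u. jz (Suc j) u * dd e' \<xi> u) u"
    by (rule dd_cong_open[OF S(1) u e1])
  also have "\<dots> = jz (Suc (Suc j)) u * dd e' \<xi> u + jz (Suc j) u * dd (dvec u) (dd e' \<xi>) u"
    using Cinf_on_differentiable[OF Cinf_on_jet_sel(3) u] Cinf_on_differentiable[OF
        Cinf_on_dd[OF S(1) smooth_components(1)] u] j
    by (simp add: dd_mult dd_jet_sel)
  finally have "dd e' (\<zeta> (Suc j)) u = jz (Suc (Suc j)) u * dd e' \<xi> u"
    using L unfolding e1[OF u] by (simp add: algebra_simps)
  \<comment> \<open>One index higher the coordinate is \<open>z_(n-1)\<close>, along which
    \<open>Z\<close> has component 1; here the term with \<open>dd en \<xi>\<close>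
    survives.\<close>
  moreover have "dd en (dd en F) u * dd e' (\<zeta> (Suc j)) u = jz (Suc (Suc j)) u * (dd en (dd en F) u * dd
      e' \<xi> u) - dd en \<xi> u"
    using relations_z(2)[OF u, of "Suc j"] j n by (simp add: zvec_def card)
  ultimately show ?thesis by simp
next
  case False
  define i j where "i = m - 2" and "j = n - 2"
  have ij: "Suc (Suc i) = m" "Suc (Suc j) = n" using False n_ge mn by (auto simp: i_def j_def)
  let ?f = "dd en (dd en F)"
  have ry: "?f u * dd e' (\<eta> i) u = jy (Suc i) u * (?f u * dd e' \<xi> u) - dd en \<xi> u * dd en F u"
    and rz: "?f u * dd e' (\<zeta> j) u = jz (Suc j) u * (?f u * dd e' \<xi> u) - dd en \<xi> u" if "u \<in> S" for u
    using relations_y(2)[OF that, of i] relations_z(2)[OF that, of j] ij by (auto simp: zvec_def card)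
  have e: "dd e' (\<eta> i) u - dd en F u * dd e' (\<zeta> j) u = (jy (Suc i) u - dd en F u * jz (Suc j) u) * dd e'
      \<xi> u" if "u \<in> S" for u
  proof -
    have "?f u * (dd e' (\<eta> i) u - dd en F u * dd e' (\<zeta> j) u)
        = ?f u * ((jy (Suc i) u - dd en F u * jz (Suc j) u) * dd e' \<xi> u)"
      using ry[OF that] rz[OF that] by algebra
    then show ?thesis using F_nn[OF that] by simp
  qed
  have F': "Cinf_on S (dd en F)" using Cinf_on_dd[OF U F] Ck_on_subset[OF _ S(2)] by blast
  note D = Cinf_on_differentiable[OF _ u]
  note dif = D[OF F'] D[OF Cinf_on_jet_sel(2)] D[OF Cinf_on_jet_sel(3)] D[OF
      Cinf_on_dd[OF S(1) smooth_components(1)]]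
     D[OF Cinf_on_dd[OF S(1) smooth_components(2)]] D[OF Cinf_on_dd[OF S(1) smooth_components(3)]]
  have swap: "dd en (dd e' g) u = dd e' (dd en g) u" if "Cinf_on S g" for g :: "('r, 'q) jet \<Rightarrow> real"
    by (rule dd_commute[OF S(1) that u])
  \<comment> \<open>The first summand appears because the coefficient \<open>y_(m-1)\<close> is the
    very coordinate that \<open>e'\<close> differentiates. It has no counterpart in
    \<open>g2\<close>, and this asymmetry decides the case.\<close>
  have g1: "dd e' (dd en (\<eta> i)) u = dd en \<xi> u + jy (Suc i) u * dd e' (dd en \<xi>) u"
  proof -
    have "dd e' (dd en (\<eta> i)) u = dd e' (\<lambda>u. jy (Suc i) u * dd en \<xi> u) u"
      using vy[OF _ disjI2[OF refl], of _ i] ij by (intro dd_cong_open[OF S(1) u]) (auto simp: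
          dd_components yn_def)
    also have "\<dots> = dd en \<xi> u + jy (Suc i) u * dd e' (dd en \<xi>) u"
      using dif ij(1) by (simp add: dd_mult dd_jet_sel card)
    finally show ?thesis .
  qed
  have g2: "dd e' (dd en (\<zeta> j)) u = jz (Suc j) u * dd e' (dd en \<xi>) u"
  proof -
    have "dd e' (dd en (\<zeta> j)) u = dd e' (\<lambda>u. jz (Suc j) u * dd en \<xi> u) u"
      using vz[OF _ disjI2[OF refl], of _ j] ij by (intro dd_cong_open[OF S(1) u]) (auto simp:
          dd_components)
    also have "\<dots> = jz (Suc j) u * dd e' (dd en \<xi>) u"
      using dif ij by (simp add: dd_mult dd_jet_sel card)
    finally show ?thesis .
  qed
  have "dd en (\<lambda>u. dd e' (\<eta> i) u - dd en F u * dd e' (\<zeta> j) u) u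
      = dd en (\<lambda>u. (jy (Suc i) u - dd en F u * jz (Suc j) u) * dd e' \<xi> u) u"
    by (rule dd_cong_open[OF S(1) u e])
  then have "dd e' (dd en (\<eta> i)) u - (?f u * dd e' (\<zeta> j) u + dd en F u * dd e' (dd en (\<zeta> j)) u)
    = - (?f u * jz (Suc j) u) * dd e' \<xi> u + (jy (Suc i) u - dd en F u * jz (Suc j) u) * dd e' (dd en \<xi>)
        u"
    unfolding swap[OF smooth_components(1), symmetric] swap[OF smooth_components(2), symmetric] swap[OF
        smooth_components(3), symmetric]
    using dif ij by (simp add: dd_diff dd_mult dd_jet_sel card)
  \<comment> \<open>What remains is \<open>dd en \<xi> u = ?f u * (dd e' (\<zeta> j) u - jz (Suc j)
    u * dd e' \<xi> u)\<close>, and by \<open>rz\<close> the right-hand side is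
    \<open>- dd en \<xi> u\<close>.\<close>
  then show ?thesis using rz[OF u] unfolding g1 g2 by (simp add: algebra_simps)
qed

text \<open>With \<open>\<partial>_n \<xi> = 0\<close> the fourth-order relation becomes a contact
  condition along \<open>\<partial>'\<close>. Together with \<open>vertical_z\<close> this is the
  part of the invariance of the rank 4 distribution that is needed off the equation.\<close>

lemma vertical_y: "u \<in> S \<Longrightarrow> Suc i < m \<Longrightarrow> dd e' (\<eta> i) u = jy (Suc i) u * dd e' \<xi> u"
  using relations_y(2)[of u i] F_nn[of u] by (simp add: characteristic_preserved)

lemma vertical_z: "u \<in> S \<Longrightarrow> Suc j < n \<Longrightarrow> dd e' (\<zeta> j) u = jz (Suc j) u * dd e' \<xi> u"
  using relations_z(2)[of u j] F_nn[of u] by (simp add: characteristic_preserved)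

end

section \<open>The equation and its distribution\<close>

text \<open>The values of the contact forms on \<open>v\<close>, placed in the directions of
  \<open>y_i\<close> for \<open>i < m\<close> and of \<open>z_j\<close> for \<open>j < n\<close>.
  The Cartan spaces thus become kernels of projections onto one fixed complement, as
  \<open>flow_preserves_kernel\<close> requires.\<close>

definition contact_projection :: "nat \<Rightarrow> nat \<Rightarrow> ('p::finite, 'q::finite) jet \<Rightarrow> ('p, 'q) jet \<Rightarrow> ('p, 'q)
    jet" where
  "contact_projection m n w v =
     jet_of 0 (\<lambda>i. if i < m then jy i v - jy (Suc i) w * jx v else 0)
       (\<lambda>j. if j < n then jz j v - jz (Suc j) w * jx v else 0)"

lemma contact_projection_sel:
  fixes v w :: "('p::finite, 'q::finite) jet"
  shows "jx (contact_projection m n w v) = 0"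
    "i < CARD('p) \<Longrightarrow> jy i (contact_projection m n w v) = (if i < m then jy i v - jy (Suc i) w * jx v else
        0)"
    "j < CARD('q) \<Longrightarrow> jz j (contact_projection m n w v) = (if j < n then jz j v - jz (Suc j) w * jx v else
        0)"
  by (simp_all add: contact_projection_def)

lemma linear_contact_projection: "linear (contact_projection m n w)"
  unfolding linear_conv_bounded_linear
  by (rule bounded_linear_jet_map; rule linearI) (simp_all add: contact_projection_sel algebra_simps)

lemma contact_projection_idem:
  fixes v :: "('p::finite, 'q::finite) jet"
  assumes "m < CARD('p)" "n < CARD('q)"
  shows "contact_projection m n w (contact_projection m n w' v) = contact_projection m n w' v"
  using assms by (intro jet_eqI) (auto simp: contact_projection_sel)

lemma cartan_eq_kernel:
  assumes "m < CARD('p)" "n < CARD('q)"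
  shows "cartan m n (w :: ('p::finite, 'q::finite) jet) = {v. contact_projection m n w v = 0}"
proof (intro set_eqI iffI)
  fix v assume "v \<in> cartan m n w"
  then have "contact_projection m n w v = 0"
    by (intro jet_eqI) (auto simp: contact_projection_sel cartan_def)
  then show "v \<in> {v. contact_projection m n w v = 0}" by simp
next
  fix v assume "v \<in> {v. contact_projection m n w v = 0}"
  then have *: "contact_projection m n w v = 0" by simp
  have "jy i v - jy (Suc i) w * jx v = 0" if "i < m" for i
    using arg_cong[OF *, of "jy i"] that assms by (simp add: contact_projection_sel)
  moreover have "jz j v - jz (Suc j) w * jx v = 0" if "j < n" for j
    using arg_cong[OF *, of "jz j"] that assms by (simp add: contact_projection_sel)
  ultimately show "v \<in> cartan m n w" by (simp add: cartan_def)
qed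

lemma Cinf_on_contact_projection:
  assumes "open W" shows "Cinf_on W (\<lambda>w. contact_projection m n w v)"
proof (rule Cinf_on_jet[OF assms])
  note smooth = Ck_on_const Ck_on_diff Ck_on_mult bounded_linear_jet_sel[THEN Ck_on_linear]
  show "Cinf_on W (\<lambda>w. jx (contact_projection m n w v))"
    by (simp add: contact_projection_sel smooth)
  show "Cinf_on W (\<lambda>w. jy i (contact_projection m n w v))" if "i < CARD('a)" for i
    using that by (cases "i < m") (simp_all add: contact_projection_sel smooth)
  show "Cinf_on W (\<lambda>w. jz j (contact_projection m n w v))" if "j < CARD('b)" for j
    using that by (cases "j < n") (simp_all add: contact_projection_sel smooth)
qed

lemma dd_contact_projection:
  fixes v w :: "('p::finite, 'q::finite) jet"
  shows "dd a (\<lambda>w. contact_projection m n w v) w =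
    jet_of 0 (\<lambda>i. if i < m then - (jy (Suc i) a * jx v) else 0) (\<lambda>j. if j < n then -
        (jz (Suc j) a * jx v) else 0)"
    (is "_ = ?R")
proof (rule jet_eqI)
  have d: "(\<lambda>w. contact_projection m n w v) differentiable at w"
    using Cinf_on_differentiable[OF Cinf_on_contact_projection[OF open_UNIV]] by simp
  note C = dd_linear_comp[OF _ d, symmetric]
  have J: "((\<lambda>w. c - l w * r) has_derivative (\<lambda>a. - (l a * r))) (at w)" if "bounded_linear l"
    for l :: "('p, 'q) jet \<Rightarrow> real" and c r
    by (auto intro!: derivative_eq_intros bounded_linear_imp_has_derivative[OF that])
  note J = has_derivative_dd[OF J]
  show "jx (dd a (\<lambda>w. contact_projection m n w v) w) = jx ?R"
    by (simp add: C bounded_linear_jet_sel contact_projection_sel dd_const)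
  show "jy i (dd a (\<lambda>w. contact_projection m n w v) w) = jy i ?R" if "i < CARD('p)" for i
    using that by (cases "i < m") (simp_all add: C bounded_linear_jet_sel contact_projection_sel
        dd_const J)
  show "jz j (dd a (\<lambda>w. contact_projection m n w v) w) = jz j ?R" if "j < CARD('q)" for j
    using that by (cases "j < n") (simp_all add: C bounded_linear_jet_sel contact_projection_sel
        dd_const J)
qed

text \<open>The image of a basis spans a space of the same dimension, hence is independent. As
  \<open>preserves_at\<close> speaks of images only, injectivity of a differential on a Cartan space
  is obtained by this count.\<close>

lemma inj_on_subspace_of_dim_image:
  fixes A :: "'a::euclidean_space \<Rightarrow> 'b::euclidean_space"
  assumes "linear A" "subspace S" "dim (A ` S) = dim S"
  shows "inj_on A S"
proof -
  obtain B where B: "B \<subseteq> S" "independent B" "S \<subseteq> span B" "card B = dim S" using basis_exists by blast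
  have S: "S = span B" using B assms(2) by (metis span_mono span_eq_iff subset_antisym)
  have fin: "finite B" using B(2) by (rule independent_imp_finite)
  have "dim (A ` S) \<le> card (A ` B)"
    unfolding S linear_span_image[OF assms(1), symmetric] dim_span
        by (rule dim_le_card') (use fin in simp)
  then have card: "card (A ` B) = card B"
    using assms(3) B(4) card_image_le[OF fin, of A] by linarith
  then have inj: "inj_on A B" by (rule eq_card_imp_inj_on[OF fin])
  have "independent (A ` B)"
  proof (rule card_eq_dim[THEN iffD2])
    show "A ` B \<subseteq> A ` S" using B by blast
    show "card (A ` B) = dim (A ` S)" using card B assms by simp
    show "finite (A ` B)" using fin by simp
    show "A ` S \<subseteq> span (A ` B)" unfolding S by (simp add: linear_span_image[OF assms(1)])
  qed
  then show ?thesis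
    unfolding S by (intro linear_inj_on_span_independent_image assms inj)
qed

section \<open>The equation as a graph and its rank 2 distribution\<close>

context monge_equation
begin

lemma card_less: "m < CARD('p)" "n < CARD('q)"
  by (simp_all add: card)

lemma drop_lift [simp]: "drop_y (lift u) = u"
  by (rule jet_eqI) (auto simp: card)

lemma lift_drop: "w \<in> monge m U F \<Longrightarrow> lift (drop_y w) = w"
  by (rule jet_eqI) (auto simp: card less_Suc_eq monge_def)

lemma diff_lift_drop: "w - lift (drop_y w) = (jy m w - F (drop_y w)) *\<^sub>R ey m"
  by (rule jet_eqI) (auto simp: card less_Suc_eq)

lemma lift_in_monge: "u \<in> U \<Longrightarrow> lift u \<in> monge m U F"
  by (simp add: monge_def)

lemma F_differentiable: "u \<in> U \<Longrightarrow> F differentiable at u"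
  by (rule Cinf_on_differentiable[OF F])

lemma dd_lift:
  assumes "u \<in> U"
  shows "dd a lift u = jet_of (jx a) (\<lambda>i. if i < m then jy i a else dd a F u) (\<lambda>j. jz j a)" (is "_
      = ?R")
proof (rule jet_eqI)
  have d: "lift differentiable at u" using Cinf_on_differentiable[OF Cinf_on_lift assms] U by simp
  note C = dd_linear_comp[OF _ d, symmetric]
  show "jx (dd a lift u) = jx ?R" by (simp add: C bounded_linear_jet_sel dd_jet_sel)
  show "jy i (dd a lift u) = jy i ?R" if "i < CARD('p)" for i
    using that by (cases "i < m") (simp_all add: C bounded_linear_jet_sel dd_jet_sel lift_def card)
  show "jz j (dd a lift u) = jz j ?R" if "j < CARD('q)" for j
    using that by (simp add: C bounded_linear_jet_sel dd_jet_sel card)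
qed

lemma monge_tangent_iff:
  assumes "w \<in> monge m U F"
  shows "v \<in> monge_tangent m F w \<longleftrightarrow> v = dd (drop_y v) lift (drop_y w)"
proof -
  have u: "drop_y w \<in> U" using assms by (simp add: monge_def)
  have "v = dd (drop_y v) lift (drop_y w)" if "jy m v = dd (drop_y v) F (drop_y w)"
    by (rule jet_eqI) (use that in \<open>auto simp: dd_lift[OF u] card less_Suc_eq\<close>)
  moreover have "jy m v = dd (drop_y v) F (drop_y w)" if "v = dd (drop_y v) lift (drop_y w)"
    using arg_cong[OF that, of "jy m"] by (simp add: dd_lift[OF u] card)
  ultimately show ?thesis by (auto simp: monge_tangent_def dd_def)
qed

lemma drop_dd_lift: "u \<in> U \<Longrightarrow> drop_y (dd a lift u) = a"
  by (rule jet_eqI) (auto simp: dd_lift card)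

lemma dd_lift_in_distribution:
  assumes u: "u \<in> U" and a: "a = s *\<^sub>R dvec u + t *\<^sub>R en"
  shows "dd a lift u \<in> monge_distribution m n F (lift u)"
proof -
  have "dd a lift u \<in> monge_tangent m F (lift u)"
    using u by (simp add: monge_tangent_iff lift_in_monge drop_dd_lift)
  moreover have "dd a lift u \<in> cartan m n (lift u)"
    using mn by (auto simp: cartan_def dd_lift[OF u] a card)
  ultimately show ?thesis by (simp add: monge_distribution_def)
qed

text \<open>The contact conditions leave only the \<open>x\<close>, \<open>y_m\<close> and
  \<open>z_n\<close> components free, and tangency fixes that of \<open>y_m\<close>. So
  \<open>jx\<close> and \<open>jz n\<close> are coordinates on each space of the distribution, which
  is the image of the span of \<open>D\<close> and \<open>\<partial>_n\<close> under the
  differential of \<open>lift\<close>.\<close>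

lemma distribution_eqI:
  assumes w: "w \<in> monge m U F" and v: "v \<in> monge_distribution m n F w"
  shows "v = dd (jx v *\<^sub>R dvec (drop_y w) + jz n v *\<^sub>R en) lift (drop_y w)"
proof -
  have c: "jy i v = jy (Suc i) w * jx v" if "i < m" for i
    using v that by (simp add: monge_distribution_def cartan_def)
  have c': "jz j v = jz (Suc j) w * jx v" if "j < n" for j
    using v that by (simp add: monge_distribution_def cartan_def)
  have yn: "yn i (drop_y w) = jy (Suc i) w" if "i < m" for i
    using w that by (cases "Suc i = m") (auto simp: yn_def monge_def card)
  have "drop_y v = jx v *\<^sub>R dvec (drop_y w) + jz n v *\<^sub>R en"
    by (rule jet_eqI) (auto simp: c c' yn card less_Suc_eq)
  moreover have "v = dd (drop_y v) lift (drop_y w)"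
    using v w by (simp add: monge_tangent_iff[symmetric] monge_distribution_def)
  ultimately show ?thesis by simp
qed

lemma subspace_monge_tangent: "w \<in> monge m U F \<Longrightarrow> subspace (monge_tangent m F w)"
proof -
  assume "w \<in> monge m U F"
  then have "linear (\<lambda>v. jy m v - dd (drop_y v :: ('r, 'q) jet) F (drop_y w))"
    using linear_compose[of drop_y "\<lambda>a. dd a F (drop_y w)"] linear_drop_y linear_dd[OF F_differentiable]
    by (intro linear_compose_sub linear_jet_sel) (auto simp: o_def linear_conv_bounded_linear monge_def)
  from linear_subspace_kernel[OF this] show ?thesis
    by (simp add: monge_tangent_def dd_def)
qed

lemma subspace_cartan: "subspace (cartan m n (w :: ('p, 'q) jet))"
  unfolding cartan_eq_kernel[OF card_less]
      by (rule linear_subspace_kernel[OF linear_contact_projection])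

lemma subspace_monge_distribution: "w \<in> monge m U F \<Longrightarrow> subspace (monge_distribution m n F (w :: ('p, 'q)
    jet))"
  unfolding monge_distribution_def by (intro subspace_inter subspace_cartan subspace_monge_tangent)

lemma dim_cartan: "dim (cartan m n (w :: ('p, 'q) jet)) = dim (cartan m n (w' :: ('p, 'q) jet))"
  unfolding cartan_eq_kernel[OF card_less]
  by (intro antisym dim_kernel_le linear_contact_projection contact_projection_idem card_less)

lemma dim_monge_distribution_le:
  fixes w w' :: "('p, 'q) jet"
  assumes w: "w \<in> monge m U F" and w': "w' \<in> monge m U F"
  shows "dim (monge_distribution m n F w') \<le> dim (monge_distribution m n F w)"
proof -
  define u :: "('r, 'q) jet" where "u = drop_y w"
  have u: "u \<in> U" "lift u = w" using w lift_drop by (auto simp: u_def monge_def)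
  have dl: "lift differentiable at u" using Cinf_on_differentiable[OF Cinf_on_lift u(1)] U by simp
  \<comment> \<open>Transports vectors of the distribution from \<open>w'\<close> to
    \<open>w\<close> by keeping the coordinates \<open>jx\<close> and \<open>jz n\<close>.\<close>
  define T where "T v = dd (jx v *\<^sub>R dvec u + jz n v *\<^sub>R en) lift u" for v :: "('p, 'q) jet"
  have lin: "linear T"
    unfolding T_def
    by (rule linearI) (simp_all add: dd_add_dir[OF dl] dd_scaleR_dir[OF dl] algebra_simps)
  have "inj_on T (monge_distribution m n F w')"
  proof (rule inj_onI)
    fix x y assume xy: "x \<in> monge_distribution m n F w'" "y \<in> monge_distribution m n F w'" "T x = T y"
    have "(drop_y (T x) :: ('r, 'q) jet) = drop_y (T y)" using xy by simp
    then have eq: "jx x *\<^sub>R dvec u + jz n x *\<^sub>R en = jx y *\<^sub>R dvec u + jz n y *\<^sub>R en"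
      by (simp add: T_def drop_dd_lift u)
    have "jx x = jx y" "jz n x = jz n y"
      using arg_cong[OF eq, of jx] arg_cong[OF eq, of "jz n"] by (simp_all add: card)
    then show "x = y" using distribution_eqI[OF w' xy(1)] distribution_eqI[OF w' xy(2)] by simp
  qed
  then have "dim (monge_distribution m n F w') = dim (T ` monge_distribution m n F w')"
    by (rule dim_image_subspace[OF lin subspace_monge_distribution[OF w'], symmetric])
  also have "\<dots> \<le> dim (monge_distribution m n F w)"
    by (rule dim_subset) (use dd_lift_in_distribution[OF u(1) refl] u(2) in \<open>auto simp: T_def\<close>)
  finally show ?thesis .
qed

text \<open>The flow keeps \<open>A t v\<close> in the Cartan space at \<open>\<phi> t w\<close>.
  Differentiating these contact identities at \<open>t = 0\<close> by the product rule, with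
  \<open>flow_first_variation\<close> for \<open>A t v\<close>, gives the infinitesimal conditions.
  The local extension \<open>g\<close> of \<open>V\<close> makes the derivatives available in the
  ambient space.\<close>

lemma internal_symmetry_contact:
  fixes V g :: "('p, 'q) jet \<Rightarrow> ('p, 'q) jet"
  assumes W: "open W" and flow: "flow_preserves (monge m U F \<inter> W) (monge_distribution m n F) V"
    and W0: "open W0" "W0 \<subseteq> W" "Cinf_on W0 g" "\<And>w. w \<in> monge m U F \<inter> W0 \<Longrightarrow> g w = V w"
    and u: "u \<in> U" "lift u \<in> W0" and a: "a = dvec u \<or> a = en"
  shows "i < m \<Longrightarrow> jy i (dd a (\<lambda>u. g (lift u)) u) = jy (Suc i) (g (lift u)) * jx a + yn i u * jx
      (dd a (\<lambda>u. g (lift u)) u)"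
    and "j < n \<Longrightarrow> jz j (dd a (\<lambda>u. g (lift u)) u) = jz (Suc j) (g (lift u)) * jx a + jz (Suc j) u * jx
        (dd a (\<lambda>u. g (lift u)) u)"
proof -
  let ?M = "monge m U F \<inter> W" and ?D = "monge_distribution m n F"
  define w where "w = lift u"
  define v where "v = dd a lift u"
  have dl: "lift differentiable at u" using Cinf_on_differentiable[OF Cinf_on_lift u(1)] U by simp
  have dg: "g differentiable at w" using Cinf_on_differentiable[OF W0(3) u(2)] by (simp add: w_def)
  have chain: "dd a (\<lambda>u. g (lift u)) u = dd v g w"
    unfolding v_def w_def by (rule dd_chain[OF dl]) (use dg in \<open>simp add: w_def\<close>)
  have wM: "w \<in> ?M" using lift_in_monge[OF u(1)] u(2) W0(2) by (auto simp: w_def)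
  have a': "\<exists>s t. a = s *\<^sub>R dvec u + t *\<^sub>R en"
    using a by (metis add.left_neutral add.right_neutral scaleR_one scaleR_zero_left)
  then have vD: "v \<in> ?D w" unfolding v_def w_def using dd_lift_in_distribution[OF u(1)] by blast
  obtain \<epsilon> N \<phi> where N: "w \<in> N" and lf: "local_flow ?M V \<epsilon> N \<phi>"
    and pres: "\<And>t x. \<bar>t\<bar> < \<epsilon> \<Longrightarrow> x \<in> N \<Longrightarrow> preserves_at ?M ?D (\<phi> t) x"
    using flow wM unfolding flow_preserves_def by metis
  have "\<forall>t. \<exists>A. \<bar>t\<bar> < \<epsilon> \<longrightarrow> (\<phi> t has_derivative A) (at w within ?M) \<and> A ` ?D w = ?D (\<phi> t w)"
    using pres[OF _ N] unfolding preserves_at_def by blast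
  then obtain A where A: "\<And>t. \<bar>t\<bar> < \<epsilon> \<Longrightarrow> (\<phi> t has_derivative A t) (at w within ?M)"
    "\<And>t. \<bar>t\<bar> < \<epsilon> \<Longrightarrow> A t ` ?D w = ?D (\<phi> t w)" by metis
  have \<epsilon>: "0 < \<epsilon>" and \<phi>w: "\<phi> 0 w = w"
    and flow': "\<And>t. \<bar>t\<bar> < \<epsilon> \<Longrightarrow> ((\<lambda>s. \<phi> s w) has_vector_derivative V (\<phi> t w)) (at t)"
    using lf N unfolding local_flow_def by auto
  have \<phi>': "((\<lambda>s. \<phi> s w) has_vector_derivative V (\<phi> 0 w)) (at 0)" by (rule flow') (use \<epsilon> in simp)
  \<comment> \<open>A curve inside the equation with velocity \<open>v\<close>, since
    \<open>A t\<close> is a derivative of \<open>\<phi> t\<close> only within the equation.\<close>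
  define c where "c s = lift (u + s *\<^sub>R a)" for s
  have line: "((\<lambda>s. u + s *\<^sub>R a) has_derivative (\<lambda>h. h *\<^sub>R a)) (at (0::real))"
    by (auto intro!: derivative_eq_intros)
  have c': "(c has_vector_derivative v) (at 0)"
  proof -
    have "(lift has_derivative (\<lambda>a. dd a lift u)) (at (u + 0 *\<^sub>R a))" using has_derivative_ddI[OF dl]
        by simp
    from has_derivative_compose[OF line this] show ?thesis
      unfolding c_def has_vector_derivative_def v_def by (simp add: dd_scaleR_dir[OF dl])
  qed
  have c0: "c 0 = w" by (simp add: c_def w_def)
  obtain \<eta> where \<eta>: "0 < \<eta>" "\<And>s. \<bar>s\<bar> < \<eta> \<Longrightarrow> c s \<in> ?M"
  proof -
    have "eventually (\<lambda>s. u + s *\<^sub>R a \<in> U) (at (0::real))"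
      using has_derivative_continuous[OF line] U u(1) unfolding continuous_within
      by (intro topological_tendstoD) auto
    moreover have "eventually (\<lambda>s. c s \<in> W) (at 0)"
      using has_vector_derivative_continuous[OF c'] W wM c0 unfolding continuous_within
      by (intro topological_tendstoD) auto
    ultimately have "eventually (\<lambda>s. c s \<in> ?M) (at 0)"
      by eventually_elim (auto simp: c_def lift_in_monge)
    then obtain \<eta> where "0 < \<eta>" "\<And>s. s \<noteq> 0 \<Longrightarrow> \<bar>s\<bar> < \<eta> \<Longrightarrow> c s \<in> ?M"
        by (auto simp: eventually_at dist_real_def)
    moreover have "c 0 \<in> ?M" using wM c0 by simp
    ultimately show thesis by (metis that)
  qed
  have gV: "g x = V x" if "x \<in> ?M \<inter> W0" for x using W0(4) that by auto
  note var = flow_first_variation[OF lf N W0(1) _ W0(3) gV \<eta>(1) \<eta>(2) c0 c' A(1)]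
  have wW0: "w \<in> W0" using u by (simp add: w_def)
  have Av: "((\<lambda>t. A t v) has_vector_derivative dd v g w) (at 0)" and A0: "A 0 v = v"
    using var[OF wW0] by auto
  have gw: "V (\<phi> 0 w) = g w" using wM wW0 \<phi>w W0(4) by auto
  \<comment> \<open>To be used with consecutive coordinates: \<open>l\<close> is \<open>y_i\<close>
    or \<open>z_j\<close>, and \<open>k\<close> is the one of the next order.\<close>
  have key: "l (dd v g w) = k (g w) * jx v + k w * jx (dd v g w)"
    if l: "bounded_linear l" and k: "bounded_linear k"
      and eq: "\<And>t. \<bar>t\<bar> < \<epsilon> \<Longrightarrow> l (A t v) = k (\<phi> t w) * jx (A t v)" for l k :: "('p, 'q) jet \<Rightarrow> real"
  proof -
    have "((\<lambda>t. k (\<phi> t w) * jx (A t v)) has_vector_derivative k (\<phi> 0 w) * jx (dd v g w) + k (V (\<phi> 0 w))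
        * jx (A 0 v)) (at 0)"
      by (intro has_vector_derivative_mult bounded_linear.has_vector_derivative[OF k]
          bounded_linear.has_vector_derivative[OF bounded_linear_jet_sel(1)] Av \<phi>')
    then have "((\<lambda>t. l (A t v)) has_vector_derivative k (\<phi> 0 w) * jx (dd v g w) + k (V (\<phi> 0 w)) * jx (A
        0 v)) (at 0)"
      by (rule has_vector_derivative_transform_within_open[where S="{-\<epsilon><..<\<epsilon>}"])
        (use \<epsilon> eq in \<open>auto simp: abs_less_iff minus_less_iff\<close>)
    from vector_derivative_unique_at[OF this bounded_linear.has_vector_derivative[OF l Av]]
    show ?thesis using gw by (simp add: \<phi>w A0)
  qed
  have inD: "A t v \<in> cartan m n (\<phi> t w)" if "\<bar>t\<bar> < \<epsilon>" for t
    using A(2)[OF that] vD by (auto simp: monge_distribution_def)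
  have jxv: "jx v = jx a" by (simp add: v_def dd_lift[OF u(1)])
  show "jy i (dd a (\<lambda>u. g (lift u)) u) = jy (Suc i) (g (lift u)) * jx a + yn i u * jx (dd a (\<lambda>u. g (lift
      u)) u)" if "i < m"
    using key[of "jy i" "jy (Suc i)"] inD that jxv by (simp add: chain bounded_linear_jet_sel cartan_def
        w_def)
  show "jz j (dd a (\<lambda>u. g (lift u)) u) = jz (Suc j) (g (lift u)) * jx a + jz (Suc j) u * jx (dd a (\<lambda>u. g
      (lift u)) u)" if "j < n"
    using key[of "jz j" "jz (Suc j)"] inD that jxv by (simp add: chain bounded_linear_jet_sel cartan_def
        w_def)
qed

end

section \<open>Extending internal symmetries\<close>

context internal_field
begin

definition jet_domain :: "('p, 'q) jet set" where "jet_domain = {w. drop_y w \<in> S}"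

definition pullback :: "('p, 'q) jet \<Rightarrow> ('p, 'q) jet" where "pullback w = v (drop_y w)"

text \<open>Setting the \<open>y_m\<close> and \<open>z_n\<close> components to 0 does not affect
  the corrections below: \<open>pullback\<close> is independent of \<open>y_m\<close>, and its
  components along \<open>x\<close>, \<open>y_i\<close> with \<open>i < m\<close> and
  \<open>z_j\<close> with \<open>j < n\<close> do not depend on \<open>z_n\<close>.\<close>

definition total_derivative :: "('p, 'q) jet \<Rightarrow> ('p, 'q) jet" where
  "total_derivative w = jet_of 1 (\<lambda>i. if i < m then jy (Suc i) w else 0) (\<lambda>j. if j < n then jz (Suc j) w
      else 0)"

text \<open>Both corrections vanish on the equation.\<close>

definition correction_y :: "('p, 'q) jet \<Rightarrow> real" where
  "correction_y w = jy (m - 1) (dd (total_derivative w) pullback w)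
     - jy m w * jx (dd (total_derivative w) pullback w) - jy m (pullback w)"

definition correction_z :: "('p, 'q) jet \<Rightarrow> real" where
  "correction_z w = jz (n - 1) (dd (total_derivative w) pullback w)
     - jz n w * jx (dd (total_derivative w) pullback w) - jz n (pullback w)"

definition prolongation :: "('p, 'q) jet \<Rightarrow> ('p, 'q) jet" where
  "prolongation w = pullback w + correction_y w *\<^sub>R ey m + correction_z w *\<^sub>R ez n"

lemma open_jet_domain: "open jet_domain"
  unfolding jet_domain_def using open_vimage[OF S(1) linear_continuous_on[OF linear_drop_y]]
      by (simp add: vimage_def)

lemma Cinf_on_pullback: "Cinf_on jet_domain pullback"
  unfolding pullback_def[abs_def]
  by (intro allI, rule Ck_on_compose[where f=drop_y and g=v and T=S, OF _ Ck_on_linear[OF linear_drop_y]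
      spec[OF v]])
    (auto simp: jet_domain_def)

lemma Cinf_on_total_derivative: "Cinf_on jet_domain total_derivative"
proof (rule Cinf_on_jet[OF open_jet_domain])
  note smooth = Ck_on_const bounded_linear_jet_sel[THEN Ck_on_linear]
  show "Cinf_on jet_domain (\<lambda>w. jx (total_derivative w))" by (simp add: total_derivative_def smooth)
  show "Cinf_on jet_domain (\<lambda>w. jy i (total_derivative w))" if "i < CARD('p)" for i
    using that by (cases "i < m") (simp_all add: total_derivative_def smooth)
  show "Cinf_on jet_domain (\<lambda>w. jz j (total_derivative w))" if "j < CARD('q)" for j
    using that by (cases "j < n") (simp_all add: total_derivative_def smooth)
qed

lemma Cinf_on_prolongation: "Cinf_on jet_domain prolongation"
proof
  fix k
  have 1: "Ck_on k jet_domain (\<lambda>w. l (dd (total_derivative w) pullback w))" "Ck_on k jet_domain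
      (\<lambda>w. l (pullback w))"
    "Ck_on k jet_domain l"
    if "bounded_linear l" for l :: "('p, 'q) jet \<Rightarrow> real"
    using Cinf_on_dd_field[OF open_jet_domain Cinf_on_pullback Cinf_on_total_derivative]
        Cinf_on_pullback that
    by (auto intro: Ck_on_linear_comp Ck_on_linear)
  show "Ck_on k jet_domain prolongation"
    unfolding prolongation_def[abs_def] correction_y_def correction_z_def using Cinf_on_pullback
    by (intro Ck_on_add Ck_on_scaleR Ck_on_diff Ck_on_mult Ck_on_const 1 bounded_linear_jet_sel) auto
qed

lemma prolongation_sel:
  "jx (prolongation w) = \<xi> (drop_y w)"
  "i < m \<Longrightarrow> jy i (prolongation w) = \<eta> i (drop_y w)"
  "j < n \<Longrightarrow> jz j (prolongation w) = \<zeta> j (drop_y w)"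
  "jy m (prolongation w) = jy (m - 1) (dd (total_derivative w) pullback w) - jy m w * jx
      (dd (total_derivative w) pullback w)"
  "jz n (prolongation w) = jz (n - 1) (dd (total_derivative w) pullback w) - jz n w * jx
      (dd (total_derivative w) pullback w)"
  by (auto simp: prolongation_def card correction_y_def correction_z_def pullback_def)

lemma dd_pullback:
  assumes "w \<in> jet_domain" shows "dd a pullback w = dd (drop_y a) v (drop_y w)"
proof -
  have "dd a pullback w = dd (dd a drop_y w) v (drop_y w)"
    unfolding pullback_def[abs_def]
    using assms Cinf_on_differentiable[OF v] bounded_linear_imp_differentiable[OF linear_drop_y]
    by (intro dd_chain[where f=drop_y and g=v]) (auto simp: jet_domain_def)
  then show ?thesis by (simp add: dd_linear[OF linear_drop_y])
qed

text \<open>The ambient total derivative moves \<open>y_(m-1)\<close> at the rate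
  \<open>y_m\<close>, whereas \<open>D\<close> moves it at the rate \<open>F\<close>. The excess
  vanishes exactly on the equation and points in the direction \<open>\<partial>'\<close>.\<close>

lemma drop_total_derivative:
  "(drop_y (total_derivative w) :: ('r, 'q) jet) = dvec (drop_y w) + (jy m w - F (drop_y w)) *\<^sub>R e'"
  using mn by (intro jet_eqI) (auto simp: total_derivative_def card yn_def less_Suc_eq Suc_lessI dest:
      Suc_lessI)

lemma drop_cartan:
  fixes a w :: "('p, 'q) jet"
  assumes "a \<in> cartan m n w"
  shows "(drop_y a :: ('r, 'q) jet) = jx a *\<^sub>R drop_y (total_derivative w) + jz n a *\<^sub>R en"
  using assms by (intro jet_eqI) (auto simp: total_derivative_def card cartan_def less_Suc_eq)

text \<open>A Cartan vector projects to a combination of \<open>D + (y_m - F) \<partial>'\<close>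
  and \<open>\<partial>_n\<close>. Below the top order the \<open>D\<close> part is covered by
  \<open>vy\<close> and \<open>vz\<close>, the \<open>\<partial>'\<close> part by
  \<open>vertical_y\<close> and \<open>vertical_z\<close>, and the \<open>\<partial>_n\<close> part
  is zero because \<open>\<partial>_n \<xi> = 0\<close>. At the top order the condition holds by the
  choice of the last two components.\<close>

lemma prolongation_contact:
  assumes w: "w \<in> jet_domain" and a: "a \<in> cartan m n w"
  shows "i < m \<Longrightarrow> jy i (dd a prolongation w) = jy (Suc i) (prolongation w) * jx a + jy (Suc i) w * jx
      (dd a prolongation w)"
    and "j < n \<Longrightarrow> jz j (dd a prolongation w) = jz (Suc j) (prolongation w) * jx a + jz (Suc j) w * jx
        (dd a prolongation w)"
proof -
  define u :: "('r, 'q) jet" where "u = drop_y w"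
  have u: "u \<in> S" using w by (simp add: jet_domain_def u_def)
  have dv: "v differentiable at u" by (rule Cinf_on_differentiable[OF v u])
  have dp: "prolongation differentiable at w"
      by (rule Cinf_on_differentiable[OF Cinf_on_prolongation w])
  have dpb: "pullback differentiable at w" by (rule Cinf_on_differentiable[OF Cinf_on_pullback w])
  have same: "l (dd a prolongation w) = l (dd (drop_y a) v u)"
    if "bounded_linear l" "\<And>w. l (prolongation w) = l (pullback w)" for l :: "('p, 'q) jet \<Rightarrow> real"
    using that dd_linear_comp[OF that(1) dp, of a] dd_linear_comp[OF that(1) dpb, of a] dd_pullback[OF
        w, of a] by (simp add: u_def)
  have x: "jx (dd a prolongation w) = jx (dd (drop_y a) v u)"
    and y: "\<And>i. i < m \<Longrightarrow> jy i (dd a prolongation w) = jy i (dd (drop_y a) v u)"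
    and z: "\<And>j. j < n \<Longrightarrow> jz j (dd a prolongation w) = jz j (dd (drop_y a) v u)"
    by (intro same bounded_linear_jet_sel; simp add: prolongation_sel pullback_def)+
  define t where "t = dd (drop_y (total_derivative w)) v u"
  define e where "e = dd en v u"
  define h where "h = dd e' v u"
  have da: "dd (drop_y a) v u = jx a *\<^sub>R t + jz n a *\<^sub>R e"
    unfolding drop_cartan[OF a] t_def e_def by (simp add: dd_add_dir[OF dv] dd_scaleR_dir[OF dv])
  have t: "t = dd (dvec u) v u + (jy m w - F u) *\<^sub>R h"
    unfolding t_def h_def drop_total_derivative by (simp add: u_def dd_add_dir[OF dv[unfolded u_def]]
        dd_scaleR_dir[OF dv[unfolded u_def]])
  have tp: "dd (total_derivative w) pullback w = t" unfolding dd_pullback[OF w] t_def u_def ..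
  have ex: "jx e = 0" using characteristic_preserved[OF u] by (simp add: e_def dd_components[OF u])
  have ey: "jy i e = 0" if "i < m" for i using vy[OF u disjI2[OF refl] that] ex
      by (simp add: e_def card)
  have ez: "jz j e = 0" if "j < n" for j using vz[OF u disjI2[OF refl] that] ex
      by (simp add: e_def card)
  show "jy i (dd a prolongation w) = jy (Suc i) (prolongation w) * jx a + jy (Suc i) w * jx
      (dd a prolongation w)" if i: "i < m"
  proof (cases "Suc i = m")
    case True
    then have "i = m - 1" by simp
    then show ?thesis using i True by (simp add: x y da ex ey prolongation_sel tp algebra_simps)
  next
    case False
    then have i': "Suc i < m" using i by simp
    have "jy i h = jy (Suc i) u * jx h" using vertical_y[OF u i']
        by (simp add: h_def dd_components[OF u])
    moreover have "jy i (dd (dvec u) v u) = jy (Suc i) (v u) + jy (Suc i) u * jx (dd (dvec u) v u)"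
      using vy[OF u disjI1[OF refl] i] i' by (simp add: yn_def)
    moreover have "jy (Suc i) u = jy (Suc i) w" using i' by (simp add: u_def card)
    ultimately show ?thesis using i i' by (simp add: x y da ex ey t prolongation_sel u_def[symmetric]
        algebra_simps)
  qed
  show "jz j (dd a prolongation w) = jz (Suc j) (prolongation w) * jx a + jz (Suc j) w * jx
      (dd a prolongation w)" if j: "j < n"
  proof (cases "Suc j = n")
    case True
    then have "j = n - 1" by simp
    then show ?thesis using j True by (simp add: x z da ex ez prolongation_sel tp algebra_simps)
  next
    case False
    then have j': "Suc j < n" using j by simp
    have "jz j h = jz (Suc j) u * jx h" using vertical_z[OF u j']
        by (simp add: h_def dd_components[OF u])
    moreover have "jz j (dd (dvec u) v u) = jz (Suc j) (v u) + jz (Suc j) u * jx (dd (dvec u) v u)"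
      using vz[OF u disjI1[OF refl] j] by simp
    moreover have "jz (Suc j) u = jz (Suc j) w" by (simp add: u_def)
    ultimately show ?thesis using j j' by (simp add: x z da ex ez t prolongation_sel u_def[symmetric]
        algebra_simps)
  qed
qed

lemma infinitesimal_lie_prolongation: "infinitesimal_lie_on m n jet_domain prolongation"
  unfolding infinitesimal_lie_on_def
proof
  show "smooth_on jet_domain prolongation"
      by (rule Cinf_on_imp_smooth_on[OF open_jet_domain Cinf_on_prolongation])
  have "flow_preserves jet_domain (\<lambda>w. {v. contact_projection m n w v = 0}) prolongation"
  proof (rule flow_preserves_kernel[OF open_jet_domain Cinf_on_prolongation linear_contact_projection
        Cinf_on_contact_projection[OF open_jet_domain] contact_projection_idem[OF card_less]])
    fix w a :: "('p, 'q) jet" assume w: "w \<in> jet_domain" and "contact_projection m n w a = 0"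
    then have a: "a \<in> cartan m n w" by (simp add: cartan_eq_kernel[OF card_less])
    show "dd (prolongation w) (\<lambda>w. contact_projection m n w a) w + contact_projection m n w
        (dd a prolongation w) = 0"
      by (rule jet_eqI)
        (auto simp: dd_contact_projection contact_projection_sel prolongation_contact[OF w a])
  qed
  then show "flow_preserves jet_domain (cartan m n) prolongation"
    by (simp add: cartan_eq_kernel[OF card_less, abs_def])
qed

text \<open>On the equation the total derivative projects to \<open>D\<close>, and there
  \<open>vy\<close> at \<open>m - 1\<close> and \<open>vz\<close> at \<open>n - 1\<close> are the
  prolongation formulas themselves.\<close>

lemma prolongation_on_equation:
  assumes w: "w \<in> monge m U F" "w \<in> jet_domain" shows "prolongation w = v (drop_y w)"
proof -
  define u :: "('r, 'q) jet" where "u = drop_y w"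
  have u: "u \<in> S" using w by (simp add: jet_domain_def u_def)
  have F: "jy m w = F u" using w by (simp add: monge_def u_def)
  have t: "dd (total_derivative w) pullback w = dd (dvec u) v u"
    by (simp add: dd_pullback[OF w(2)] drop_total_derivative u_def[symmetric] F)
  have "correction_y w = 0"
    using vy[OF u disjI1[OF refl], of "m - 1"] mn(1) by (simp add: correction_y_def t F yn_def
        pullback_def u_def[symmetric])
  moreover have "correction_z w = 0"
    using vz[OF u disjI1[OF refl], of "n - 1"] n_ge by (simp add: correction_z_def t pullback_def u_def)
  ultimately show ?thesis by (simp add: prolongation_def pullback_def)
qed

end

section \<open>Internal versus external symmetries\<close>

context monge_equation
begin

lemma internal_imp_external:
  fixes V :: "('p, 'q) jet \<Rightarrow> ('p, 'q) jet"
  assumes Fzz: "\<And>u. u \<in> U \<Longrightarrow> dd en (dd en F) u \<noteq> 0"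
    and p: "p \<in> monge m U F" "p \<in> W" and W: "open W" and V: "internal_symmetry_on m n U F W V"
  obtains W' X where "open W'" "p \<in> W'" "external_symmetry_on m n U F W' X"
    "\<And>w. w \<in> monge m U F \<inter> W' \<Longrightarrow> X w = V w"
proof -
  have sm: "smooth_on (monge m U F \<inter> W) V" and tang: "\<And>w. w \<in> monge m U F \<inter> W
      \<Longrightarrow> V w \<in> monge_tangent m F w"
    and flow: "flow_preserves (monge m U F \<inter> W) (monge_distribution m n F) V"
    using V by (auto simp: internal_symmetry_on_def)
  obtain W1 g where W1: "open W1" "p \<in> W1" "Cinf_on W1 g" "\<And>w. w \<in> W1 \<inter> (monge m U F \<inter> W) \<Longrightarrow> g w = V w"
    using sm p unfolding smooth_on_def by (metis IntI)
  define W0 where "W0 = W1 \<inter> W"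
  have W0: "open W0" "W0 \<subseteq> W" "Cinf_on W0 g" "\<And>w. w \<in> monge m U F \<inter> W0 \<Longrightarrow> g w = V w"
    using W1 W Ck_on_subset[of _ W1 g W0] by (auto simp: W0_def)
  define S where "S = {u \<in> U. lift u \<in> W0}"
  have S: "open S" "S \<subseteq> U"
    using continuous_open_preimage[OF Cinf_on_continuous[OF Cinf_on_lift[OF U order_refl]] U W0(1)]
    by (auto simp: S_def vimage_def Int_def)
  have v: "Cinf_on S (\<lambda>u. g (lift u))"
    by (intro allI, rule Ck_on_compose[where f=lift and g=g and T=W0, OF _ spec[OF Cinf_on_lift[OF S]]
        spec[OF W0(3)]])
      (auto simp: S_def)
  interpret internal_field m n U F ptype S "\<lambda>u. g (lift u)"
  proof
    fix u a assume u: "u \<in> S" and a: "a = dvec u \<or> a = en"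
    have u': "u \<in> U" "lift u \<in> W0" using u by (auto simp: S_def)
    show "jy i (dd a (\<lambda>u. g (lift u)) u) = jy (Suc i) (g (lift u)) * jx a + yn i u * jx (dd a (\<lambda>u. g
        (lift u)) u)" if "i < m" for i
      by (rule internal_symmetry_contact(1)[OF W flow W0 u' a that])
    show "jz j (dd a (\<lambda>u. g (lift u)) u) = jz (Suc j) (g (lift u)) * jx a + jz (Suc j) u * jx (dd a (\<lambda>u.
        g (lift u)) u)" if "j < n" for j
      by (rule internal_symmetry_contact(2)[OF W flow W0 u' a that])
  qed (use S v Fzz in auto)
  have jet_domain_iff: "w \<in> jet_domain \<longleftrightarrow> drop_y w \<in> U \<and> lift (drop_y w) \<in> W0" for w
    unfolding jet_domain_def unfolding S_def by simp
  have eq: "prolongation w = V w" and inW: "w \<in> W" if w: "w \<in> monge m U F \<inter> jet_domain" for w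
  proof -
    have "lift (drop_y w) = w" using w by (intro lift_drop) auto
    moreover have "lift (drop_y w) \<in> W0" using w jet_domain_iff by blast
    ultimately show "prolongation w = V w" "w \<in> W"
      using prolongation_on_equation[of w] w W0 by auto
  qed
  show ?thesis
  proof (rule that[OF open_jet_domain])
    have "lift (drop_y p) = p" by (rule lift_drop[OF p(1)])
    then show "p \<in> jet_domain" using p W1(2) unfolding jet_domain_iff by (auto simp: W0_def monge_def)
    show "external_symmetry_on m n U F jet_domain prolongation"
      unfolding external_symmetry_on_def using infinitesimal_lie_prolongation eq inW tang by auto
  qed (rule eq)
qed

text \<open>With \<open>G = y_m - F\<close> and \<open>K\<close> the derivative of \<open>G\<close>
  along \<open>X\<close>, tangency makes \<open>K\<close> vanish on the equation; hence
  \<open>K\<close> is bounded by a multiple of \<open>G\<close> nearby, and Gronwall keeps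
  \<open>G = 0\<close> along the flow. The differentials then map the distribution into itself, and
  a dimension count turns this inclusion into an equality.\<close>

lemma external_imp_internal:
  fixes X :: "('p, 'q) jet \<Rightarrow> ('p, 'q) jet"
  assumes W: "open W" and X: "external_symmetry_on m n U F W X"
  shows "internal_symmetry_on m n U F W X"
proof -
  let ?M = "monge m U F \<inter> W" and ?D = "monge_distribution m n F"
  have sm: "smooth_on W X" and flow: "flow_preserves W (cartan m n) X"
    and tang: "\<And>w. w \<in> ?M \<Longrightarrow> X w \<in> monge_tangent m F w"
    using X by (auto simp: external_symmetry_on_def infinitesimal_lie_on_def)
  have Xs: "Cinf_on W X" by (rule smooth_on_open_imp_Cinf_on[OF W sm])
  define Z where "Z = {w \<in> W. drop_y w \<in> U}"
  have Z: "open Z" "Z \<subseteq> W"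
    using open_Int[OF W open_vimage[OF U linear_continuous_on[OF linear_drop_y]]]
    by (auto simp: Z_def vimage_def Int_def)
  define G where "G w = jy m w - F (drop_y w)" for w :: "('p, 'q) jet"
  have G: "Cinf_on Z G"
    unfolding G_def[abs_def]
    by (intro allI, rule Ck_on_diff[OF Ck_on_linear[OF bounded_linear_jet_sel(2)]
          Ck_on_compose[where f=drop_y and g=F and T=U, OF _ Ck_on_linear[OF linear_drop_y]
              spec[OF F]]])
      (auto simp: Z_def)
  have dG: "dd a G w = jy m a - dd (drop_y a) F (drop_y w)" if "w \<in> Z" for a w
  proof -
    have u: "drop_y w \<in> U" using that by (simp add: Z_def)
    have "(G has_derivative (\<lambda>a. jy m a - dd (drop_y a) F (drop_y w))) (at w)"
      unfolding G_def[abs_def]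
      by (intro has_derivative_diff bounded_linear_imp_has_derivative[OF bounded_linear_jet_sel(2)]
          has_derivative_compose[where f=drop_y and g=F, OF bounded_linear_imp_has_derivative[OF
              linear_drop_y] has_derivative_ddI[OF F_differentiable[OF u]]])
    then show ?thesis by (rule has_derivative_dd)
  qed
  have tangent_iff: "a \<in> monge_tangent m F w \<longleftrightarrow> dd a G w = 0" if "w \<in> Z" for a w
    using dG[OF that] by (simp add: monge_tangent_def dd_def)
  have monge_iff: "w \<in> ?M \<longleftrightarrow> w \<in> Z \<and> G w = 0" for w
    by (auto simp: monge_def Z_def G_def)
  define K where "K w = dd (X w) G w" for w
  have K: "Cinf_on Z K"
    unfolding K_def[abs_def] using Xs Z Ck_on_subset by (intro Cinf_on_dd_field Z G) blast
  have K0: "K w = 0" if "w \<in> ?M" for w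
    using tang[OF that] tangent_iff[of w "X w"] that monge_iff[of w] by (simp add: K_def)
  have "flow_preserves ?M ?D X"
    unfolding flow_preserves_def
  proof
    fix q assume q: "q \<in> ?M"
    then have qZ: "q \<in> Z" and qG: "G q = 0" using monge_iff[of q] by auto
    obtain \<epsilon> N \<phi> where qN: "q \<in> N" and lf: "local_flow W X \<epsilon> N \<phi>"
      and pres: "\<And>t w. \<bar>t\<bar> < \<epsilon> \<Longrightarrow> w \<in> N \<Longrightarrow> preserves_at W (cartan m n) (\<phi> t) w"
      using flow q unfolding flow_preserves_def by (metis IntD2)
    have \<epsilon>: "0 < \<epsilon>" and N: "openin (top_of_set W) N" and \<phi>0: "\<And>w. w \<in> N \<Longrightarrow> \<phi> 0 w = w"
      and \<phi>W: "\<And>t w. w \<in> N \<Longrightarrow> \<bar>t\<bar> < \<epsilon> \<Longrightarrow> \<phi> t w \<in> W"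
      and \<phi>': "\<And>t w. w \<in> N \<Longrightarrow> \<bar>t\<bar> < \<epsilon> \<Longrightarrow> ((\<lambda>s. \<phi> s w) has_vector_derivative X (\<phi> t w)) (at t)"
      using lf unfolding local_flow_def by auto
    have oN: "open N" by (rule openin_open_trans[OF N W])
    obtain \<delta> where \<delta>: "0 < \<delta>" "cball q \<delta> \<subseteq> Z" using qZ Z by (meson open_contains_cball)
    have "Ck_on 1 Z K" using K by blast
    then obtain L where L: "0 \<le> L" "\<And>x y. x \<in> cball q \<delta> \<Longrightarrow> y \<in> cball q \<delta> \<Longrightarrow> norm (K x - K y)
        \<le> L * norm (x - y)"
      using C1_lipschitz[OF Z(1) _ compact_cball convex_cball \<delta>(2)] by metis
    have "compact (X ` cball q \<delta>)"
      using \<delta> Z by (intro compact_continuous_image continuous_on_subset[OF Cinf_on_continuous[OF Xs]])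
          auto
    then obtain B where B: "0 < B" "\<And>x. x \<in> cball q \<delta> \<Longrightarrow> norm (X x) \<le> B"
      by (force dest!: compact_imp_bounded simp: bounded_pos)
    have "continuous_on Z (\<lambda>w. w - G w *\<^sub>R (ey m :: ('p, 'q) jet))"
      by (intro continuous_intros Cinf_on_continuous G)
    then have "isCont (\<lambda>w. w - G w *\<^sub>R (ey m :: ('p, 'q) jet)) q" using qZ Z
        by (simp add: continuous_on_eq_continuous_at)
    then obtain d where d: "0 < d" "\<And>w. dist w q < d \<Longrightarrow> dist (w - G w *\<^sub>R (ey m :: ('p, 'q) jet)) q < \<delta>"
      using \<delta>(1) qG unfolding continuous_at_eps_delta by (metis diff_zero scaleR_zero_left)
    \<comment> \<open>Within this radius, moving a point to the equation along the
      \<open>y_m\<close> axis does not leave the ball of radius \<open>\<delta>\<close>.\<close>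
    define r where "r = min d \<delta>"
    have r: "0 < r" "r \<le> \<delta>" "\<And>w. w \<in> ball q r \<Longrightarrow> w - G w *\<^sub>R ey m \<in> cball q \<delta>"
      using d \<delta>(1) by (auto simp: r_def dist_commute less_imp_le)
    \<comment> \<open>Compare \<open>w\<close> with the point of the equation below it on the
      \<open>y_m\<close> axis: \<open>K\<close> vanishes there, and the distance is a multiple of
      the absolute value of \<open>G w\<close>.\<close>
    have Kbd: "norm (K w) \<le> (L * norm (ey m :: ('p, 'q) jet)) * norm (G w)" if "w \<in> ball q r" for w
    proof -
      let ?w = "w - G w *\<^sub>R ey m :: ('p, 'q) jet"
      have w: "w \<in> cball q \<delta>" "w \<in> Z" using that r(2) \<delta>(2) by auto
      have "?w = lift (drop_y w)" using diff_lift_drop[of w] by (simp add: G_def algebra_simps)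
      then have "?w \<in> monge m U F" using lift_in_monge w(2) by (simp add: Z_def)
      moreover have "?w \<in> W" using r(3)[OF that] \<delta>(2) Z(2) by blast
      ultimately have "K ?w = 0" by (intro K0) auto
      then have "norm (K w) = norm (K w - K ?w)" by simp
      also have "\<dots> \<le> L * norm (w - ?w)" by (rule L(2)[OF w(1) r(3)[OF that]])
      finally show ?thesis by (simp add: mult_ac)
    qed
    define C where "C = L * norm (ey m :: ('p, 'q) jet)"
    have C: "0 \<le> C" using L(1) by (simp add: C_def)
    \<comment> \<open>The bounds provide existence of the flow, confinement to the ball of radius
      \<open>r\<close>, and the Gronwall condition with constant \<open>C\<close>.\<close>
    define \<epsilon>1 where "\<epsilon>1 = Min {\<epsilon>, r / (2 * B), 1 / (2 * (C + 1))}"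
    have e1: "0 < \<epsilon>1" "\<epsilon>1 \<le> \<epsilon>" using \<epsilon> r(1) B(1) C by (auto simp: \<epsilon>1_def)
    have "\<epsilon>1 \<le> r / (2 * B)" "\<epsilon>1 \<le> 1 / (2 * (C + 1))" unfolding \<epsilon>1_def by (intro Min_le; simp)+
    then have "\<epsilon>1 * (2 * B) \<le> r" "\<epsilon>1 * (2 * (C + 1)) \<le> 1"
      using B(1) C by (simp_all add: pos_le_divide_eq del: distrib_left_numeral)
    then have e2: "B * \<epsilon>1 \<le> r / 2" "C * \<epsilon>1 \<le> 1 / 2" using e1 by (auto simp: algebra_simps)
    have inb: "\<phi> t w \<in> ball q r" if "w \<in> N" "w \<in> ball q (r / 2)" "\<bar>t\<bar> < \<epsilon>1" for t w
    proof (rule stays_in_ball[where \<epsilon>=\<epsilon>1 and u="\<lambda>t. \<phi> t w" and B=B])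
      show "((\<lambda>t. \<phi> t w) has_vector_derivative X (\<phi> t w)) (at t)" if "\<bar>t\<bar> < \<epsilon>1" for t
        using \<phi>' that e1 \<open>w \<in> N\<close> by auto
      show "norm (X (\<phi> t w)) \<le> B" if "\<bar>t\<bar> < \<epsilon>1" "\<phi> t w \<in> ball q r" for t
        using B(2)[of "\<phi> t w"] that(2) r(2) by auto
      show "B * \<bar>t\<bar> \<le> r / 2" using mult_left_mono[OF less_imp_le[OF that(3)], of B] B(1) e2 by linarith
    qed (use that \<phi>0 in auto)
    have onE: "\<phi> t w \<in> ?M" if w: "w \<in> N" "w \<in> ball q (r / 2)" "w \<in> ?M" and t: "\<bar>t\<bar> < \<epsilon>1" for t w
    proof -
      have "G (\<phi> t w) = 0"
      proof (rule gronwall_zero[where u="\<lambda>t. G (\<phi> t w)" and L=C and \<epsilon>=\<epsilon>1])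
        fix s assume s: "\<bar>s\<bar> < \<epsilon>1"
        have b: "\<phi> s w \<in> ball q r" by (rule inb[OF w(1,2) s])
        then have "\<phi> s w \<in> Z" using r(2) \<delta>(2) by auto
        then have d: "G differentiable at (\<phi> s w)" by (rule Cinf_on_differentiable[OF G])
        have "((\<lambda>s. \<phi> s w) has_derivative (\<lambda>h. h *\<^sub>R X (\<phi> s w))) (at s)"
          using \<phi>'[OF w(1), of s] s e1 by (simp add: has_vector_derivative_def)
        from has_derivative_compose[OF this has_derivative_ddI[OF d]]
        show "((\<lambda>s. G (\<phi> s w)) has_vector_derivative K (\<phi> s w)) (at s)"
          unfolding has_vector_derivative_def K_def by (simp add: dd_scaleR_dir[OF d])
        show "norm (K (\<phi> s w)) \<le> C * norm (G (\<phi> s w))" unfolding C_def by (rule Kbd[OF b])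
      qed (use C e2 t \<phi>0 w monge_iff in auto)
      moreover have "\<phi> t w \<in> Z" using inb[OF w(1,2) t] r(2) \<delta>(2) by auto
      ultimately show ?thesis using monge_iff by blast
    qed
    show "\<exists>\<epsilon> N \<phi>. q \<in> N \<and> local_flow ?M X \<epsilon> N \<phi> \<and>
        (\<forall>t w. \<bar>t\<bar> < \<epsilon> \<longrightarrow> w \<in> N \<longrightarrow> preserves_at ?M ?D (\<phi> t) w)"
    proof (intro exI[of _ \<epsilon>1] exI[of _ "?M \<inter> (N \<inter> ball q (r / 2))"] exI[of _ \<phi>] conjI allI impI)
      show "q \<in> ?M \<inter> (N \<inter> ball q (r / 2))" using q qN r(1) by auto
      show "local_flow ?M X \<epsilon>1 (?M \<inter> (N \<inter> ball q (r / 2))) \<phi>"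
        unfolding local_flow_def
      proof (intro conjI ballI allI impI)
        show "openin (top_of_set ?M) (?M \<inter> (N \<inter> ball q (r / 2)))" using oN
            by (intro openin_open_Int) auto
        fix w assume w: "w \<in> ?M \<inter> (N \<inter> ball q (r / 2))"
        show "\<phi> 0 w = w" using w \<phi>0 by auto
        fix t assume t: "\<bar>t\<bar> < \<epsilon>1"
        show "\<phi> t w \<in> ?M" using w t by (intro onE) auto
        show "((\<lambda>s. \<phi> s w) has_vector_derivative X (\<phi> t w)) (at t)" using w t e1 by (intro \<phi>') auto
      qed (rule e1)
      fix t w assume t: "\<bar>t\<bar> < \<epsilon>1" and w': "w \<in> ?M \<inter> (N \<inter> ball q (r / 2))"
      then have w: "w \<in> N" "w \<in> ball q (r / 2)" "w \<in> ?M" by auto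
      have E: "\<phi> t w \<in> ?M" using onE[OF w t] .
      obtain A where A: "(\<phi> t has_derivative A) (at w within W)" "A ` cartan m n w = cartan m n (\<phi> t w)"
        using pres[of t w] t e1 w(1) unfolding preserves_at_def by auto
      note lin = has_derivative_linear[OF A(1)]
      have "at w within W = at w" using w(3) W by (intro at_within_open) auto
      then have A': "(\<phi> t has_derivative A) (at w)" using A(1) by simp
      \<comment> \<open>Membership in the Cartan space is given. For tangency, follow a curve in the
        equation with velocity \<open>a\<close>: the flow keeps it in the equation, so
        \<open>G\<close> is constant along its image and the derivative of \<open>G\<close> along
        \<open>A a\<close> is 0.\<close>
      have sub: "A a \<in> ?D (\<phi> t w)" if a: "a \<in> ?D w" for a
      proof -
        define u :: "('r, 'q) jet" where "u = drop_y w"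
        have u: "u \<in> U" "lift u = w" using w(3) lift_drop by (auto simp: u_def monge_def)
        have aeq: "a = dd (drop_y a) lift u"
          using a w(3) by (simp add: u_def monge_distribution_def monge_tangent_iff[symmetric])
        define c where "c s = lift (u + s *\<^sub>R drop_y a)" for s
        have line: "((\<lambda>s. u + s *\<^sub>R drop_y a) has_derivative (\<lambda>h. h *\<^sub>R drop_y a)) (at (0::real))"
          by (auto intro!: derivative_eq_intros)
        have dl: "lift differentiable at u" using Cinf_on_differentiable[OF Cinf_on_lift u(1)] U by simp
        have "(lift has_derivative (\<lambda>a. dd a lift u)) (at (u + 0 *\<^sub>R drop_y a))"
            using has_derivative_ddI[OF dl] by simp
        from has_derivative_compose[OF line this] have c': "(c has_derivative (\<lambda>h. h *\<^sub>R a)) (at 0)"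
          unfolding c_def by (simp add: dd_scaleR_dir[OF dl] aeq[symmetric])
        have c0: "c 0 = w" by (simp add: c_def u)
        have "eventually (\<lambda>s. u + s *\<^sub>R drop_y a \<in> U) (at (0::real))"
          using has_derivative_continuous[OF line] U u(1) unfolding continuous_within
          by (intro topological_tendstoD) auto
        moreover have "eventually (\<lambda>s. c s \<in> W \<inter> (N \<inter> ball q (r / 2))) (at 0)"
          using has_derivative_continuous[OF c'] W oN w c0 unfolding continuous_within
          by (intro topological_tendstoD) auto
        ultimately have ev: "eventually (\<lambda>s. G (\<phi> t (c s)) = 0) (at 0)"
        proof eventually_elim
          case (elim s)
          then have "\<phi> t (c s) \<in> ?M" using t by (intro onE) (auto simp: c_def lift_in_monge)
          then show ?case using monge_iff by blast
        qed
        have Gd: "G differentiable at (\<phi> t w)" using Cinf_on_differentiable[OF G] E monge_iff by blast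
        have 1: "(\<phi> t has_derivative A) (at (c 0))" using A' by (simp add: c0)
        have 2: "(G has_derivative (\<lambda>a. dd a G (\<phi> t w))) (at (\<phi> t (c 0)))"
            using has_derivative_ddI[OF Gd] by (simp add: c0)
        have comp: "((\<lambda>s. G (\<phi> t (c s))) has_derivative (\<lambda>h. dd (A (h *\<^sub>R a)) G (\<phi> t w))) (at 0)"
          by (rule has_derivative_compose[OF has_derivative_compose[OF c' 1] 2])
        have zero: "((\<lambda>s. G (\<phi> t (c s))) has_derivative (\<lambda>h::real. 0)) (at 0)"
          by (rule has_derivative_transform_eventually[OF has_derivative_const[of 0]])
            (use ev E monge_iff c0 in \<open>auto simp: eq_commute[of 0]\<close>)
        have "(\<lambda>h. dd (A (h *\<^sub>R a)) G (\<phi> t w)) = (\<lambda>h::real. 0)"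
            by (rule has_derivative_unique[OF comp zero])
        from fun_cong[OF this, of 1] have "dd (A a) G (\<phi> t w) = 0" by simp
        then have "A a \<in> monge_tangent m F (\<phi> t w)" using tangent_iff E monge_iff by blast
        then show ?thesis using A(2) a by (auto simp: monge_distribution_def)
      qed
      have "A ` ?D w = ?D (\<phi> t w)"
      proof (rule subspace_dim_equal)
        show "subspace (A ` ?D w)" "subspace (?D (\<phi> t w))"
          using w E by (auto intro: linear_subspace_image[OF lin] subspace_monge_distribution)
        show "A ` ?D w \<subseteq> ?D (\<phi> t w)" using sub by blast
        \<comment> \<open>The differential maps one Cartan space onto another of equal dimension, so
          it is injective there and in particular on the smaller space \<open>?D w\<close>.\<close>
        have "inj_on A (cartan m n w)"
          by (rule inj_on_subspace_of_dim_image[OF lin subspace_cartan]) (unfold A(2), rule dim_cartan)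
        then have "inj_on A (?D w)" by (rule inj_on_subset) (auto simp: monge_distribution_def)
        then have "dim (A ` ?D w) = dim (?D w)"
          using w(3) by (intro dim_image_subspace[OF lin] subspace_monge_distribution) auto
        moreover have "dim (?D (\<phi> t w)) \<le> dim (?D w)" using w E by (intro dim_monge_distribution_le)
            auto
        ultimately show "dim (?D (\<phi> t w)) \<le> dim (A ` ?D w)" by simp
      qed
      then show "preserves_at ?M ?D (\<phi> t) w"
        unfolding preserves_at_def using has_derivative_subset[OF A(1)] by blast
    qed
  qed
  moreover have "smooth_on ?M X" by (rule smooth_on_subset[OF sm]) simp
  ultimately show ?thesis using tang by (auto simp: internal_symmetry_on_def)
qed

end

text \<open>For an iterated \<open>deriv\<close> the inner derivative must be known on a
  neighbourhood of 0; openness of \<open>U\<close> provides it.\<close>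

lemma F_zz_eq:
  fixes F :: "('r::finite, 'q::finite) jet \<Rightarrow> real"
  assumes U: "open U" and F: "Cinf_on U F" and n: "n < CARD('q)" and u: "u \<in> U"
  shows "F_zz n F u = dd (ez n) (dd (ez n) F) u"
proof -
  let ?e = "ez n :: ('r, 'q) jet"
  have der: "((\<lambda>s. g (u + s *\<^sub>R ?e)) has_real_derivative dd ?e g (u + s *\<^sub>R ?e)) (at s)"
    if "Cinf_on U g" "u + s *\<^sub>R ?e \<in> U" for g :: "('r, 'q) jet \<Rightarrow> real" and s
    by (rule DERIV_along[OF Cinf_on_differentiable[OF that]])
  have "isCont (\<lambda>s::real. u + s *\<^sub>R ?e) 0" by (intro continuous_intros)
  then have "eventually (\<lambda>s. u + s *\<^sub>R ?e \<in> U) (nhds (0::real))"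
    using U u by (auto simp: isCont_def tendsto_def eventually_at_filter elim!: allE[of _ U]
        eventually_mono)
  then have "eventually (\<lambda>s. deriv (\<lambda>s. F (u + s *\<^sub>R ?e)) s = dd ?e F (u + s *\<^sub>R ?e)) (nhds 0)"
    by eventually_elim (rule DERIV_imp_deriv[OF der[OF F]])
  then have "deriv (deriv (\<lambda>s. F (u + s *\<^sub>R ?e))) 0 = deriv (\<lambda>s. dd ?e F (u + s *\<^sub>R ?e)) 0"
    by (rule deriv_cong_ev) simp
  also have "\<dots> = dd ?e (dd ?e F) u"
    using DERIV_imp_deriv[OF der[OF Cinf_on_dd[OF U F], of 0]] u by simp
  finally show ?thesis
    by (simp add: F_zz_def ez_eq_axis[OF n] numeral_2_eq_2)
qed

theorem theorem2:
  fixes m n :: nat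
    and U :: "('r::finite, 'q::finite) jet set"
    and F :: "('r, 'q) jet \<Rightarrow> real"
    and p :: "('p::finite, 'q) jet"
  assumes "CARD('r) = m" and "CARD('p) = m + 1" and "CARD('q) = n + 1"
    and "0 < m" and "m \<le> n" and "(m, n) \<noteq> (1, 1)" and "(m, n) \<noteq> (1, 2)"
    and "open U" and "smooth_on U F"
    and "\<forall>u\<in>U. F_zz n F u \<noteq> 0"
    and "p \<in> monge m U F"
  shows "internal_symmetry_germs m n U F p = external_symmetry_germs m n U F p"
proof -
  have F: "Cinf_on U F" by (rule smooth_on_open_imp_Cinf_on[OF assms(8,9)])
  interpret monge_equation m n U F "TYPE('p)"
    by unfold_locales (use assms F in auto)
  have Fzz: "dd en (dd en F) u \<noteq> 0" if "u \<in> U" for u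
    using F_zz_eq[OF assms(8) F _ that, of n] assms(3,10) that by auto
  show ?thesis
  proof (intro subset_antisym subsetI)
    fix V assume "V \<in> internal_symmetry_germs m n U F p"
    then obtain W V0 where V0: "V = germ_along (monge m U F) p V0" "open W" "p \<in> W"
        "internal_symmetry_on m n U F W V0"
      unfolding internal_symmetry_germs_def by blast
    obtain W' X where X: "open W'" "p \<in> W'" "external_symmetry_on m n U F W' X"
        "\<And>w. w \<in> monge m U F \<inter> W' \<Longrightarrow> X w = V0 w"
      using internal_imp_external[OF Fzz assms(11) V0(3,2,4)] by metis
    have "eventually (\<lambda>q. q \<in> W') (nhds p)" using X by (simp add: eventually_nhds_in_open)
    then have ev: "eventually (\<lambda>q. q \<in> monge m U F \<longrightarrow> X q = V0 q) (nhds p)"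
      by eventually_elim (use X(4) in auto)
    have "germ_along (monge m U F) p V0 = germ_along (monge m U F) p X"
      unfolding germ_along_def
    proof (intro Collect_cong iffI)
      fix V' assume "\<forall>\<^sub>F q in nhds p. q \<in> monge m U F \<longrightarrow> V' q = V0 q"
      with ev show "\<forall>\<^sub>F q in nhds p. q \<in> monge m U F \<longrightarrow> V' q = X q" by eventually_elim auto
    next
      fix V' assume "\<forall>\<^sub>F q in nhds p. q \<in> monge m U F \<longrightarrow> V' q = X q"
      with ev show "\<forall>\<^sub>F q in nhds p. q \<in> monge m U F \<longrightarrow> V' q = V0 q" by eventually_elim auto
    qed
    with V0(1) X show "V \<in> external_symmetry_germs m n U F p"
      unfolding external_symmetry_germs_def by blast
  next
    fix V assume "V \<in> external_symmetry_germs m n U F p"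
    \<comment> \<open>The same field on the same neighbourhood represents the germ on both
      sides.\<close>
    then show "V \<in> internal_symmetry_germs m n U F p"
      unfolding external_symmetry_germs_def internal_symmetry_germs_def
      using external_imp_internal by blast
  qed
qed

end
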